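(* Let $\mathcal{D}=\mathbb{R}^2\setminus(\mathcal{O}_1\cup\mathcal{O}_2\cup\mathcal{O}_3)$ be a billiard table as in the context. Let $\sigma=(\sigma_1\sigma_0)\in\{1,2,3\}^2$ with $\sigma_0\neq\sigma_1$, let $\tau_1$ be such that $\{\tau_1,\sigma_0,\sigma_1\}=\{1,2,3\}$, and set $\tau:=(\tau_1\sigma_0)$. Let $\lambda<1<\mu=\lambda^{-1}$ be the eigenvalues of $D\mathcal{F}^2$ at the points of the period two orbit labelled by $\sigma$. Let $\mathcal{L}^\infty:=\lim_{n\to+\infty}\big(\mathcal{L}(\tau\sigma^n)-(n+1)\mathcal{L}(\sigma)\big)\in\mathbb{R}$. Then $$\mathrm{LE}(\sigma)=\frac12\log(\mu)=-\frac12\log(\lambda)=-\lim_{n\to+\infty}\frac{1}{2n}\log\left(-\mathcal{L}(\tau\sigma^n)+(n+1)\mathcal{L}(\sigma)+\mathcal{L}^\infty\right).$$ In particular, the value of the Lyapunov exponent of $\sigma=(\sigma_1\sigma_0)$ is determined by the Marked Length Spectrum.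
   Context: Billiard table: $\mathcal{O}_1,\mathcal{O}_2,\mathcal{O}_3\subset\mathbb{R}^2$ are bounded strictly convex domains (obstacles) whose boundaries $\Gamma_i=\partial\mathcal{O}_i$ are of class at least $C^3$ with positive curvature, satisfying the non-eclipse condition: the convex hull of any two obstacles is disjoint from the third one. $\mathcal{D}=\mathbb{R}^2\setminus\bigcup_i\mathcal{O}_i$. Billiard map: the collision space $\mathcal{M}$ is the set of pairs $(q,v)$ with $q\in\bigcup_i\Gamma_i$ and $v$ a unit vector with $\langle v,n\rangle\ge 0$, where $n$ is the unit normal at $q$ pointing inside $\mathcal{D}$. Coordinates on $\mathcal{M}$ are $(s,\varphi)$, with $s$ the arc-length parameter of $q$ and $\varphi\in[-\frac{\pi}{2},\frac{\pi}{2}]$ the oriented angle between $n$ and $v$. $\mathcal{F}$ is the billiard map, sending a collision to the next one (straight flight in $\mathcal{D}$, then elastic reflection), defined where a next collision exists. Coding: a bi-infinite word $(\rho_j)_{j\in\mathbb{Z}}\in\{1,2,3\}^{\mathbb{Z}}$ is admissible if $\rho_{j+1}\neq\rho_j$ for all $j$; each admissible word is realized by exactly one orbit $(x_j)_{j\in\mathbb{Z}}$ of $\mathcal{F}$ with $x_j$ based on $\Gamma_{\rho_j}$. A finite word $\rho=(\rho_1\dots\rho_p)$, $p\ge2$, is admissible if its periodic repetition is; it labels a periodic orbit of period $p$, and $\mathcal{L}(\rho)$ is the length of this orbit (sum of the lengths of its $p$ segments). The Marked Length Spectrum is the function $\rho\mapsto\mathcal{L}(\rho)$ on finite admissible words.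 Words are concatenated by juxtaposition. For a periodic orbit of period $p$ labelled by $\rho$, $D\mathcal{F}^p$ at its points has determinant $1$ and is hyperbolic with eigenvalues $\lambda(\rho)<1<\mu(\rho)=\lambda(\rho)^{-1}$, and its Lyapunov exponent is $\mathrm{LE}(\rho)=\frac1p\log\mu(\rho)$. A quantity attached to tables is "determined by the Marked Length Spectrum" if it takes the same value on any two billiard tables that have the same Marked Length Spectrum and are each obtained by removing from $\mathbb{R}^2$ three bounded strictly convex domains with boundaries of class at least $C^3$ and of positive curvature, such that the convex hull of any two of the domains is disjoint from the third one. *)

theory Defs
  imports "HOL-Analysis.Analysis"
begin

text \<open>
  The Euclidean plane is \<^typ>\<open>complex\<close>, so that multiplication by \<^term>\<open>cis \<phi>\<close> is the rotation by
  the oriented angle \<open>\<phi>\<close>. The labels \<open>1, 2, 3\<close> of the obstacles are the elements of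
  the three-element type \<^typ>\<open>3\<close> (in which \<open>3 = 0\<close>).
\<close>

definition strictly_convex :: "complex set \<Rightarrow> bool" where
  "strictly_convex K \<longleftrightarrow>
     (\<forall>x\<in>closure K. \<forall>y\<in>closure K. x \<noteq> y \<longrightarrow> open_segment x y \<subseteq> interior K)"

text \<open>
  \<open>\<gamma>\<close> is a counterclockwise arc-length parametrization, of class \<open>C\<^sup>3\<close>, of the closed curve
  \<^term>\<open>frontier K\<close>. The signed curvature of a unit speed curve is the determinant
  \<open>det(\<gamma>', \<gamma>'') = Im (cnj \<gamma>' * \<gamma>'')\<close>; as \<open>K\<close> will be convex, its positivity
  also says that \<open>\<gamma>\<close> runs counterclockwise. Such a \<open>\<gamma>\<close> is unique up to the choice of
  the base point \<open>\<gamma> 0\<close>.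
\<close>

definition arclength_param :: "complex set \<Rightarrow> (real \<Rightarrow> complex) \<Rightarrow> bool" where
  "arclength_param K \<gamma> \<longleftrightarrow>
     (\<exists>T>0. (\<forall>s. \<gamma> (s + T) = \<gamma> s) \<and> inj_on \<gamma> {0..<T}) \<and> range \<gamma> = frontier K \<and>
     (\<exists>\<gamma>1 \<gamma>2 \<gamma>3.
        (\<forall>s. (\<gamma> has_vector_derivative \<gamma>1 s) (at s) \<and>
             (\<gamma>1 has_vector_derivative \<gamma>2 s) (at s) \<and>
             (\<gamma>2 has_vector_derivative \<gamma>3 s) (at s)) \<and>
        continuous_on UNIV \<gamma>3 \<and>
        (\<forall>s. norm (\<gamma>1 s) = 1) \<and>
        (\<forall>s. Im (cnj (\<gamma>1 s) * \<gamma>2 s) > 0))"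

definition obstacle :: "complex set \<Rightarrow> bool" where
  "obstacle K \<longleftrightarrow> open K \<and> connected K \<and> K \<noteq> {} \<and> bounded K \<and> strictly_convex K \<and>
     (\<exists>\<gamma>. arclength_param K \<gamma>)"

text \<open>
  The obstacles are open sets, and the non-eclipse condition is imposed on their closures.
  For the open sets themselves it would allow two obstacles to touch each other, or a
  segment joining two obstacles to graze the third one.
\<close>

definition non_eclipse :: "(3 \<Rightarrow> complex set) \<Rightarrow> bool" where
  "non_eclipse \<O> \<longleftrightarrow> (\<forall>i j k. i \<noteq> j \<and> k \<noteq> i \<and> k \<noteq> j \<longrightarrow>
     convex hull (closure (\<O> i) \<union> closure (\<O> j)) \<inter> closure (\<O> k) = {})"

definition billiard_table :: "(3 \<Rightarrow> complex set) \<Rightarrow> bool" where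
  "billiard_table \<O> \<longleftrightarrow> (\<forall>i. obstacle (\<O> i)) \<and> non_eclipse \<O>"

text \<open>
  The unit normal at \<open>q \<in> frontier K\<close> pointing out of the obstacle \<open>K\<close>, hence into the table;
  it is unique because the boundary is differentiable.
\<close>

definition unit_normal :: "complex set \<Rightarrow> complex \<Rightarrow> complex" where
  "unit_normal K q = (THE n. norm n = 1 \<and> (\<forall>x\<in>K. (x - q) \<bullet> n \<le> 0))"

definition collision_space :: "(3 \<Rightarrow> complex set) \<Rightarrow> (complex \<times> complex) set" where
  "collision_space \<O> =
     {(q, v). norm v = 1 \<and> (\<exists>i. q \<in> frontier (\<O> i) \<and> v \<bullet> unit_normal (\<O> i) q \<ge> 0)}"

text \<open>
  The billiard map is a partial map, represented by its graph:
  \<^term>\<open>billiard_map \<O> x y\<close> says that the next collision after \<open>x\<close> exists and is \<open>y\<close>.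
\<close>

definition billiard_map :: "(3 \<Rightarrow> complex set) \<Rightarrow> complex \<times> complex \<Rightarrow> complex \<times> complex \<Rightarrow> bool" where
  "billiard_map \<O> = (\<lambda>(q, v) (q', v').
     (q, v) \<in> collision_space \<O> \<and>
     (\<exists>t>0. \<exists>i. q' = q + t *\<^sub>R v \<and> q' \<in> frontier (\<O> i) \<and>
        (\<forall>u. 0 < u \<and> u < t \<longrightarrow> (\<forall>k. q + u *\<^sub>R v \<notin> closure (\<O> k))) \<and>
        v' = v - (2 * (v \<bullet> unit_normal (\<O> i) q')) *\<^sub>R unit_normal (\<O> i) q'))"

lemma billiard_map_right_unique:
  assumes "billiard_table \<O>" "billiard_map \<O> x y" "billiard_map \<O> x z"
  shows "y = z"
proof -
  obtain q v q1 v1 q2 v2 where [simp]: "x = (q, v)" "y = (q1, v1)" "z = (q2, v2)"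
    by (cases x, cases y, cases z)
  from assms(2) obtain t i where t: "t > 0" "q1 = q + t *\<^sub>R v" "q1 \<in> frontier (\<O> i)"
      "\<And>u k. 0 < u \<Longrightarrow> u < t \<Longrightarrow> q + u *\<^sub>R v \<notin> closure (\<O> k)"
      "v1 = v - (2 * (v \<bullet> unit_normal (\<O> i) q1)) *\<^sub>R unit_normal (\<O> i) q1"
    by (auto simp: billiard_map_def)
  from assms(3) obtain s j where s: "s > 0" "q2 = q + s *\<^sub>R v" "q2 \<in> frontier (\<O> j)"
      "\<And>u k. 0 < u \<Longrightarrow> u < s \<Longrightarrow> q + u *\<^sub>R v \<notin> closure (\<O> k)"
      "v2 = v - (2 * (v \<bullet> unit_normal (\<O> j) q2)) *\<^sub>R unit_normal (\<O> j) q2"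
    by (auto simp: billiard_map_def)
  have clos: "q1 \<in> closure (\<O> i)" "q2 \<in> closure (\<O> j)"
    using t(3) s(3) by (auto simp: frontier_def)
  have "\<not> t < s" "\<not> s < t"
    using s(4)[of t i] t(4)[of s j] t(1,2) s(1,2) clos by auto
  then have ts: "t = s" by simp
  have "i = j"
  proof (rule ccontr)
    assume ij: "i \<noteq> j"
    have "card {i, j} < CARD(3)"
      using ij by simp
    then have "{i, j} \<noteq> UNIV"
      by force
    then obtain k where k: "k \<noteq> i" "k \<noteq> j" by blast
    have "convex hull (closure (\<O> i) \<union> closure (\<O> k)) \<inter> closure (\<O> j) = {}"
      using assms(1) k ij unfolding billiard_table_def non_eclipse_def by metis
    moreover have "q1 \<in> convex hull (closure (\<O> i) \<union> closure (\<O> k))"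
      using clos(1) by (simp add: hull_inc)
    ultimately show False using clos ts t(2) s(2) by auto
  qed
  with ts t s show ?thesis by simp
qed

text \<open>The point of the collision space with coordinates \<open>(s, \<phi>)\<close>, \<open>s\<close> the parameter of \<open>\<gamma>\<close>.\<close>

definition collision_coords :: "complex set \<Rightarrow> (real \<Rightarrow> complex) \<Rightarrow> real \<times> real \<Rightarrow> complex \<times> complex" where
  "collision_coords K \<gamma> = (\<lambda>(s, \<phi>). (\<gamma> s, unit_normal K (\<gamma> s) * cis \<phi>))"

text \<open>
  \<open>A\<close> is the differential at \<open>x\<close> of the \<open>p\<close>-th iterate of the billiard map, expressed in the
  coordinates \<open>(s, \<phi>)\<close> around \<open>x\<close> and around its image: \<open>f\<close> is the coordinate
  expression of the iterate. Changing the base points of \<open>\<gamma>\<close> and \<open>\<gamma>'\<close> only translates the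
  coordinates, so \<open>A\<close> does not depend on these choices.
\<close>

definition has_billiard_derivative ::
  "(3 \<Rightarrow> complex set) \<Rightarrow> nat \<Rightarrow> complex \<times> complex \<Rightarrow> (real \<times> real \<Rightarrow> real \<times> real) \<Rightarrow> bool" where
  "has_billiard_derivative \<O> p x A \<longleftrightarrow>
     (\<exists>i j \<gamma> \<gamma>' z f.
        arclength_param (\<O> i) \<gamma> \<and> arclength_param (\<O> j) \<gamma>' \<and>
        x = collision_coords (\<O> i) \<gamma> z \<and>
        (\<forall>\<^sub>F w in nhds z. snd w \<in> {-pi/2..pi/2} \<and> snd (f w) \<in> {-pi/2..pi/2} \<and>
           (billiard_map \<O> ^^ p) (collision_coords (\<O> i) \<gamma> w) (collision_coords (\<O> j) \<gamma>' (f w))) \<and>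
        (f has_derivative A) (at z))"

definition billiard_eigenvalues :: "(3 \<Rightarrow> complex set) \<Rightarrow> nat \<Rightarrow> complex \<times> complex \<Rightarrow> real set" where
  "billiard_eigenvalues \<O> p x =
     {c. \<exists>A w. has_billiard_derivative \<O> p x A \<and> w \<noteq> 0 \<and> A w = c *\<^sub>R w}"

definition periodic_word :: "3 list \<Rightarrow> int \<Rightarrow> 3" where
  "periodic_word \<rho> j = \<rho> ! nat (j mod int (length \<rho>))"

definition admissible :: "3 list \<Rightarrow> bool" where
  "admissible \<rho> \<longleftrightarrow> length \<rho> \<ge> 2 \<and> (\<forall>j. periodic_word \<rho> (j + 1) \<noteq> periodic_word \<rho> j)"

definition periodic_orbit :: "(3 \<Rightarrow> complex set) \<Rightarrow> 3 list \<Rightarrow> int \<Rightarrow> complex \<times> complex" where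
  "periodic_orbit \<O> \<rho> = (THE x. \<forall>j.
     billiard_map \<O> (x j) (x (j + 1)) \<and>
     fst (x j) \<in> frontier (\<O> (periodic_word \<rho> j)) \<and>
     x (j + int (length \<rho>)) = x j)"

definition orbit_length :: "(3 \<Rightarrow> complex set) \<Rightarrow> 3 list \<Rightarrow> real" where
  "orbit_length \<O> \<rho> = (\<Sum>j<length \<rho>.
     dist (fst (periodic_orbit \<O> \<rho> (int j))) (fst (periodic_orbit \<O> \<rho> (int j + 1))))"

definition marked_length_spectrum :: "(3 \<Rightarrow> complex set) \<Rightarrow> 3 list \<Rightarrow> real" where
  "marked_length_spectrum \<O> = restrict (orbit_length \<O>) {\<rho>. admissible \<rho>}"

definition determined_by_MLS :: "((3 \<Rightarrow> complex set) \<Rightarrow> 'a) \<Rightarrow> bool" where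
  "determined_by_MLS Q \<longleftrightarrow> (\<forall>\<O> \<O>'. billiard_table \<O> \<and> billiard_table \<O>' \<and>
     marked_length_spectrum \<O> = marked_length_spectrum \<O>' \<longrightarrow> Q \<O> = Q \<O>')"

text \<open>
  In the coordinates \<open>(s, \<phi>)\<close> each collision reverses orientation along the boundary, so for odd
  periods both eigenvalues are negative; hence the absolute values, which are
  immaterial for even periods.
\<close>

definition unstable_eigenvalue :: "(3 \<Rightarrow> complex set) \<Rightarrow> 3 list \<Rightarrow> real" where
  "unstable_eigenvalue \<O> \<rho> = (THE \<mu>. \<bar>\<mu>\<bar> > 1 \<and>
     (\<forall>j. \<mu> \<in> billiard_eigenvalues \<O> (length \<rho>) (periodic_orbit \<O> \<rho> j)))"

definition lyapunov_exponent :: "(3 \<Rightarrow> complex set) \<Rightarrow> 3 list \<Rightarrow> real" where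
  "lyapunov_exponent \<O> \<rho> = 1 / real (length \<rho>) * ln \<bar>unstable_eigenvalue \<O> \<rho>\<bar>"

end

(*
  A periodic billiard orbit with a given label is the unique shortest closed polygon with vertices
  in the closed convex obstacles.  The word tau sigma^n is a palindrome, so its orbit runs along a
  shortest chain from the third obstacle into the gap between the two obstacles of sigma, ends
  perpendicularly and runs back: its length is twice the minimum G(n+1) over chains with n+1 links.
  With d = L(sigma)/2 the sequence G(m) - m d increases to a limit E, and cutting or prolonging
  minimal chains bounds E - G(m) + m d above and below by constants times the squared distance of
  the last vertex to the period two orbit.  In arc-length coordinates s_j the critical point
  equations read s_(j-1) + s_(j+1) = 2 (1 + d k_j) s_j up to higher order, with k_j the curvature,
  so the ratios s_(j-1)/s_j, computed backwards from the free end, converge to the solution of a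
  continued fraction whose product over two steps is the root mu > 1 of
  mu + 1/mu = 4 (1 + d k_0) (1 + d k_1) - 2.  The same equation is the characteristic equation of
  the differential of the squared billiard map at the period two orbit.
*)
theory Submission
  imports Defs
begin

subsection \<open>Boundary curves of obstacles\<close>

text \<open>Letting vertices range over the filled obstacles turns reflection into a statement about
  convex sets: the first variation at a minimum supplies a supporting line, and the non-eclipse
  condition keeps a vertex off the segment joining its neighbours, so that this line is not
  degenerate. Uniqueness of orbits comes from a calibration by the unit velocities, with strict
  convexity settling the case of equality.

  The logarithm forgives every subexponential error. So the critical point equations are used only
  up to a relative error \<eta>, for each \<eta> > 0, without any normal form. The difficulty moves
  to uniformity in the number m of links: the deviation has to be small from an index independent of
  m on, and at every fixed index it has to stay away from 0 as m grows. Comparison of lengths gives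
  the former, compactness the latter.

  The eigenvalues are defined through arbitrary coordinate expressions of the iterated map. Hence
  the differential must be shown to be the same for all of them, which rests on the curvature being
  determined by the boundary as a point set.\<close>

definition arc_param ::
  "complex set \<Rightarrow> real \<Rightarrow> (real \<Rightarrow> complex) \<Rightarrow> (real \<Rightarrow> complex) \<Rightarrow> (real \<Rightarrow> complex) \<Rightarrow> bool" where
  "arc_param K T \<gamma> \<gamma>1 \<gamma>2 \<longleftrightarrow> T > 0 \<and> (\<forall>s. \<gamma> (s + T) = \<gamma> s) \<and> inj_on \<gamma> {0..<T} \<and>
     range \<gamma> = frontier K \<and> (\<forall>s. (\<gamma> has_vector_derivative \<gamma>1 s) (at s)) \<and>
     (\<forall>s. (\<gamma>1 has_vector_derivative \<gamma>2 s) (at s)) \<and> continuous_on UNIV \<gamma>2 \<and>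
     (\<forall>s. norm (\<gamma>1 s) = 1) \<and> (\<forall>s. Im (cnj (\<gamma>1 s) * \<gamma>2 s) > 0)"

definition curv :: "(real \<Rightarrow> complex) \<Rightarrow> (real \<Rightarrow> complex) \<Rightarrow> real \<Rightarrow> real" where
  "curv \<gamma>1 \<gamma>2 s = Im (cnj (\<gamma>1 s) * \<gamma>2 s)"

lemma arclength_param_imp_arc_param:
  assumes "arclength_param K \<gamma>"
  obtains T \<gamma>1 \<gamma>2 where "arc_param K T \<gamma> \<gamma>1 \<gamma>2"
proof -
  from assms obtain T \<gamma>1 \<gamma>2 \<gamma>3 where *: "T > 0" "\<forall>s. \<gamma> (s + T) = \<gamma> s" "inj_on \<gamma> {0..<T}"
    "range \<gamma> = frontier K"
    "\<forall>s. (\<gamma> has_vector_derivative \<gamma>1 s) (at s) \<and> (\<gamma>1 has_vector_derivative \<gamma>2 s) (at s) \<and>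
         (\<gamma>2 has_vector_derivative \<gamma>3 s) (at s)"
    "\<forall>s. norm (\<gamma>1 s) = 1" "\<forall>s. Im (cnj (\<gamma>1 s) * \<gamma>2 s) > 0"
    unfolding arclength_param_def by blast
  have "continuous_on UNIV \<gamma>2"
    using * by (auto intro!: continuous_at_imp_continuous_on has_vector_derivative_continuous)
  with * have "arc_param K T \<gamma> \<gamma>1 \<gamma>2"
    unfolding arc_param_def by blast
  with that show ?thesis by blast
qed

context
  fixes K T \<gamma> \<gamma>1 \<gamma>2
  assumes arc: "arc_param K T \<gamma> \<gamma>1 \<gamma>2"
begin

lemma arc_param_deriv:
  "(\<gamma> has_vector_derivative \<gamma>1 s) (at s)" "(\<gamma>1 has_vector_derivative \<gamma>2 s) (at s)"
  using arc by (auto simp: arc_param_def)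

lemma arc_param_period_pos: "T > 0"
  using arc by (auto simp: arc_param_def)

lemma arc_param_in_frontier: "\<gamma> s \<in> frontier K"
  using arc by (auto simp: arc_param_def)

lemma arc_param_norm: "norm (\<gamma>1 s) = 1"
  using arc by (auto simp: arc_param_def)

lemma arc_param_cont: "continuous_on A \<gamma>" "continuous_on A \<gamma>1" "continuous_on A \<gamma>2"
proof -
  have "isCont \<gamma> s" "isCont \<gamma>1 s" for s
    by (rule has_vector_derivative_continuous, rule arc_param_deriv)+
  then show "continuous_on A \<gamma>" "continuous_on A \<gamma>1"
    by (simp_all add: continuous_at_imp_continuous_on)
  show "continuous_on A \<gamma>2"
    using arc by (auto intro: continuous_on_subset simp: arc_param_def)
qed

lemma arc_param_periodic_nat: "\<gamma> (s + real n * T) = \<gamma> s"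
proof (induction n)
  case (Suc n)
  have "\<gamma> (s + real (Suc n) * T) = \<gamma> ((s + real n * T) + T)"
    by (simp add: algebra_simps)
  then show ?case using Suc arc by (simp add: arc_param_def)
qed simp

lemma arc_param_periodic_int: "\<gamma> (s + of_int k * T) = \<gamma> s"
proof (cases "k \<ge> 0")
  case True
  then show ?thesis using arc_param_periodic_nat[of s "nat k"] by simp
next
  case False
  then show ?thesis using arc_param_periodic_nat[of "s + of_int k * T" "nat (-k)"] by simp
qed

text \<open>Reducing both parameters modulo \<open>T\<close> into \<open>{0..<T}\<close> shows that
  equal points have parameters differing by an integer multiple of \<open>T\<close>; a multiple
  smaller than \<open>T\<close> is 0.\<close>

lemma arc_param_inj:
  assumes "\<bar>s - t\<bar> < T" "\<gamma> s = \<gamma> t"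
  shows "s = t"
proof -
  have T: "T > 0" by (rule arc_param_period_pos)
  define red where "red u = u + of_int (- \<lfloor>u / T\<rfloor>) * T" for u
  have g: "\<gamma> (red u) = \<gamma> u" for u
    unfolding red_def by (rule arc_param_periodic_int)
  have r: "red u \<in> {0..<T}" for u
  proof -
    have "of_int \<lfloor>u / T\<rfloor> * T \<le> u" "u < (of_int \<lfloor>u / T\<rfloor> + 1) * T"
      using floor_divide_lower[OF T] floor_divide_upper[OF T] by simp_all
    then show ?thesis by (auto simp: red_def algebra_simps)
  qed
  have "red s = red t"
    using arc r[of s] r[of t] g assms(2) by (metis arc_param_def inj_on_eq_iff)
  then have eq: "s - t = of_int (\<lfloor>s / T\<rfloor> - \<lfloor>t / T\<rfloor>) * T"
    by (simp add: red_def algebra_simps)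
  then have "\<bar>of_int (\<lfloor>s / T\<rfloor> - \<lfloor>t / T\<rfloor>) :: real\<bar> * T < 1 * T"
    using assms(1) T by (simp add: abs_mult)
  then have "\<bar>of_int (\<lfloor>s / T\<rfloor> - \<lfloor>t / T\<rfloor>) :: real\<bar> < 1"
    using T by (simp only: mult_less_cancel_right_pos)
  then have "\<lfloor>s / T\<rfloor> - \<lfloor>t / T\<rfloor> = 0" by linarith
  with eq show ?thesis by simp
qed

lemma arc_param_surj:
  assumes "x \<in> frontier K"
  obtains s where "\<gamma> s = x" "\<bar>s - a\<bar> \<le> T / 2"
proof -
  have T: "T > 0" by (rule arc_param_period_pos)
  obtain u where u: "\<gamma> u = x" using assms arc unfolding arc_param_def by (metis imageE)
  define k where "k = \<lfloor>(u - a + T / 2) / T\<rfloor>"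
  have "of_int k * T \<le> u - a + T / 2" "u - a + T / 2 < (of_int k + 1) * T"
    unfolding k_def using floor_divide_lower[OF T] floor_divide_upper[OF T] by simp_all
  then have "of_int k * T \<le> u - a + T / 2" "u - a + T / 2 < of_int k * T + T"
    by (auto simp: algebra_simps)
  then have "u - of_int k * T - a \<le> T / 2" "- (u - of_int k * T - a) \<le> T / 2" by auto
  then have "\<bar>(u + of_int (-k) * T) - a\<bar> \<le> T / 2" by linarith
  with u show ?thesis
    using that[of "u + of_int (-k) * T"] arc_param_periodic_int[of u "-k"] by metis
qed

text \<open>The inverse of the parametrization is continuous at \<open>\<gamma> a\<close>: the
  parameters of one period that are not \<epsilon>-close to \<open>a\<close> form a compact set,
  whose image is closed and misses \<open>\<gamma> a\<close>.\<close>

lemma arc_param_local_surj: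
  assumes "\<epsilon> > 0"
  obtains \<delta> where "\<delta> > 0"
    "\<And>s. \<bar>s - a\<bar> \<le> T / 2 \<Longrightarrow> dist (\<gamma> s) (\<gamma> a) < \<delta> \<Longrightarrow> \<bar>s - a\<bar> < \<epsilon>"
proof -
  define S where "S = cball a (T/2) - ball a \<epsilon>"
  have "compact S" unfolding S_def by (intro compact_diff) auto
  then have cl: "closed (\<gamma> ` S)"
    by (intro compact_imp_closed compact_continuous_image arc_param_cont)
  have "\<gamma> a \<notin> \<gamma> ` S"
  proof
    assume "\<gamma> a \<in> \<gamma> ` S"
    then obtain s where s: "s \<in> S" "\<gamma> a = \<gamma> s" by (metis imageE)
    have "\<bar>a - s\<bar> \<le> T / 2"
      using s(1) by (simp add: S_def dist_real_def)
    then have "a = s" using arc_param_inj[OF _ s(2)] arc_param_period_pos by linarith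
    with s(1) assms show False by (simp add: S_def)
  qed
  then obtain \<delta> where "\<delta> > 0" and \<delta>: "\<And>y. y \<in> \<gamma> ` S \<Longrightarrow> \<delta> \<le> dist (\<gamma> a) y"
    using separate_point_closed[OF cl, of "\<gamma> a"] by metis
  show ?thesis
  proof (rule that[OF \<open>\<delta> > 0\<close>])
    fix s assume s: "\<bar>s - a\<bar> \<le> T / 2" "dist (\<gamma> s) (\<gamma> a) < \<delta>"
    show "\<bar>s - a\<bar> < \<epsilon>"
    proof (rule ccontr)
      assume "\<not> ?thesis"
      with s(1) have "s \<in> S" by (simp add: S_def dist_real_def abs_minus_commute)
      with \<delta>[of "\<gamma> s"] s(2) show False by (simp add: dist_commute)
    qed
  qed
qed

lemma arc_param_lipschitz: "dist (\<gamma> s) (\<gamma> t) \<le> \<bar>s - t\<bar>"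
proof -
  have "norm (\<gamma> s - \<gamma> t) \<le> 1 * norm (s - t)"
  proof (rule differentiable_bound[of UNIV \<gamma> "\<lambda>x h. h *\<^sub>R \<gamma>1 x"])
    show "(\<gamma> has_derivative (\<lambda>h. h *\<^sub>R \<gamma>1 x)) (at x within UNIV)" for x
      using arc_param_deriv(1)[of x] by (simp add: has_vector_derivative_def)
    show "onorm (\<lambda>h. h *\<^sub>R \<gamma>1 x) \<le> 1" for x
      by (rule onorm_le) (simp add: arc_param_norm)
  qed auto
  then show ?thesis by (simp add: dist_norm)
qed

lemma curv_pos: "curv \<gamma>1 \<gamma>2 s > 0"
  using arc by (auto simp: arc_param_def curv_def)

text \<open>Frenet equation. Differentiating the constant
  \<open>\<gamma>1 s \<bullet> \<gamma>1 s\<close> makes \<open>\<gamma>2 s\<close> orthogonal to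
  \<open>\<gamma>1 s\<close>, so \<open>cnj (\<gamma>1 s) * \<gamma>2 s\<close> is purely imaginary;
  multiplying by the unit number \<open>\<gamma>1 s\<close> recovers
  \<open>\<gamma>2 s\<close>.\<close>

lemma arc_param_second: "\<gamma>2 s = curv \<gamma>1 \<gamma>2 s *\<^sub>R (\<i> * \<gamma>1 s)"
proof -
  have "((\<lambda>s. \<gamma>1 s \<bullet> \<gamma>1 s) has_derivative (\<lambda>h. \<gamma>1 s \<bullet> (h *\<^sub>R \<gamma>2 s) + (h *\<^sub>R \<gamma>2 s) \<bullet> \<gamma>1 s)) (at s)"
    by (rule has_derivative_inner) (use arc_param_deriv(2)[of s] in \<open>auto simp: has_vector_derivative_def\<close>)
  moreover have "(\<lambda>s. \<gamma>1 s \<bullet> \<gamma>1 s) = (\<lambda>s. 1)"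
    by (auto simp: dot_square_norm arc_param_norm)
  moreover have "((\<lambda>s::real. 1::real) has_derivative (\<lambda>h. 0)) (at s)" by simp
  ultimately have "(\<lambda>h. \<gamma>1 s \<bullet> (h *\<^sub>R \<gamma>2 s) + (h *\<^sub>R \<gamma>2 s) \<bullet> \<gamma>1 s) = (\<lambda>h. 0)"
    using has_derivative_unique by metis
  then have "\<gamma>1 s \<bullet> (1 *\<^sub>R \<gamma>2 s) + (1 *\<^sub>R \<gamma>2 s) \<bullet> \<gamma>1 s = 0"
    by (rule fun_cong)
  then have 0: "\<gamma>1 s \<bullet> \<gamma>2 s = 0"
    by (simp add: inner_commute)
  have "cnj (\<gamma>1 s) * \<gamma>2 s = \<i> * of_real (curv \<gamma>1 \<gamma>2 s)"
    using 0 by (simp add: complex_eq_iff curv_def inner_complex_def)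
  then have "\<gamma>1 s * cnj (\<gamma>1 s) * \<gamma>2 s = \<gamma>1 s * (\<i> * of_real (curv \<gamma>1 \<gamma>2 s))"
    by (simp add: mult.assoc)
  moreover have "\<gamma>1 s * cnj (\<gamma>1 s) = 1"
    using complex_norm_square[of "\<gamma>1 s"] by (simp add: arc_param_norm)
  ultimately show ?thesis by (simp add: scaleR_conv_of_real)
qed

end

section \<open>Supporting lines and outer normals of strictly convex obstacles\<close>

lemma obstacle_open: "obstacle K \<Longrightarrow> open K" by (simp add: obstacle_def)

lemma obstacle_segment:
  assumes "obstacle K" "x \<in> closure K" "y \<in> closure K" "x \<noteq> y"
  shows "open_segment x y \<subseteq> K"
  using assms interior_open[of K] unfolding obstacle_def strictly_convex_def by blast

lemma obstacle_convex: assumes "obstacle K" shows "convex K"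
  unfolding convex_contains_open_segment
proof (intro ballI)
  fix x y assume "x \<in> K" "y \<in> K"
  then show "open_segment x y \<subseteq> K"
    using obstacle_segment[OF assms, of x y] closure_subset[of K] by (cases "x = y") auto
qed

lemma obstacle_compact: "obstacle K \<Longrightarrow> compact (closure K)"
  by (simp add: obstacle_def)

lemma obstacle_frontier: "obstacle K \<Longrightarrow> frontier K = closure K - K"
  by (simp add: obstacle_def frontier_def interior_open)

lemma obstacle_frontier_subset: "obstacle K \<Longrightarrow> frontier K \<subseteq> closure K"
  by (simp add: frontier_def)

lemma obstacle_nonempty: "obstacle K \<Longrightarrow> K \<noteq> {}"
  by (simp add: obstacle_def)

lemma half_space_closure:
  fixes q n :: "'a::real_inner"
  assumes "\<forall>x\<in>K. (x - q) \<bullet> n \<le> 0" "x \<in> closure K"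
  shows "(x - q) \<bullet> n \<le> 0"
proof -
  have "closed {x. (x - q) \<bullet> n \<le> 0}"
    by (intro closed_Collect_le continuous_intros)
  with assms(1) have "closure K \<subseteq> {x. (x - q) \<bullet> n \<le> 0}"
    by (intro closure_minimal) auto
  with assms(2) show ?thesis by auto
qed

text \<open>Along the boundary curve the supporting functional is maximal at \<open>s\<close>. Its
  vanishing first derivative leaves only \<open>\<i> * \<gamma>1 s\<close> and
  \<open>- \<i> * \<gamma>1 s\<close>; for the former the second derivative would be the positive
  curvature, which contradicts the maximum.\<close>

lemma supporting_normal_unique:
  assumes arc: "arc_param K T \<gamma> \<gamma>1 \<gamma>2" and n: "norm n = 1" "\<forall>x\<in>K. (x - \<gamma> s) \<bullet> n \<le> 0"
  shows "n = - \<i> * \<gamma>1 s"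
proof -
  define f where "f r = (\<gamma> r - \<gamma> s) \<bullet> n" for r
  have le: "f r \<le> 0" for r
    unfolding f_def using half_space_closure[OF n(2)] arc_param_in_frontier[OF arc, of r]
    by (simp add: frontier_def)
  have df: "(f has_real_derivative \<gamma>1 r \<bullet> n) (at r)" for r
    unfolding f_def has_field_derivative_def
    using arc_param_deriv(1)[OF arc, of r, unfolded has_vector_derivative_def]
    by (auto intro!: derivative_eq_intros)
  have ddf: "((\<lambda>r. \<gamma>1 r \<bullet> n) has_real_derivative \<gamma>2 r \<bullet> n) (at r)" for r
    unfolding has_field_derivative_def
    using arc_param_deriv(2)[OF arc, of r, unfolded has_vector_derivative_def]
    by (auto intro!: derivative_eq_intros)
  have fs: "f s = 0" by (simp add: f_def)
  have orth: "\<gamma>1 s \<bullet> n = 0"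
    using DERIV_local_max[OF df[of s], of 1] le fs by auto
  define c where "c = Im (cnj (\<gamma>1 s) * n)"
  have "cnj (\<gamma>1 s) * n = \<i> * of_real c"
    using orth by (simp add: complex_eq_iff c_def inner_complex_def)
  then have "\<gamma>1 s * cnj (\<gamma>1 s) * n = \<gamma>1 s * (\<i> * of_real c)"
    by (simp add: mult.assoc)
  moreover have "\<gamma>1 s * cnj (\<gamma>1 s) = 1"
    using complex_norm_square[of "\<gamma>1 s"] by (simp add: arc_param_norm[OF arc])
  ultimately have nc: "n = c *\<^sub>R (\<i> * \<gamma>1 s)" by (simp add: scaleR_conv_of_real)
  then have "\<bar>c\<bar> = 1" using n(1) by (simp add: norm_mult arc_param_norm[OF arc])
  moreover have "c \<noteq> 1"
  proof
    assume "c = 1"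
    then have "\<gamma>2 s \<bullet> n = curv \<gamma>1 \<gamma>2 s"
      using nc arc_param_second[OF arc, of s]
      by (simp add: dot_square_norm norm_mult arc_param_norm[OF arc] del: inner_complex_def)
    then have "0 < \<gamma>2 s \<bullet> n" using curv_pos[OF arc] by metis
    from DERIV_pos_inc_right[OF ddf this] obtain d where "d > 0"
      and d: "\<And>h. 0 < h \<Longrightarrow> h < d \<Longrightarrow> \<gamma>1 s \<bullet> n < \<gamma>1 (s + h) \<bullet> n" by blast
    obtain z where z: "s < z" "z < s + d / 2" "f (s + d/2) - f s = (s + d/2 - s) * (\<gamma>1 z \<bullet> n)"
      using MVT2[of s "s + d/2" f "\<lambda>z. \<gamma>1 z \<bullet> n"] df \<open>d > 0\<close> by auto
    have "\<gamma>1 z \<bullet> n > 0" using d[of "z - s"] z orth \<open>d > 0\<close> by auto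
    then have "(s + d/2 - s) * (\<gamma>1 z \<bullet> n) > 0" using \<open>d > 0\<close> by simp
    then have "f (s + d/2) > 0" using z(3) fs by linarith
    with le[of "s + d/2"] show False by simp
  qed
  ultimately have "c = -1" by linarith
  with nc show ?thesis by simp
qed

text \<open>Existence of a normal is the supporting hyperplane theorem for the convex set
  \<open>K\<close>; together with uniqueness it evaluates the definite description in
  \<open>unit_normal\<close>.\<close>

lemma unit_normal_arc_param:
  assumes ob: "obstacle K" and arc: "arc_param K T \<gamma> \<gamma>1 \<gamma>2"
  shows "unit_normal K (\<gamma> s) = - \<i> * \<gamma>1 s"
    and "x \<in> closure K \<Longrightarrow> (x - \<gamma> s) \<bullet> (- \<i> * \<gamma>1 s) \<le> 0"
proof -
  have q: "\<gamma> s \<in> closure K" "\<gamma> s \<notin> K"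
    using arc_param_in_frontier[OF arc, of s] obstacle_frontier[OF ob] by auto
  have ri: "rel_interior K = K"
    using ob rel_interior_open obstacle_open by blast
  obtain a where a: "a \<noteq> 0" "\<And>y. y \<in> closure K \<Longrightarrow> a \<bullet> \<gamma> s \<le> a \<bullet> y"
    using supporting_hyperplane_relative_frontier[OF obstacle_convex[OF ob] q(1)] q(2) ri by metis
  define n where "n = - (a /\<^sub>R norm a)"
  have "norm n = 1" using a(1) by (simp add: n_def)
  moreover have sup: "(y - \<gamma> s) \<bullet> n \<le> 0" if "y \<in> closure K" for y
  proof -
    have "(y - \<gamma> s) \<bullet> n = (a \<bullet> \<gamma> s - a \<bullet> y) / norm a"
      by (simp add: n_def inner_diff_left inner_commute divide_inverse algebra_simps)
    then show ?thesis using a(2)[OF that] by (simp add: divide_nonpos_nonneg)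
  qed
  ultimately have nn: "norm n = 1 \<and> (\<forall>x\<in>K. (x - \<gamma> s) \<bullet> n \<le> 0)"
    using closure_subset[of K] by blast
  then have ne: "n = - \<i> * \<gamma>1 s"
    using supporting_normal_unique[OF arc] by blast
  show "unit_normal K (\<gamma> s) = - \<i> * \<gamma>1 s"
    unfolding unit_normal_def
    by (rule the_equality) (use nn ne supporting_normal_unique[OF arc] in auto)
  show "x \<in> closure K \<Longrightarrow> (x - \<gamma> s) \<bullet> (- \<i> * \<gamma>1 s) \<le> 0"
    using sup ne by simp
qed

lemma obstacle_arc_param:
  assumes "obstacle K"
  obtains T \<gamma> \<gamma>1 \<gamma>2 where "arc_param K T \<gamma> \<gamma>1 \<gamma>2"
  using assms arclength_param_imp_arc_param unfolding obstacle_def by metis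

lemma unit_normal_eqI:
  assumes "obstacle K" "q \<in> frontier K" "norm n = 1" "\<forall>x\<in>K. (x - q) \<bullet> n \<le> 0"
  shows "unit_normal K q = n"
proof -
  obtain T \<gamma> \<gamma>1 \<gamma>2 where arc: "arc_param K T \<gamma> \<gamma>1 \<gamma>2" using obstacle_arc_param assms(1) .
  then obtain s where "\<gamma> s = q" using arc_param_surj[OF arc assms(2)] by blast
  then show ?thesis
    using supporting_normal_unique[OF arc assms(3)] unit_normal_arc_param(1)[OF assms(1) arc] assms(4)
    by metis
qed

lemma unit_normal_props:
  assumes "obstacle K" "q \<in> frontier K"
  shows "norm (unit_normal K q) = 1" "x \<in> closure K \<Longrightarrow> (x - q) \<bullet> unit_normal K q \<le> 0"
proof -
  obtain T \<gamma> \<gamma>1 \<gamma>2 where arc: "arc_param K T \<gamma> \<gamma>1 \<gamma>2" using obstacle_arc_param assms(1) .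
  then obtain s where s: "\<gamma> s = q" using arc_param_surj[OF arc assms(2)] by blast
  show "norm (unit_normal K q) = 1"
    using unit_normal_arc_param(1)[OF assms(1) arc, of s] s
    by (simp add: norm_mult arc_param_norm[OF arc])
  show "x \<in> closure K \<Longrightarrow> (x - q) \<bullet> unit_normal K q \<le> 0"
    using unit_normal_arc_param[OF assms(1) arc, where s=s] s by metis
qed

text \<open>Strict convexity puts the midpoint of \<open>x\<close> and \<open>q\<close> into the
  open set \<open>K\<close>, where it can still be moved a little along the normal. The moved point
  is not above the supporting line, so the midpoint, and with it \<open>x\<close>, is strictly
  below.\<close>

lemma unit_normal_strict:
  assumes ob: "obstacle K" and q: "q \<in> frontier K" and x: "x \<in> closure K" "x \<noteq> q"
  shows "(x - q) \<bullet> unit_normal K q < 0"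
proof -
  define n where "n = unit_normal K q"
  have n: "n \<bullet> n = 1" using unit_normal_props(1)[OF ob q] by (simp add: n_def dot_square_norm)
  have "midpoint x q \<in> K"
    using obstacle_segment[OF ob x(1), of q] obstacle_frontier[OF ob] q x(2) midpoint_in_open_segment[of x q]
    by blast
  then obtain e where e: "e > 0" "ball (midpoint x q) e \<subseteq> K"
    using obstacle_open[OF ob] open_contains_ball by blast
  have "midpoint x q + (e/2) *\<^sub>R n \<in> K"
    using e unit_normal_props(1)[OF ob q] by (intro subsetD[OF e(2)]) (auto simp: dist_norm n_def)
  then have "(midpoint x q + (e/2) *\<^sub>R n - q) \<bullet> n \<le> 0"
    using unit_normal_props(2)[OF ob q] closure_subset unfolding n_def by blast
  moreover have "(midpoint x q + (e/2) *\<^sub>R n - q) \<bullet> n = ((x - q) \<bullet> n) / 2 + e / 2"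
  proof -
    have *: "midpoint x q + (e/2) *\<^sub>R n - q = (1/2) *\<^sub>R (x - q) + (e/2) *\<^sub>R n"
      by (simp add: midpoint_def complex_eq_iff field_simps)
    show ?thesis unfolding * using n by (simp add: inner_add_left)
  qed
  ultimately show ?thesis using e(1) by (simp add: n_def)
qed

lemma obstacle_closure_convex: "obstacle K \<Longrightarrow> convex (closure K)"
  by (simp add: obstacle_convex convex_closure)

subsection \<open>Reflection at minima and uniqueness of periodic orbits\<close>

lemma billiard_obstacle: "billiard_table \<O> \<Longrightarrow> obstacle (\<O> i)"
  by (simp add: billiard_table_def)

lemma billiard_closures_disjoint:
  assumes "billiard_table \<O>" "i \<noteq> j"
  shows "closure (\<O> i) \<inter> closure (\<O> j) = {}"
proof -
  have "card {i, j} < CARD(3)" using assms(2) by simp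
  then have "{i, j} \<noteq> UNIV" by force
  then obtain k where k: "k \<noteq> i" "k \<noteq> j" by blast
  have "convex hull (closure (\<O> i) \<union> closure (\<O> k)) \<inter> closure (\<O> j) = {}"
    using assms k unfolding billiard_table_def non_eclipse_def by metis
  then show ?thesis by (auto intro: hull_inc)
qed

text \<open>The case \<open>i = j\<close> is included because both neighbours of a vertex may lie on
  the same obstacle, as at the ends of a folded path; there convexity and disjointness replace the
  non-eclipse condition.\<close>

lemma billiard_segment_avoids:
  assumes tab: "billiard_table \<O>" and "k \<noteq> i" "k \<noteq> j" "x \<in> closure (\<O> i)" "y \<in> closure (\<O> j)"
    and z: "z \<in> closed_segment x y"
  shows "z \<notin> closure (\<O> k)"
proof (cases "i = j")
  case True
  then have "z \<in> closure (\<O> i)"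
    using z assms(4,5) obstacle_closure_convex[OF billiard_obstacle[OF tab]] convex_contains_segment
    by blast
  then show ?thesis using billiard_closures_disjoint[OF tab, of k i] assms(2) by auto
next
  case False
  have "z \<in> convex hull (closure (\<O> i) \<union> closure (\<O> j))"
    using z assms(4,5) convex_contains_segment[of "convex hull (closure (\<O> i) \<union> closure (\<O> j))"]
    by (meson UnI1 UnI2 convex_convex_hull hull_inc subsetD)
  moreover have "convex hull (closure (\<O> i) \<union> closure (\<O> j)) \<inter> closure (\<O> k) = {}"
    using tab False assms(2,3) unfolding billiard_table_def non_eclipse_def by metis
  ultimately show ?thesis by blast
qed

section \<open>First variation of length and the law of reflection\<close>

lemma inner_sgn_self: "x \<bullet> sgn x = norm (x::'a::real_inner)"
  by (cases "x = 0") (simp_all add: sgn_div_norm dot_square_norm power2_eq_square)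

lemma norm_scaleR_sgn: "norm x *\<^sub>R sgn x = (x::'a::real_normed_vector)"
  by (cases "x = 0") (simp_all add: sgn_div_norm)

lemma has_derivative_norm_compose:
  fixes f :: "'a::real_normed_vector \<Rightarrow> 'b::real_inner"
  assumes "(f has_derivative f') (at x)" "f x \<noteq> 0"
  shows "((\<lambda>x. norm (f x)) has_derivative (\<lambda>h. f' h \<bullet> sgn (f x))) (at x)"
  using has_derivative_compose[OF assms(1) GDERIV_norm[OF assms(2), unfolded gderiv_def]] .

lemma inner_le_norm_unit: "norm v = 1 \<Longrightarrow> x \<bullet> v \<le> norm (x::'a::real_inner)"
  using norm_cauchy_schwarz[of x v] by simp

lemma aligned_in_closed_segment:
  fixes y a b v :: "'a::real_vector"
  assumes "r > 0" "s > 0" "y - a = r *\<^sub>R v" "b - y = s *\<^sub>R v"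
  shows "y \<in> closed_segment a b"
proof -
  have ba: "b - a = (r + s) *\<^sub>R v"
    using assms(3,4) by (simp add: scaleR_add_left) (metis add.commute add_diff_eq diff_add_cancel)
  have "(1 - r / (r + s)) *\<^sub>R a + (r / (r + s)) *\<^sub>R b = a + (r / (r + s)) *\<^sub>R (b - a)"
    by (simp add: algebra_simps)
  also have "\<dots> = a + r *\<^sub>R v" unfolding ba using assms(1,2) by simp
  also have "\<dots> = y" using assms(3) by (metis add.commute diff_add_cancel)
  finally show ?thesis
    using assms(1,2) unfolding closed_segment_def by (auto intro!: exI[of _ "r / (r + s)"])
qed

text \<open>Moving \<open>y\<close> towards \<open>x\<close> stays inside the convex set, so the
  one-sided derivative of the length along this segment cannot be negative.\<close>

lemma sum_dist_first_variation:
  fixes a b y x :: "'a::real_inner"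
  assumes "convex S" "y \<in> S" "x \<in> S" "y \<noteq> a" "y \<noteq> b"
    and min: "\<And>w. w \<in> S \<Longrightarrow> dist a y + dist y b \<le> dist a w + dist w b"
  shows "(x - y) \<bullet> (sgn (y - a) + sgn (y - b)) \<ge> 0"
proof (rule ccontr)
  assume neg: "\<not> ?thesis"
  define f where "f t = norm (y + t *\<^sub>R (x - y) - a) + norm (y + t *\<^sub>R (x - y) - b)" for t :: real
  have "(f has_real_derivative (x - y) \<bullet> sgn (y - a) + (x - y) \<bullet> sgn (y - b)) (at 0)"
    unfolding f_def has_field_derivative_def
    using assms(4,5)
    by (auto intro!: derivative_eq_intros has_derivative_norm_compose simp: algebra_simps)
  then have "(f has_real_derivative (x - y) \<bullet> (sgn (y - a) + sgn (y - b))) (at 0)"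
    by (simp add: inner_add_right)
  then obtain d where d: "d > 0" "\<And>h. 0 < h \<Longrightarrow> h < d \<Longrightarrow> f 0 > f (0 + h)"
    using DERIV_neg_dec_right[of f _ 0] neg by (meson not_le)
  define h where "h = min (d / 2) 1"
  have h: "0 < h" "h < d" "h \<le> 1" using d(1) by (auto simp: h_def)
  have "y + h *\<^sub>R (x - y) = (1 - h) *\<^sub>R y + h *\<^sub>R x" by (simp add: algebra_simps)
  then have "y + h *\<^sub>R (x - y) \<in> S"
    using convexD_alt[OF assms(1-3), of h] h by simp
  from min[OF this] have "f 0 \<le> f h"
    by (simp add: f_def dist_norm norm_minus_commute)
  with d(2)[OF h(1,2)] show False by simp
qed

text \<open>By the first variation, \<open>u = v - v'\<close> is nonnegative on
  \<open>closure K - y\<close>. Once \<open>u\<close> is known not to vanish,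
  \<open>- u / norm u\<close> is a supporting normal at \<open>y\<close>, so the velocity changes
  only in the normal direction.\<close>

lemma reflection_of_minimum:
  assumes ob: "obstacle K" and y: "y \<in> closure K"
    and seg: "\<And>z. z \<in> closed_segment a b \<Longrightarrow> z \<notin> closure K"
    and min: "\<And>w. w \<in> closure K \<Longrightarrow> dist a y + dist y b \<le> dist a w + dist w b"
  defines "n \<equiv> unit_normal K y" and "v \<equiv> sgn (y - a)" and "v' \<equiv> sgn (b - y)"
  shows "y \<in> frontier K" "v \<bullet> n < 0" "v' \<bullet> n > 0" "v' = v - (2 * (v \<bullet> n)) *\<^sub>R n"
proof -
  have ne: "y \<noteq> a" "y \<noteq> b" using seg y by auto
  define u where "u = sgn (y - a) + sgn (y - b)"
  have uv: "u = v - v'"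
    by (simp add: u_def v_def v'_def) (metis minus_diff_eq sgn_minus)
  have var: "(x - y) \<bullet> u \<ge> 0" if "x \<in> closure K" for x
    unfolding u_def
    by (rule sum_dist_first_variation[OF obstacle_closure_convex[OF ob] y that ne min])
  have norms: "norm v = 1" "norm v' = 1"
    using ne by (auto simp: v_def v'_def norm_sgn)
  \<comment> \<open>If the path went straight on at \<open>y\<close>, then \<open>y\<close> would
    lie on the segment from \<open>a\<close> to \<open>b\<close>, which misses the obstacle.\<close>
  have "u \<noteq> 0"
  proof
    assume "u = 0"
    then have vv: "v = v'" using uv by simp
    define r s where "r = norm (y - a)" and "s = norm (b - y)"
    have rs: "r > 0" "s > 0" using ne by (auto simp: r_def s_def)
    have "y - a = r *\<^sub>R v" "b - y = s *\<^sub>R v'"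
      by (simp_all add: r_def s_def v_def v'_def norm_scaleR_sgn)
    then have "y - a = r *\<^sub>R v" "b - y = s *\<^sub>R v" using vv by simp_all
    then have "y \<in> closed_segment a b" using aligned_in_closed_segment[OF rs] by blast
    with seg y show False by blast
  qed
  define n0 where "n0 = - (u /\<^sub>R norm u)"
  have n01: "norm n0 = 1" using \<open>u \<noteq> 0\<close> by (simp add: n0_def)
  have un: "u = - (norm u *\<^sub>R n0)" using \<open>u \<noteq> 0\<close> by (simp add: n0_def)
  have sup: "(x - y) \<bullet> n0 \<le> 0" if "x \<in> closure K" for x
    using var[OF that] \<open>u \<noteq> 0\<close> by (simp add: n0_def)
  \<comment> \<open>An interior point could be moved a little in the direction \<open>n0\<close>,
    against the support inequality.\<close>
  have "y \<notin> K"
  proof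
    assume "y \<in> K"
    then obtain e where e: "e > 0" "ball y e \<subseteq> K"
      using obstacle_open[OF ob] open_contains_ball by blast
    have "y + (e/2) *\<^sub>R n0 \<in> K"
      using e n01 by (intro subsetD[OF e(2)]) (auto simp: dist_norm)
    then have "(y + (e/2) *\<^sub>R n0 - y) \<bullet> n0 \<le> 0" using sup closure_subset by blast
    then show False using e n01 by (simp add: dot_square_norm)
  qed
  then show fr: "y \<in> frontier K" using y obstacle_frontier[OF ob] by blast
  have nn: "n = n0"
    unfolding n_def using sup closure_subset[of K]
    by (intro unit_normal_eqI[OF ob fr n01]) blast
  have "v' = v - u" using uv by simp
  then have v': "v' = v + norm u *\<^sub>R n" using un nn by (metis diff_minus_eq_add)
  have n1: "n \<bullet> n = 1" using n01 nn by (simp add: dot_square_norm)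
  \<comment> \<open>Both velocities are unit vectors, which determines \<open>norm u\<close> and
    thereby the coefficient in the law of reflection.\<close>
  have "v' \<bullet> v' = v \<bullet> v + 2 * norm u * (v \<bullet> n) + norm u * norm u"
    unfolding v' using n1
    by (simp add: inner_add_left inner_add_right inner_commute algebra_simps)
  then have "norm u * (2 * (v \<bullet> n) + norm u) = 0"
    using norms by (simp add: dot_square_norm algebra_simps)
  then have nu: "norm u = - 2 * (v \<bullet> n)" using \<open>u \<noteq> 0\<close> by auto
  show "v \<bullet> n < 0" using nu \<open>u \<noteq> 0\<close> by (metis norm_eq_zero norm_ge_zero less_eq_real_def
        mult_minus_left neg_0_less_iff_less zero_less_mult_iff not_less zero_less_numeral)
  moreover have "v' \<bullet> n = v \<bullet> n + norm u" unfolding v' using n1 by (simp add: inner_add_left)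
  ultimately show "v' \<bullet> n > 0" using nu by linarith
  show "v' = v - (2 * (v \<bullet> n)) *\<^sub>R n" using v' nu by simp
qed

section \<open>One step of the billiard map between known obstacles\<close>

lemma billiard_mapD:
  assumes tab: "billiard_table \<O>" and m: "billiard_map \<O> (q, v) (q', v')"
    and q: "q \<in> frontier (\<O> i)" "q' \<in> frontier (\<O> j)"
  shows "norm v = 1" "v \<bullet> unit_normal (\<O> i) q \<ge> 0" "v = sgn (q' - q)"
    "v' = v - (2 * (v \<bullet> unit_normal (\<O> j) q')) *\<^sub>R unit_normal (\<O> j) q'"
proof -
  have uniq: "k = l" if "x \<in> frontier (\<O> k)" "x \<in> frontier (\<O> l)" for x k l
    using that billiard_closures_disjoint[OF tab, of k l] by (auto simp: frontier_def)
  from m q uniq show nv: "norm v = 1" and "v \<bullet> unit_normal (\<O> i) q \<ge> 0"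
    unfolding billiard_map_def collision_space_def by blast+
  from m obtain t k where t: "t > 0" "q' = q + t *\<^sub>R v" "q' \<in> frontier (\<O> k)"
    "v' = v - (2 * (v \<bullet> unit_normal (\<O> k) q')) *\<^sub>R unit_normal (\<O> k) q'"
    unfolding billiard_map_def by blast
  show "v = sgn (q' - q)" using t(1,2) nv by (simp add: sgn_div_norm)
  show "v' = v - (2 * (v \<bullet> unit_normal (\<O> j) q')) *\<^sub>R unit_normal (\<O> j) q'"
    using t(3,4) uniq q(2) by blast
qed

text \<open>The flight is unobstructed for three reasons: an outgoing velocity keeps the ray
  strictly above the supporting line at \<open>q\<close>, an incoming one keeps it strictly above
  the supporting line at \<open>q'\<close> until it arrives, and the segment misses the third
  obstacle.\<close>

lemma billiard_mapI:
  assumes tab: "billiard_table \<O>" and ij: "i \<noteq> j"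
    and q: "q \<in> frontier (\<O> i)" "q' \<in> frontier (\<O> j)" and v: "v = sgn (q' - q)"
    and out: "v \<bullet> unit_normal (\<O> i) q > 0" and inn: "v \<bullet> unit_normal (\<O> j) q' < 0"
    and v': "v' = v - (2 * (v \<bullet> unit_normal (\<O> j) q')) *\<^sub>R unit_normal (\<O> j) q'"
  shows "billiard_map \<O> (q, v) (q', v')"
proof -
  have ob: "obstacle (\<O> k)" for k using tab by (rule billiard_obstacle)
  have cl: "q \<in> closure (\<O> i)" "q' \<in> closure (\<O> j)"
    using q obstacle_frontier_subset[OF ob] by blast+
  have ne: "q' \<noteq> q" using billiard_closures_disjoint[OF tab ij] cl by auto
  define t where "t = norm (q' - q)"
  have t: "t > 0" "q' = q + t *\<^sub>R v" using ne by (auto simp: t_def v sgn_div_norm)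
  have nv: "norm v = 1" using ne by (simp add: v norm_sgn)
  have free: "q + u *\<^sub>R v \<notin> closure (\<O> k)" if u: "0 < u" "u < t" for u k
  proof -
    consider "k = i" | "k = j" | "k \<noteq> i" "k \<noteq> j" by blast
    then show ?thesis
    proof cases
      case 1
      have "(q + u *\<^sub>R v - q) \<bullet> unit_normal (\<O> i) q > 0" using out u by simp
      then show ?thesis using unit_normal_props(2)[OF ob q(1)] 1 by fastforce
    next
      case 2
      have "q + u *\<^sub>R v - q' = - ((t - u) *\<^sub>R v)" using t(2) by (simp add: algebra_simps)
      then have "(q + u *\<^sub>R v - q') \<bullet> unit_normal (\<O> j) q' = - ((t - u) * (v \<bullet> unit_normal (\<O> j) q'))"
        by simp
      also have "\<dots> > 0" using inn u by (simp add: mult_pos_neg)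
      finally show ?thesis using unit_normal_props(2)[OF ob q(2)] 2 by fastforce
    next
      case 3
      have "q + u *\<^sub>R v \<in> closed_segment q q'"
        using u t(2) by (intro aligned_in_closed_segment[of u "t - u" _ _ v]) (auto simp: algebra_simps)
      then show ?thesis using billiard_segment_avoids[OF tab 3 cl] by blast
    qed
  qed
  have "(q, v) \<in> collision_space \<O>"
    unfolding collision_space_def using nv q(1) out by (auto intro!: exI[of _ i])
  then show ?thesis
    unfolding billiard_map_def using t q(2) free v' by auto
qed

section \<open>Uniqueness of labelled periodic orbits\<close>

definition is_periodic_orbit :: "(3 \<Rightarrow> complex set) \<Rightarrow> 3 list \<Rightarrow> (int \<Rightarrow> complex \<times> complex) \<Rightarrow> bool" where
  "is_periodic_orbit \<O> \<rho> x \<longleftrightarrow> (\<forall>j.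
     billiard_map \<O> (x j) (x (j + 1)) \<and>
     fst (x j) \<in> frontier (\<O> (periodic_word \<rho> j)) \<and>
     x (j + int (length \<rho>)) = x j)"

text \<open>The velocities calibrate the length: summing \<open>dist (q' j) (q' (j+1)) \<ge> (q' (j+1) - q' j) \<bullet> v j\<close> by
  parts leaves the length of the orbit and one term of definite sign per reflection.\<close>

lemma periodic_orbit_length_calibration:
  fixes q' :: "int \<Rightarrow> complex"
  assumes tab: "billiard_table \<O>" and orb: "is_periodic_orbit \<O> \<rho> x"
    and per: "\<And>j. q' (j + int (length \<rho>)) = q' j"
  defines "q \<equiv> \<lambda>j. fst (x j)" and "n \<equiv> \<lambda>j. unit_normal (\<O> (periodic_word \<rho> j)) (fst (x j))"
    and "v \<equiv> \<lambda>j. snd (x j)"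
  shows "(\<Sum>j<length \<rho>. dist (q (int j)) (q (int j + 1)))
    - (\<Sum>j<length \<rho>. 2 * (v (int j) \<bullet> n (int j)) * ((q' (int j) - q (int j)) \<bullet> n (int j)))
    \<le> (\<Sum>j<length \<rho>. dist (q' (int j)) (q' (int j + 1)))"
    and "v j - v (j - 1) = (2 * (v j \<bullet> n j)) *\<^sub>R n j"
    and "v j \<bullet> n j \<ge> 0" and "v j = sgn (q (j + 1) - q j)" and "norm (v j) = 1"
proof -
  have ob: "obstacle (\<O> k)" for k using tab by (rule billiard_obstacle)
  have st: "billiard_map \<O> (q j, v j) (q (j + 1), v (j + 1))" for j
    using orb by (simp add: is_periodic_orbit_def q_def v_def)
  have fr: "q j \<in> frontier (\<O> (periodic_word \<rho> j))" for j
    using orb by (simp add: is_periodic_orbit_def q_def)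
  have nv: "norm (v j) = 1" and vn: "v j \<bullet> n j \<ge> 0" and vs: "v j = sgn (q (j + 1) - q j)" for j
    using billiard_mapD(1-3)[OF tab st fr fr, of j] by (simp_all add: n_def q_def)
  have refl: "v (j + 1) = v j - (2 * (v j \<bullet> n (j + 1))) *\<^sub>R n (j + 1)" for j
    using billiard_mapD(4)[OF tab st fr fr, of j] by (simp add: n_def q_def)
  have nn: "n j \<bullet> n j = 1" for j
    using unit_normal_props(1)[OF ob fr[of j]] by (simp add: n_def q_def dot_square_norm)
  \<comment> \<open>Reflection negates the normal component, so the coefficient can be written with
    the outgoing velocity, whose normal component is nonnegative.\<close>
  have diff: "v j - v (j - 1) = (2 * (v j \<bullet> n j)) *\<^sub>R n j" for j
  proof -
    have *: "v j = v (j - 1) - (2 * (v (j - 1) \<bullet> n j)) *\<^sub>R n j" using refl[of "j - 1"] by simp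
    then have "v j \<bullet> n j = - (v (j - 1) \<bullet> n j)"
      using nn[of j] by (metis (no_types, lifting) add_diff_cancel_left' inner_diff_left
          inner_scaleR_left mult.right_neutral mult_2 minus_add_distrib diff_conv_add_uminus
          add_diff_cancel_right' diff_add_cancel)
    then show ?thesis using * by simp
  qed
  show "v j - v (j - 1) = (2 * (v j \<bullet> n j)) *\<^sub>R n j" "v j \<bullet> n j \<ge> 0"
    "v j = sgn (q (j + 1) - q j)" "norm (v j) = 1"
    by (rule diff vn vs nv)+
  define p where "p = length \<rho>"
  define d where "d j = q' j - q j" for j
  have perd: "d (j + int p) = d j" for j
    using per orb by (simp add: d_def q_def p_def is_periodic_orbit_def)
  have perv: "v (j + int p) = v j" for j
    using orb by (simp add: v_def p_def is_periodic_orbit_def)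
  have tele: "(\<Sum>j<p. d (int j + 1) \<bullet> v (int j) - d (int j) \<bullet> v (int j - 1)) = 0"
  proof -
    have "(\<Sum>j<p. d (int j + 1) \<bullet> v (int j) - d (int j) \<bullet> v (int j - 1)) =
        (\<Sum>j<p. d (int (Suc j)) \<bullet> v (int (Suc j) - 1) - d (int j) \<bullet> v (int j - 1))"
      by (simp add: add.commute)
    also have "\<dots> = d (int p) \<bullet> v (int p - 1) - d (int 0) \<bullet> v (int 0 - 1)"
      by (rule sum_lessThan_telescope)
    also have "\<dots> = 0" using perd[of 0] perv[of "-1"] by simp
    finally show ?thesis .
  qed
  have each: "dist (q (int j)) (q (int j + 1))
      - 2 * (v (int j) \<bullet> n (int j)) * ((q' (int j) - q (int j)) \<bullet> n (int j))
      + (d (int j + 1) \<bullet> v (int j) - d (int j) \<bullet> v (int j - 1))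
      \<le> dist (q' (int j)) (q' (int j + 1))" for j
  proof -
    let ?j = "int j"
    have "dist (q ?j) (q (?j + 1)) = (q (?j + 1) - q ?j) \<bullet> v ?j"
      unfolding vs inner_sgn_self by (simp add: dist_norm norm_minus_commute)
    moreover have "(q' (?j + 1) - q' ?j) \<bullet> v ?j \<le> dist (q' ?j) (q' (?j + 1))"
      using inner_le_norm_unit[OF nv] by (metis dist_norm dist_commute)
    moreover have "d ?j \<bullet> v ?j - d ?j \<bullet> v (?j - 1) = 2 * (v ?j \<bullet> n ?j) * (d ?j \<bullet> n ?j)"
      unfolding inner_diff_right[symmetric] diff by simp
    ultimately show ?thesis
      by (simp add: d_def inner_diff_left)
  qed
  have "(\<Sum>j<p. dist (q (int j)) (q (int j + 1))
      - 2 * (v (int j) \<bullet> n (int j)) * ((q' (int j) - q (int j)) \<bullet> n (int j))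
      + (d (int j + 1) \<bullet> v (int j) - d (int j) \<bullet> v (int j - 1)))
      \<le> (\<Sum>j<p. dist (q' (int j)) (q' (int j + 1)))"
    by (intro sum_mono each)
  then show "(\<Sum>j<length \<rho>. dist (q (int j)) (q (int j + 1)))
    - (\<Sum>j<length \<rho>. 2 * (v (int j) \<bullet> n (int j)) * ((q' (int j) - q (int j)) \<bullet> n (int j)))
    \<le> (\<Sum>j<length \<rho>. dist (q' (int j)) (q' (int j + 1)))"
    unfolding sum.distrib sum_subtractf tele[unfolded sum_subtractf] by (simp add: p_def)
qed

text \<open>Each orbit calibrates the length of the other, so their lengths agree and every
  correction term is 0. Since no reflection is tangential,
  \<open>(fst (y j) - fst (x j)) \<bullet> n j\<close> vanishes, and by strict convexity the
  vertices coincide; the velocities are determined by the vertices.\<close>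

lemma periodic_orbit_unique:
  assumes tab: "billiard_table \<O>" and adm: "admissible \<rho>"
    and x: "is_periodic_orbit \<O> \<rho> x" and y: "is_periodic_orbit \<O> \<rho> y"
  shows "x = y"
proof -
  define p where "p = length \<rho>"
  have p: "p > 0" using adm by (auto simp: p_def admissible_def)
  have ob: "obstacle (\<O> k)" for k using tab by (rule billiard_obstacle)
  define n where "n j = unit_normal (\<O> (periodic_word \<rho> j)) (fst (x j))" for j
  have per: "fst (y (j + int (length \<rho>))) = fst (y j)" "fst (x (j + int (length \<rho>))) = fst (x j)" for j
    using x y by (auto simp: is_periodic_orbit_def)
  have fr: "fst (x j) \<in> frontier (\<O> (periodic_word \<rho> j))" "fst (y j) \<in> frontier (\<O> (periodic_word \<rho> j))" for j
    using x y by (auto simp: is_periodic_orbit_def)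
  have cl: "fst (x j) \<in> closure (\<O> (periodic_word \<rho> j))" "fst (y j) \<in> closure (\<O> (periodic_word \<rho> j))" for j
    using fr obstacle_frontier_subset[OF ob] by blast+
  have calx: "(\<Sum>j<p. dist (fst (x (int j))) (fst (x (int j + 1))))
    - (\<Sum>j<p. 2 * (snd (x (int j)) \<bullet> n (int j)) * ((fst (y (int j)) - fst (x (int j))) \<bullet> n (int j)))
    \<le> (\<Sum>j<p. dist (fst (y (int j))) (fst (y (int j + 1))))"
    using periodic_orbit_length_calibration(1)[OF tab x, of "\<lambda>j. fst (y j)"] per
    unfolding n_def p_def by simp
  have caly: "(\<Sum>j<p. dist (fst (y (int j))) (fst (y (int j + 1))))
    - (\<Sum>j<p. 2 * (snd (y (int j)) \<bullet> unit_normal (\<O> (periodic_word \<rho> (int j))) (fst (y (int j)))) *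
        ((fst (x (int j)) - fst (y (int j))) \<bullet> unit_normal (\<O> (periodic_word \<rho> (int j))) (fst (y (int j)))))
    \<le> (\<Sum>j<p. dist (fst (x (int j))) (fst (x (int j + 1))))"
    using periodic_orbit_length_calibration(1)[OF tab y, of "\<lambda>j. fst (x j)"] per
    unfolding p_def by simp
  have termy: "2 * (snd (y (int j)) \<bullet> unit_normal (\<O> (periodic_word \<rho> (int j))) (fst (y (int j)))) *
        ((fst (x (int j)) - fst (y (int j))) \<bullet> unit_normal (\<O> (periodic_word \<rho> (int j))) (fst (y (int j)))) \<le> 0" for j
    by (rule mult_nonneg_nonpos)
      (use periodic_orbit_length_calibration(3)[OF tab y, of "\<lambda>_. 0"] unit_normal_props(2)[OF ob fr(2) cl(1)] in auto)
  have sumy: "(\<Sum>j<p. 2 * (snd (y (int j)) \<bullet> unit_normal (\<O> (periodic_word \<rho> (int j))) (fst (y (int j)))) *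
        ((fst (x (int j)) - fst (y (int j))) \<bullet> unit_normal (\<O> (periodic_word \<rho> (int j))) (fst (y (int j))))) \<le> 0"
    by (rule sum_nonpos) (rule termy)
  define g where "g j = 2 * (snd (x j) \<bullet> n j) * ((fst (y j) - fst (x j)) \<bullet> n j)" for j
  have termx: "g j \<le> 0" for j
    unfolding g_def
    by (rule mult_nonneg_nonpos)
      (use periodic_orbit_length_calibration(3)[OF tab x, of "\<lambda>_. 0", folded n_def]
        unit_normal_props(2)[OF ob fr(1) cl(2), folded n_def] in auto)
  have "(\<Sum>j<p. g (int j)) = 0"
  proof (rule antisym)
    show "(\<Sum>j<p. g (int j)) \<le> 0" by (intro sum_nonpos termx)
    show "0 \<le> (\<Sum>j<p. g (int j))" using calx caly sumy by (simp add: g_def)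
  qed
  then have g0: "g (int j) = 0" if "j < p" for j
    using that termx sum_nonneg_eq_0_iff[of "{..<p}" "\<lambda>j. - g (int j)"] by (auto simp: sum_negf)
  \<comment> \<open>A tangential collision would leave the velocity unchanged and put the vertex on
    the segment between its neighbours, contrary to the non-eclipse condition.\<close>
  have vn: "snd (x j) \<bullet> n j > 0" for j
  proof -
    note cal = periodic_orbit_length_calibration(2-5)[OF tab x, of "\<lambda>_. 0", OF refl, folded n_def]
    have "snd (x j) \<bullet> n j \<noteq> 0"
    proof
      assume "snd (x j) \<bullet> n j = 0"
      then have eq: "snd (x j) = snd (x (j - 1))" using cal(1)[of j] by simp
      define a b c where "a = fst (x (j - 1))" and "b = fst (x j)" and "c = fst (x (j + 1))"
      define v where "v = snd (x j)"
      define r s where "r = norm (b - a)" and "s = norm (c - b)"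
      have v: "v = sgn (c - b)" "v = sgn (b - a)" "norm v = 1"
        using cal(3)[of j] cal(3)[of "j - 1"] cal(4)[of j] eq by (simp_all add: v_def a_def b_def c_def)
      then have rs: "r > 0" "s > 0" by (auto simp: r_def s_def)
      have "b - a = r *\<^sub>R v" "c - b = s *\<^sub>R v"
        unfolding r_def s_def by (subst v(2), rule norm_scaleR_sgn[symmetric])
          (subst v(1), rule norm_scaleR_sgn[symmetric])
      then have "b \<in> closed_segment a c" using aligned_in_closed_segment[OF rs] by blast
      moreover have "periodic_word \<rho> j \<noteq> periodic_word \<rho> (j - 1)"
        "periodic_word \<rho> j \<noteq> periodic_word \<rho> (j + 1)"
        using adm unfolding admissible_def by (metis diff_add_cancel)+
      ultimately have "b \<notin> closure (\<O> (periodic_word \<rho> j))"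
        using billiard_segment_avoids[OF tab _ _ cl(1)[of "j - 1"] cl(1)[of "j + 1"]]
        by (simp add: a_def c_def)
      then show False using cl(1)[of j] by (simp add: b_def)
    qed
    with cal(2)[of j] show ?thesis by linarith
  qed
  have eqn: "fst (x (int j)) = fst (y (int j))" if "j < p" for j
  proof (rule ccontr)
    assume ne: "fst (x (int j)) \<noteq> fst (y (int j))"
    have "(fst (y (int j)) - fst (x (int j))) \<bullet> n (int j) < 0"
      using unit_normal_strict[OF ob fr(1) cl(2), of "int j"] ne by (simp add: n_def)
    with g0[OF that] vn[of "int j"] show False by (simp add: g_def)
  qed
  have eqm: "x j = x (j mod int p)" "y j = y (j mod int p)" for j
  proof -
    have "z (i + int k * int p) = z i" if "\<And>j. z (j + int p) = z j" for z :: "int \<Rightarrow> complex \<times> complex" and i k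
    proof (induction k)
      case (Suc k)
      have "z (i + int (Suc k) * int p) = z ((i + int k * int p) + int p)"
        by (simp add: algebra_simps)
      then show ?case using that Suc by metis
    qed simp
    note add = this
    have "z j = z (j mod int p)" if per: "\<And>j. z (j + int p) = z j" for z :: "int \<Rightarrow> complex \<times> complex"
    proof (cases "j div int p \<ge> 0")
      case True
      then show ?thesis using add[of z "j mod int p" "nat (j div int p)", OF per]
        by (simp add: mod_mult_div_eq add.commute)
    next
      case False
      have "j + int (nat (- (j div int p))) * int p = j mod int p"
        using False mult_div_mod_eq[of "int p" j] by (simp add: algebra_simps)
      then show ?thesis using add[of z j "nat (- (j div int p))", OF per] by simp
    qed
    then show "x j = x (j mod int p)" "y j = y (j mod int p)"
      using x y by (auto simp: is_periodic_orbit_def p_def)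
  qed
  have eqq: "fst (x j) = fst (y j)" for j
  proof -
    have "0 \<le> j mod int p" "j mod int p < int p" using p by auto
    then have "fst (x (j mod int p)) = fst (y (j mod int p))"
      using eqn[of "nat (j mod int p)"] by (simp add: nat_less_iff)
    then show ?thesis using eqm by metis
  qed
  have "snd (x j) = snd (y j)" for j
    using periodic_orbit_length_calibration(4)[OF tab x, of "\<lambda>_. 0", OF refl, of j]
      periodic_orbit_length_calibration(4)[OF tab y, of "\<lambda>_. 0", OF refl, of j] eqq by simp
  with eqq show ?thesis by (auto simp: fun_eq_iff prod_eq_iff)
qed

lemma periodic_orbit_eqI:
  assumes "billiard_table \<O>" "admissible \<rho>" "is_periodic_orbit \<O> \<rho> x"
  shows "periodic_orbit \<O> \<rho> = x"
  unfolding periodic_orbit_def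
  by (rule the_equality)
    (use assms periodic_orbit_unique[OF assms(1,2)] in \<open>auto simp: is_periodic_orbit_def\<close>)

subsection \<open>Shortest chains and palindromic orbits\<close>

definition chain_length :: "nat \<Rightarrow> (nat \<Rightarrow> complex) \<Rightarrow> real" where
  "chain_length m z = (\<Sum>j<m. dist (z j) (z (Suc j)))"

text \<open>Chains are infinite sequences of which only the vertices up to index \<open>m\<close>
  enter the length. Minimizers for different \<open>m\<close> thus live in one compact product
  space, where limits as \<open>m\<close> grows can be taken.\<close>

definition chain_minimizer ::
  "(3 \<Rightarrow> complex set) \<Rightarrow> (nat \<Rightarrow> 3) \<Rightarrow> nat \<Rightarrow> (nat \<Rightarrow> complex) \<Rightarrow> bool" where
  "chain_minimizer \<O> u m z \<longleftrightarrow> (\<forall>j. z j \<in> closure (\<O> (u j))) \<and>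
     (\<forall>y. (\<forall>j. y j \<in> closure (\<O> (u j))) \<longrightarrow> chain_length m z \<le> chain_length m y)"

lemma chain_minimizer_le:
  assumes "chain_minimizer \<O> u m z" "\<And>i. y i \<in> closure (\<O> (u i))"
  shows "chain_length m z \<le> chain_length m y"
  using assms by (simp add: chain_minimizer_def)

lemma compact_functions_into:
  assumes "\<And>i. compact (K i :: 'b::topological_space set)"
  shows "compact {z. \<forall>i. z i \<in> K i}"
proof -
  have "compactin (product_topology (\<lambda>i. euclidean) UNIV) (PiE UNIV K)"
    unfolding compactin_PiE using assms by simp
  moreover have "PiE UNIV K = {z. \<forall>i. z i \<in> K i}" by (auto simp: PiE_def Pi_def)
  ultimately show ?thesis
    by (simp add: euclidean_product_topology)
qed

lemma chain_minimizer_exists: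
  assumes tab: "billiard_table \<O>"
  obtains z where "chain_minimizer \<O> u m z"
proof -
  define S where "S = {z. \<forall>i. z i \<in> closure (\<O> (u i))}"
  have "compact S" unfolding S_def
    by (intro compact_functions_into obstacle_compact billiard_obstacle tab)
  moreover have "S \<noteq> {}"
  proof -
    have "\<forall>i. \<exists>w. w \<in> closure (\<O> (u i))"
      using obstacle_nonempty[OF billiard_obstacle[OF tab]] closure_subset by blast
    then show ?thesis unfolding S_def by (auto dest: choice)
  qed
  moreover have "continuous_on S (chain_length m)"
    unfolding chain_length_def
    by (intro continuous_intros continuous_on_subset[OF continuous_on_product_coordinates]) auto
  ultimately obtain z where "z \<in> S" "\<forall>y\<in>S. chain_length m z \<le> chain_length m y"
    using continuous_attains_inf by blast
  with that show ?thesis by (auto simp: chain_minimizer_def S_def)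
qed

lemma chain_minimizer_local:
  assumes min: "chain_minimizer \<O> u m z" and w: "w \<in> closure (\<O> (u k))"
  shows "0 < k \<Longrightarrow> k < m \<Longrightarrow>
      dist (z (k - 1)) (z k) + dist (z k) (z (k + 1)) \<le> dist (z (k - 1)) w + dist w (z (k + 1))"
    and "k = 0 \<Longrightarrow> 0 < m \<Longrightarrow> dist (z 0) (z 1) \<le> dist w (z 1)"
    and "k = m \<Longrightarrow> 0 < m \<Longrightarrow> dist (z (m - 1)) (z m) \<le> dist (z (m - 1)) w"
proof -
  define y where "y = z(k := w)"
  have "chain_length m z \<le> chain_length m y"
    using min w by (auto simp: chain_minimizer_def y_def)
  moreover define S where "S = {j. j < m \<and> (j = k \<or> Suc j = k)}"
  have split: "chain_length m x =
      (\<Sum>j\<in>{..<m} - S. dist (x j) (x (Suc j))) + (\<Sum>j\<in>S. dist (x j) (x (Suc j)))" for x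
    unfolding chain_length_def by (rule sum.subset_diff) (auto simp: S_def)
  have "(\<Sum>j\<in>{..<m} - S. dist (y j) (y (Suc j))) = (\<Sum>j\<in>{..<m} - S. dist (z j) (z (Suc j)))"
    by (rule sum.cong) (auto simp: S_def y_def)
  ultimately have le: "(\<Sum>j\<in>S. dist (z j) (z (Suc j))) \<le> (\<Sum>j\<in>S. dist (y j) (y (Suc j)))"
    using split[of z] split[of y] by linarith
  {
    assume "0 < k" "k < m"
    then have "S = {k - 1, k}" by (auto simp: S_def)
    moreover have "k - 1 \<noteq> k" "Suc (k - 1) = k" using \<open>0 < k\<close> by auto
    ultimately show "dist (z (k - 1)) (z k) + dist (z k) (z (k + 1)) \<le> dist (z (k - 1)) w + dist w (z (k + 1))"
      using le by (simp add: y_def)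
  next
    assume "k = 0" "0 < m"
    then have "S = {0}" by (auto simp: S_def)
    with le \<open>k = 0\<close> show "dist (z 0) (z 1) \<le> dist w (z 1)" by (simp add: y_def)
  next
    assume "k = m" "0 < m"
    then have "S = {m - 1}" by (auto simp: S_def)
    moreover have "m - 1 \<noteq> m" "Suc (m - 1) = m" using \<open>0 < m\<close> by auto
    ultimately show "dist (z (m - 1)) (z m) \<le> dist (z (m - 1)) w"
      using le \<open>k = m\<close> by (simp add: y_def)
  }
qed

text \<open>The path \<open>0, 1, \<dots>, m, m - 1, \<dots>, 1\<close>, repeated with period \<open>2 m\<close>: an orbit hitting its two end
  points perpendicularly retraces itself.\<close>

definition fold_index :: "nat \<Rightarrow> int \<Rightarrow> nat" where
  "fold_index m j = (let r = nat (j mod (2 * int m)) in if r \<le> m then r else 2 * m - r)"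

definition folded_orbit :: "nat \<Rightarrow> (nat \<Rightarrow> complex) \<Rightarrow> int \<Rightarrow> complex \<times> complex" where
  "folded_orbit m z j = (z (fold_index m j), sgn (z (fold_index m (j + 1)) - z (fold_index m j)))"

section \<open>Index arithmetic of the folded path\<close>

lemma mod_succ_pred:
  fixes j n :: int
  assumes "n > 0"
  shows "(j + 1) mod n = (if j mod n = n - 1 then 0 else j mod n + 1)"
    and "(j - 1) mod n = (if j mod n = 0 then n - 1 else j mod n - 1)"
proof -
  have r: "0 \<le> j mod n" "j mod n < n" using assms by auto
  have "(j + 1) mod n = (j mod n + 1) mod n" by (simp add: mod_add_left_eq)
  also have "\<dots> = (if j mod n = n - 1 then 0 else j mod n + 1)" using r by auto
  finally show "(j + 1) mod n = (if j mod n = n - 1 then 0 else j mod n + 1)" .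
  have "(j - 1) mod n = (j mod n - 1) mod n" by (simp add: mod_diff_left_eq)
  also have "\<dots> = (if j mod n = 0 then n - 1 else j mod n - 1)"
  proof (cases "j mod n = 0")
    case True
    then show ?thesis using assms by (simp add: zmod_minus1)
  next
    case False
    then show ?thesis using r mod_pos_pos_trivial[of "j mod n - 1" n] by simp
  qed
  finally show "(j - 1) mod n = (if j mod n = 0 then n - 1 else j mod n - 1)" .
qed

lemma fold_index_neighbours:
  assumes m: "m > 0"
  shows "fold_index m j \<le> m"
    and "fold_index m j = 0 \<Longrightarrow> fold_index m (j - 1) = 1 \<and> fold_index m (j + 1) = 1"
    and "fold_index m j = m \<Longrightarrow> fold_index m (j - 1) = m - 1 \<and> fold_index m (j + 1) = m - 1"
    and "0 < fold_index m j \<Longrightarrow> fold_index m j < m \<Longrightarrow>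
       fold_index m (j - 1) = fold_index m j - 1 \<and> fold_index m (j + 1) = fold_index m j + 1 \<or>
       fold_index m (j - 1) = fold_index m j + 1 \<and> fold_index m (j + 1) = fold_index m j - 1"
proof -
  define r where "r = nat (j mod (2 * int m))"
  have r: "r < 2 * m" "j mod (2 * int m) = int r"
    using m by (auto simp: r_def nat_less_iff)
  have up: "(j + 1) mod (2 * int m) = (if r = 2 * m - 1 then 0 else int (r + 1))"
    and dn: "(j - 1) mod (2 * int m) = (if r = 0 then int (2 * m - 1) else int (r - 1))"
    using mod_succ_pred[of "2 * int m" j] m r by auto
  have f: "fold_index m j = (if r \<le> m then r else 2 * m - r)"
    by (simp add: fold_index_def r_def Let_def)
  have fu: "fold_index m (j + 1) =
      (if r = 2 * m - 1 then 0 else if r + 1 \<le> m then r + 1 else 2 * m - (r + 1))"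
    unfolding fold_index_def up Let_def by (auto simp: nat_add_distrib)
  have fd: "fold_index m (j - 1) =
      (if r = 0 then 2 * m - (2 * m - 1) else if r - 1 \<le> m then r - 1 else 2 * m - (r - 1))"
    unfolding fold_index_def dn Let_def using m by auto
  show "fold_index m j \<le> m" unfolding f by auto
  show "fold_index m j = 0 \<Longrightarrow> fold_index m (j - 1) = 1 \<and> fold_index m (j + 1) = 1"
    unfolding f fu fd using r(1) m by (auto split: if_splits)
  show "fold_index m j = m \<Longrightarrow> fold_index m (j - 1) = m - 1 \<and> fold_index m (j + 1) = m - 1"
    unfolding f fu fd using r(1) m by (auto split: if_splits)
  show "0 < fold_index m j \<Longrightarrow> fold_index m j < m \<Longrightarrow>
       fold_index m (j - 1) = fold_index m j - 1 \<and> fold_index m (j + 1) = fold_index m j + 1 \<or>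
       fold_index m (j - 1) = fold_index m j + 1 \<and> fold_index m (j + 1) = fold_index m j - 1"
    unfolding f fu fd using r(1) m by (auto split: if_splits)
qed

lemma fold_index_periodic: "fold_index m (j + 2 * int m) = fold_index m j"
  by (simp add: fold_index_def)

lemma fold_index_small: "k \<le> m \<Longrightarrow> 0 < m \<Longrightarrow> fold_index m (int k) = k"
  by (simp add: fold_index_def)

lemma fold_index_reflect: "k \<le> m \<Longrightarrow> 0 < m \<Longrightarrow> fold_index m (int m + int k) = m - k"
proof (cases "k = m")
  case True
  then show "0 < m \<Longrightarrow> ?thesis" by (simp add: fold_index_def flip: mult_2)
next
  case False
  then show "k \<le> m \<Longrightarrow> 0 < m \<Longrightarrow> ?thesis"
    by (auto simp: fold_index_def Let_def nat_add_distrib mod_pos_pos_trivial)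
qed

lemma sum_lessThan_add: "(\<Sum>i<m + n. f i) = (\<Sum>i<m. f i) + (\<Sum>i<n. f (m + i :: nat) :: real)"
  by (induction n) (auto simp: add.assoc)

section \<open>The periodic orbit obtained by folding a shortest chain\<close>

context
  fixes \<O> u m z
  assumes tab: "billiard_table \<O>" and m: "m > 0" and min: "chain_minimizer \<O> u m z"
    and u: "\<And>j. j < m \<Longrightarrow> u j \<noteq> u (Suc j)"
begin

lemma folded_word_neighbours: "u (fold_index m j) \<noteq> u (fold_index m (j + 1))"
    "u (fold_index m j) \<noteq> u (fold_index m (j - 1))"
proof -
  define k where "k = fold_index m j"
  note nb = fold_index_neighbours[OF m, of j, folded k_def]
  have a: "u k \<noteq> u (k + 1)" if "k < m" using u[of k] that by simp
  have b: "u k \<noteq> u (k - 1)" if "0 < k" using u[of "k - 1"] that nb(1) by (cases k) auto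
  consider "k = 0" | "k = m" | "0 < k" "k < m" using nb(1) by linarith
  then have "u k \<noteq> u (fold_index m (j + 1)) \<and> u k \<noteq> u (fold_index m (j - 1))"
  proof cases
    case 1 with nb(2) a m show ?thesis by auto
  next
    case 2 with nb(3) b m show ?thesis by auto
  next
    case 3 with nb(4) a b show ?thesis by auto
  qed
  then show "u (fold_index m j) \<noteq> u (fold_index m (j + 1))"
    "u (fold_index m j) \<noteq> u (fold_index m (j - 1))" by (auto simp: k_def)
qed

text \<open>End vertices need no separate treatment: their two neighbours in the folded path
  coincide, so minimality of the single end link, counted twice, is minimality of the sum of both
  links. Reflection with equal neighbours means a perpendicular hit.\<close>

lemma folded_reflection:
  defines "Q \<equiv> \<lambda>j. z (fold_index m j)"
  defines "n \<equiv> \<lambda>j. unit_normal (\<O> (u (fold_index m j))) (Q j)"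
  shows "Q j \<in> frontier (\<O> (u (fold_index m j)))" "sgn (Q j - Q (j - 1)) \<bullet> n j < 0"
    "sgn (Q (j + 1) - Q j) \<bullet> n j > 0"
    "sgn (Q (j + 1) - Q j) = sgn (Q j - Q (j - 1)) - (2 * (sgn (Q j - Q (j - 1)) \<bullet> n j)) *\<^sub>R n j"
proof -
  have cl: "z k \<in> closure (\<O> (u k))" for k using min by (simp add: chain_minimizer_def)
  have ob: "obstacle (\<O> (u (fold_index m j)))" by (rule billiard_obstacle[OF tab])
  have seg: "x \<notin> closure (\<O> (u (fold_index m j)))" if "x \<in> closed_segment (Q (j - 1)) (Q (j + 1))" for x
    using billiard_segment_avoids[OF tab folded_word_neighbours(2,1)[of j] cl cl] that
    by (simp add: Q_def)
  have mn: "dist (Q (j - 1)) (Q j) + dist (Q j) (Q (j + 1)) \<le> dist (Q (j - 1)) w + dist w (Q (j + 1))"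
    if w: "w \<in> closure (\<O> (u (fold_index m j)))" for w
  proof -
    define k where "k = fold_index m j"
    note nb = fold_index_neighbours[OF m, of j, folded k_def]
    note loc = chain_minimizer_local[OF min w, folded k_def]
    consider "k = 0" | "k = m" | "0 < k" "k < m" using nb(1) by linarith
    then show ?thesis
    proof cases
      case 1
      then show ?thesis using nb(2) loc(2) m by (simp add: Q_def k_def dist_commute)
    next
      case 2
      then show ?thesis using nb(3) loc(3) m by (simp add: Q_def k_def dist_commute)
    next
      case 3
      then show ?thesis using nb(4) loc(1) by (auto simp: Q_def k_def dist_commute)
    qed
  qed
  have "Q j \<in> closure (\<O> (u (fold_index m j)))" using cl by (simp add: Q_def)
  note R = reflection_of_minimum[OF ob this seg mn]
  show "Q j \<in> frontier (\<O> (u (fold_index m j)))" "sgn (Q j - Q (j - 1)) \<bullet> n j < 0"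
    "sgn (Q (j + 1) - Q j) \<bullet> n j > 0"
    "sgn (Q (j + 1) - Q j) = sgn (Q j - Q (j - 1)) - (2 * (sgn (Q j - Q (j - 1)) \<bullet> n j)) *\<^sub>R n j"
    using R by (auto simp: n_def)
qed

lemma chain_minimizer_frontier: "k \<le> m \<Longrightarrow> z k \<in> frontier (\<O> (u k))"
  using folded_reflection(1)[of "int k"] fold_index_small[of k m] m by simp

context
  fixes \<rho>
  assumes len: "length \<rho> = 2 * m" and word: "\<And>j. periodic_word \<rho> j = u (fold_index m j)"
begin

lemma folded_admissible: "admissible \<rho>"
proof -
  have "length \<rho> \<ge> 2" using len m by simp
  then show ?thesis
    unfolding admissible_def word using folded_word_neighbours(1) by metis
qed

lemma folded_is_periodic_orbit: "is_periodic_orbit \<O> \<rho> (folded_orbit m z)"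
proof -
  have "billiard_map \<O> (folded_orbit m z j) (folded_orbit m z (j + 1))" for j
    unfolding folded_orbit_def
    using folded_word_neighbours(1)[of j] folded_reflection[of j] folded_reflection[of "j + 1"]
    by (intro billiard_mapI[OF tab]) auto
  moreover have "folded_orbit m z (j + int (length \<rho>)) = folded_orbit m z j" for j
  proof -
    have *: "j + int (length \<rho>) = j + 2 * int m" "j + 2 * int m + 1 = (j + 1) + 2 * int m"
      using len by simp_all
    show ?thesis unfolding folded_orbit_def * fold_index_periodic ..
  qed
  moreover have "fst (folded_orbit m z j) \<in> frontier (\<O> (periodic_word \<rho> j))" for j
    using folded_reflection(1) word by (simp add: folded_orbit_def)
  ultimately show ?thesis
    unfolding is_periodic_orbit_def by blast
qed

lemma folded_periodic_orbit: "periodic_orbit \<O> \<rho> = folded_orbit m z"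
  by (rule periodic_orbit_eqI[OF tab folded_admissible folded_is_periodic_orbit])

lemma folded_orbit_length: "orbit_length \<O> \<rho> = 2 * chain_length m z"
proof -
  define f where "f j = dist (z (fold_index m (int j))) (z (fold_index m (int j + 1)))" for j
  have "orbit_length \<O> \<rho> = (\<Sum>j<m + m. f j)"
    unfolding orbit_length_def folded_periodic_orbit len f_def
    by (simp add: folded_orbit_def mult_2)
  also have "\<dots> = (\<Sum>j<m. f j) + (\<Sum>j<m. f (m + j))" by (rule sum_lessThan_add)
  also have "(\<Sum>j<m. f j) = chain_length m z"
    unfolding chain_length_def
  proof (rule sum.cong)
    fix j assume "j \<in> {..<m}"
    then show "f j = dist (z j) (z (Suc j))"
      using fold_index_small[of j m] fold_index_small[of "Suc j" m] m
      by (simp add: f_def add.commute)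
  qed simp
  \<comment> \<open>The way back consists of the same links in reverse order.\<close>
  also have "(\<Sum>j<m. f (m + j)) = (\<Sum>j<m. dist (z (m - Suc j)) (z (Suc (m - Suc j))))"
  proof (rule sum.cong)
    fix j assume j: "j \<in> {..<m}"
    then have "fold_index m (int (m + j)) = m - j" "fold_index m (int (m + j) + 1) = m - Suc j"
      using fold_index_reflect[of j m] fold_index_reflect[of "Suc j" m] m
      by (simp_all add: add.commute add.left_commute)
    moreover have "m - j = Suc (m - Suc j)" using j by auto
    ultimately show "f (m + j) = dist (z (m - Suc j)) (z (Suc (m - Suc j)))"
      by (simp add: f_def dist_commute)
  qed simp
  also have "\<dots> = chain_length m z"
    unfolding chain_length_def by (rule sum.nat_diff_reindex)
  finally show ?thesis by simp
qed

end

end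

subsection \<open>Second order geometry of the boundary\<close>

text \<open>A positive normal component places the angle in the range where the sine is injective,
  so the coordinate \<phi> is the arcsine of the tangential component.\<close>

lemma unit_eq_cis_arcsin:
  assumes "norm v = 1" "norm n = 1" "v \<bullet> n > 0"
  shows "v = n * cis (arcsin (v \<bullet> (\<i> * n)))"
proof -
  define w where "w = v * cnj n"
  have Re: "Re w = v \<bullet> n" and Im: "Im w = v \<bullet> (\<i> * n)"
    by (simp_all add: w_def inner_complex_def algebra_simps)
  have "norm w = 1" using assms by (simp add: w_def norm_mult)
  then have sq: "(Re w)\<^sup>2 + (Im w)\<^sup>2 = 1" by (simp add: cmod_def)
  then have le: "\<bar>Im w\<bar> \<le> 1" by (metis abs_square_le_1 add_increasing zero_le_power2 le_add_same_cancel2)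
  have "Re w = sqrt (1 - (Im w)\<^sup>2)"
    using sq Re assms(3) by (intro real_sqrt_unique[symmetric]) auto
  then have "w = cis (arcsin (Im w))"
    using le by (simp add: complex_eq_iff cos_arcsin abs_le_iff)
  moreover have "n * w = v"
    using complex_norm_square[of n] assms(2) by (simp add: w_def)
  ultimately show ?thesis using Im by metis
qed

text \<open>The Lagrange remainder exists for scalar functions only; it is applied to the component
  along \<open>n\<close>, so the intermediate parameter depends on \<open>n\<close>.\<close>

lemma arc_param_taylor:
  assumes arc: "arc_param K T \<gamma> \<gamma>1 \<gamma>2" and "s \<noteq> a"
  shows "\<exists>\<xi>. \<bar>\<xi> - a\<bar> < \<bar>s - a\<bar> \<and>
    (\<gamma> s - \<gamma> a) \<bullet> n = (s - a) * (\<gamma>1 a \<bullet> n) + (\<gamma>2 \<xi> \<bullet> n) / 2 * (s - a)\<^sup>2"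
proof -
  define diff where "diff m = (if m = 0 then (\<lambda>r. \<gamma> r \<bullet> n) else if m = (1::nat) then (\<lambda>r. \<gamma>1 r \<bullet> n)
    else (\<lambda>r. \<gamma>2 r \<bullet> n))" for m
  have d0: "((\<lambda>r. \<gamma> r \<bullet> n) has_real_derivative \<gamma>1 r \<bullet> n) (at r)" for r
    unfolding has_field_derivative_def
    using arc_param_deriv(1)[OF arc, of r, unfolded has_vector_derivative_def]
    by (auto intro!: derivative_eq_intros)
  have d1: "((\<lambda>r. \<gamma>1 r \<bullet> n) has_real_derivative \<gamma>2 r \<bullet> n) (at r)" for r
    unfolding has_field_derivative_def
    using arc_param_deriv(2)[OF arc, of r, unfolded has_vector_derivative_def]
    by (auto intro!: derivative_eq_intros)
  have "\<forall>m t. m < 2 \<and> min s a \<le> t \<and> t \<le> max s a \<longrightarrow> DERIV (diff m) t :> diff (Suc m) t"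
    using d0 d1 by (auto simp: diff_def less_2_cases_iff)
  then obtain t where t: "if s < a then s < t \<and> t < a else a < t \<and> t < s"
    "\<gamma> s \<bullet> n = (\<Sum>m<2. (diff m a / fact m) * (s - a)^m) + (diff 2 t / fact 2) * (s - a)^2"
    using Taylor[of 2 diff "\<lambda>r. \<gamma> r \<bullet> n" "min s a" "max s a" a s] assms(2)
    by (auto simp: diff_def)
  show ?thesis
  proof (intro exI conjI)
    show "\<bar>t - a\<bar> < \<bar>s - a\<bar>" using t(1) by (auto split: if_splits)
    show "(\<gamma> s - \<gamma> a) \<bullet> n = (s - a) * (\<gamma>1 a \<bullet> n) + (\<gamma>2 t \<bullet> n) / 2 * (s - a)\<^sup>2"
      using t(2) by (simp add: diff_def inner_diff_left numeral_2_eq_2)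
  qed
qed

lemma inner_i_mult_self: "(\<i> * z) \<bullet> z = 0" "z \<bullet> (\<i> * z) = 0"
  by (simp_all add: inner_complex_def)

text \<open>Expresses the curvature by the set \<open>frontier K\<close> and the normal: signed
  height over the tangent, divided by the squared chord. No parametrization appears in the
  quotient.\<close>

lemma arc_param_normal_limit:
  assumes arc: "arc_param K T \<gamma> \<gamma>1 \<gamma>2"
  shows "((\<lambda>x. ((x - \<gamma> a) \<bullet> (- \<i> * \<gamma>1 a)) / (norm (x - \<gamma> a))\<^sup>2) \<longlongrightarrow> - curv \<gamma>1 \<gamma>2 a / 2)
    (at (\<gamma> a) within frontier K)"
proof -
  define n where "n = - \<i> * \<gamma>1 a"
  define r where "r s = ((\<gamma> s - \<gamma> a) \<bullet> n) / (norm (\<gamma> s - \<gamma> a))\<^sup>2" for s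
  have "\<exists>\<xi>. \<forall>s. s \<noteq> a \<longrightarrow> \<bar>\<xi> s - a\<bar> < \<bar>s - a\<bar> \<and>
      (\<gamma> s - \<gamma> a) \<bullet> n = (\<gamma>2 (\<xi> s) \<bullet> n) / 2 * (s - a)\<^sup>2"
    using arc_param_taylor[OF arc, of _ a n]
    by (intro choice) (simp add: n_def inner_i_mult_self)
  then obtain \<xi> where \<xi>: "\<And>s. s \<noteq> a \<Longrightarrow> \<bar>\<xi> s - a\<bar> < \<bar>s - a\<bar>"
    "\<And>s. s \<noteq> a \<Longrightarrow> (\<gamma> s - \<gamma> a) \<bullet> n = (\<gamma>2 (\<xi> s) \<bullet> n) / 2 * (s - a)\<^sup>2" by blast
  have \<xi>lim: "(\<xi> \<longlongrightarrow> a) (at a)"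
  proof (rule Lim_transform)
    show "((\<lambda>s. s) \<longlongrightarrow> a) (at a)" by (rule tendsto_ident_at)
    show "((\<lambda>s. \<xi> s - s) \<longlongrightarrow> 0) (at a)"
    proof (rule Lim_null_comparison)
      have "norm (\<xi> s - s) \<le> 2 * \<bar>s - a\<bar>" if "s \<noteq> a" for s
        using \<xi>(1)[OF that] abs_triangle_ineq4[of "\<xi> s - a" "s - a"] by simp
      then show "\<forall>\<^sub>F s in at a. norm (\<xi> s - s) \<le> 2 * \<bar>s - a\<bar>"
        by (auto simp: eventually_at_filter)
      show "((\<lambda>s. 2 * \<bar>s - a\<bar>) \<longlongrightarrow> 0) (at a)" by (auto intro!: tendsto_eq_intros)
    qed
  qed
  have "isCont \<gamma>2 a"
    using arc_param_cont(3)[OF arc, of UNIV] by (simp add: continuous_on_eq_continuous_at)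
  then have lim2: "((\<lambda>s. \<gamma>2 (\<xi> s)) \<longlongrightarrow> \<gamma>2 a) (at a)"
    by (rule isCont_tendsto_compose[OF _ \<xi>lim])
  have lim1: "((\<lambda>s. (\<gamma> s - \<gamma> a) /\<^sub>R (s - a)) \<longlongrightarrow> \<gamma>1 a) (at a)"
  proof -
    have "((\<lambda>s. norm ((1 / norm (s - a)) *\<^sub>R (\<gamma> s - (\<gamma> a + (s - a) *\<^sub>R \<gamma>1 a)))) \<longlongrightarrow> 0) (at a)"
      by (rule arc_param_deriv(1)[OF arc, of a, unfolded has_vector_derivative_def has_derivative_within,
            THEN conjunct2, THEN tendsto_norm_zero])
    moreover have "norm ((1 / norm (s - a)) *\<^sub>R (\<gamma> s - (\<gamma> a + (s - a) *\<^sub>R \<gamma>1 a))) =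
        norm ((\<gamma> s - \<gamma> a) /\<^sub>R (s - a) - \<gamma>1 a)" if "s \<noteq> a" for s
    proof -
      have "(\<gamma> s - \<gamma> a) /\<^sub>R (s - a) - \<gamma>1 a = (1 / (s - a)) *\<^sub>R (\<gamma> s - (\<gamma> a + (s - a) *\<^sub>R \<gamma>1 a))"
        using that by (simp add: scaleR_diff_right scaleR_add_right divide_inverse)
      then show ?thesis by simp
    qed
    ultimately have "((\<lambda>s. norm ((\<gamma> s - \<gamma> a) /\<^sub>R (s - a) - \<gamma>1 a)) \<longlongrightarrow> 0) (at a)"
      by (auto intro: Lim_transform_eventually simp: eventually_at_filter)
    then show ?thesis by (simp add: tendsto_norm_zero_iff LIM_zero_iff)
  qed
  have "((\<lambda>s. (\<gamma>2 (\<xi> s) \<bullet> n) / 2 / (norm ((\<gamma> s - \<gamma> a) /\<^sub>R (s - a)))\<^sup>2) \<longlongrightarrow>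
      (\<gamma>2 a \<bullet> n) / 2 / (norm (\<gamma>1 a))\<^sup>2) (at a)"
    by (intro tendsto_intros lim1 lim2) (simp_all add: arc_param_norm[OF arc])
  moreover have "(\<gamma>2 a \<bullet> n) / 2 / (norm (\<gamma>1 a))\<^sup>2 = - curv \<gamma>1 \<gamma>2 a / 2"
    unfolding arc_param_second[OF arc, of a]
    using arc_param_norm[OF arc, of a]
    by (simp add: n_def dot_square_norm norm_mult del: inner_complex_def)
  moreover have "(\<gamma>2 (\<xi> s) \<bullet> n) / 2 / (norm ((\<gamma> s - \<gamma> a) /\<^sub>R (s - a)))\<^sup>2 = r s" if "s \<noteq> a" for s
  proof -
    have "(norm ((\<gamma> s - \<gamma> a) /\<^sub>R (s - a)))\<^sup>2 = (norm (\<gamma> s - \<gamma> a))\<^sup>2 / (s - a)\<^sup>2"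
      by (simp add: power_mult_distrib divide_inverse power_inverse mult.commute)
    then show ?thesis unfolding r_def \<xi>(2)[OF that] by simp
  qed
  ultimately have lim: "(r \<longlongrightarrow> - curv \<gamma>1 \<gamma>2 a / 2) (at a)"
    by (auto intro: Lim_transform_eventually simp: eventually_at_filter)
  show ?thesis
    unfolding n_def[symmetric]
  proof (rule tendstoI)
    fix e :: real assume "e > 0"
    then obtain \<eta> where "\<eta> > 0"
      and \<eta>: "\<And>s. s \<noteq> a \<Longrightarrow> \<bar>s - a\<bar> < \<eta> \<Longrightarrow> dist (r s) (- curv \<gamma>1 \<gamma>2 a / 2) < e"
      using lim by (force simp: tendsto_iff eventually_at dist_real_def)
    \<comment> \<open>Boundary points close to \<open>\<gamma> a\<close> in the plane have
      parameters close to \<open>a\<close>; this turns the limit in the parameter into a limit along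
      the point set.\<close>
    obtain \<delta> where "\<delta> > 0"
      and \<delta>: "\<And>s. \<bar>s - a\<bar> \<le> T / 2 \<Longrightarrow> dist (\<gamma> s) (\<gamma> a) < \<delta> \<Longrightarrow> \<bar>s - a\<bar> < \<eta>"
      using arc_param_local_surj[OF arc \<open>\<eta> > 0\<close>] by blast
    have "dist (((x - \<gamma> a) \<bullet> n) / (norm (x - \<gamma> a))\<^sup>2) (- curv \<gamma>1 \<gamma>2 a / 2) < e"
      if x: "x \<in> frontier K" "x \<noteq> \<gamma> a" "dist x (\<gamma> a) < \<delta>" for x
    proof -
      obtain s where s: "\<gamma> s = x" "\<bar>s - a\<bar> \<le> T / 2" using arc_param_surj[OF arc x(1)] by blast
      then have "s \<noteq> a" "\<bar>s - a\<bar> < \<eta>" using \<delta>[of s] x by auto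
      then show ?thesis using \<eta>[of s] s(1) by (simp add: r_def)
    qed
    then show "\<forall>\<^sub>F x in at (\<gamma> a) within frontier K.
        dist (((x - \<gamma> a) \<bullet> n) / (norm (x - \<gamma> a))\<^sup>2) (- curv \<gamma>1 \<gamma>2 a / 2) < e"
      using \<open>\<delta> > 0\<close> by (auto simp: eventually_at)
  qed
qed

text \<open>Both curvatures are limits of the same quotient along the same set, and
  \<open>\<gamma> a\<close> is a limit point of that set. This makes the eigenvalues independent of
  the curves chosen in \<open>has_billiard_derivative\<close>.\<close>

lemma curv_unique:
  assumes ob: "obstacle K" and arc: "arc_param K T \<gamma> \<gamma>1 \<gamma>2" and arc': "arc_param K T' \<gamma>' \<gamma>1' \<gamma>2'"
    and eq: "\<gamma> a = \<gamma>' a'"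
  shows "curv \<gamma>1 \<gamma>2 a = curv \<gamma>1' \<gamma>2' a'"
proof -
  have T: "T > 0" by (rule arc_param_period_pos[OF arc])
  have n: "- \<i> * \<gamma>1 a = - \<i> * \<gamma>1' a'"
    using unit_normal_arc_param(1)[OF ob arc, of a] unit_normal_arc_param(1)[OF ob arc', of a'] eq
    by simp
  have "\<gamma> a islimpt frontier K"
    unfolding islimpt_approachable
  proof (intro allI impI)
    fix e :: real assume "e > 0"
    define s where "s = a + min (e / 2) (T / 2)"
    have s: "s \<noteq> a" "\<bar>s - a\<bar> < e" "\<bar>s - a\<bar> < T" using \<open>e > 0\<close> T by (auto simp: s_def min_def)
    show "\<exists>x'\<in>frontier K. x' \<noteq> \<gamma> a \<and> dist x' (\<gamma> a) < e"
      using s arc_param_in_frontier[OF arc, of s] arc_param_inj[OF arc s(3)]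
        arc_param_lipschitz[OF arc, of s a]
      by (intro bexI[of _ "\<gamma> s"]) auto
  qed
  then have "\<not> trivial_limit (at (\<gamma> a) within frontier K)"
    by (simp add: trivial_limit_within)
  from tendsto_unique[OF this arc_param_normal_limit[OF arc]
      arc_param_normal_limit[OF arc', of a', folded n eq]]
  show ?thesis by simp
qed

text \<open>With both curves counterclockwise, \<open>\<gamma>1 a\<close> and \<open>\<beta>1 b\<close> point in opposite directions.\<close>

context
  fixes \<gamma> \<gamma>1 \<gamma>2 \<beta> \<beta>1 \<beta>2 :: "real \<Rightarrow> complex" and K K' :: "complex set" and T T' a b d :: real
  assumes arc: "arc_param K T \<gamma> \<gamma>1 \<gamma>2" and arc': "arc_param K' T' \<beta> \<beta>1 \<beta>2"
    and d: "d > 0" and base: "\<beta> b = \<gamma> a + d *\<^sub>R (- \<i> * \<gamma>1 a)" and opp: "\<beta>1 b = - \<gamma>1 a"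
begin

text \<open>The function is the partial derivative of the link length in the first parameter. Its
  numerator vanishes at the perpendicular link, so the derivative of the norm in the denominator
  drops out. The formula is the common source of the flight matrix and of the linearized critical
  point equations.\<close>

lemma grazing_has_derivative:
  "((\<lambda>p. sgn (\<gamma> (fst p) - \<beta> (snd p)) \<bullet> \<gamma>1 (fst p)) has_derivative
    (\<lambda>h. (curv \<gamma>1 \<gamma>2 a + 1 / d) * fst h + snd h / d)) (at (a, b))"
proof -
  define w where "w p = \<gamma> (fst p) - \<beta> (snd p)" for p
  have w0: "w (a, b) = d *\<^sub>R (\<i> * \<gamma>1 a)" by (simp add: w_def base)
  have nw: "norm (w (a, b)) = d" using d by (simp add: w0 norm_mult arc_param_norm[OF arc])
  have dg: "((\<lambda>p. \<gamma> (fst p)) has_derivative (\<lambda>h. fst h *\<^sub>R \<gamma>1 a)) (at (a, b))"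
    using arc_param_deriv(1)[OF arc, of a] unfolding has_vector_derivative_def
    by (intro has_derivative_compose[of fst fst "(a, b)" UNIV \<gamma>, simplified]) (auto intro: derivative_intros)
  have dg1: "((\<lambda>p. \<gamma>1 (fst p)) has_derivative (\<lambda>h. fst h *\<^sub>R \<gamma>2 a)) (at (a, b))"
    using arc_param_deriv(2)[OF arc, of a] unfolding has_vector_derivative_def
    by (intro has_derivative_compose[of fst fst "(a, b)" UNIV \<gamma>1, simplified]) (auto intro: derivative_intros)
  have db: "((\<lambda>p. \<beta> (snd p)) has_derivative (\<lambda>h. snd h *\<^sub>R \<beta>1 b)) (at (a, b))"
    using arc_param_deriv(1)[OF arc', of b] unfolding has_vector_derivative_def
    by (intro has_derivative_compose[of snd snd "(a, b)" UNIV \<beta>, simplified]) (auto intro: derivative_intros)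
  have dw: "(w has_derivative (\<lambda>h. fst h *\<^sub>R \<gamma>1 a - snd h *\<^sub>R \<beta>1 b)) (at (a, b))"
    unfolding w_def by (rule has_derivative_diff[OF dg db])
  have dnum: "((\<lambda>p. w p \<bullet> \<gamma>1 (fst p)) has_derivative
      (\<lambda>h. w (a, b) \<bullet> (fst h *\<^sub>R \<gamma>2 a) + (fst h *\<^sub>R \<gamma>1 a - snd h *\<^sub>R \<beta>1 b) \<bullet> \<gamma>1 a)) (at (a, b))"
    using has_derivative_inner[OF dw dg1] by simp
  have dden: "((\<lambda>p. norm (w p)) has_derivative
      (\<lambda>h. (fst h *\<^sub>R \<gamma>1 a - snd h *\<^sub>R \<beta>1 b) \<bullet> sgn (w (a, b)))) (at (a, b))"
    by (rule has_derivative_norm_compose[OF dw]) (use nw d in auto)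
  have zero: "w (a, b) \<bullet> \<gamma>1 a = 0" by (simp add: w0 inner_i_mult_self)
  have g1: "\<gamma>1 a \<bullet> \<gamma>1 a = 1" by (simp add: dot_square_norm arc_param_norm[OF arc])
  have "w (a, b) \<bullet> \<gamma>2 a = d * curv \<gamma>1 \<gamma>2 a"
    unfolding w0 arc_param_second[OF arc, of a]
    by (simp add: dot_square_norm norm_mult arc_param_norm[OF arc])
  then have "((\<lambda>p. (w p \<bullet> \<gamma>1 (fst p)) / norm (w p)) has_derivative
      (\<lambda>h. (fst h * (d * curv \<gamma>1 \<gamma>2 a) + (fst h + snd h)) / d)) (at (a, b))"
    using has_derivative_divide[OF dnum dden] nw d zero opp g1
    by (simp add: inner_diff_left inner_add_left)
  moreover have "(\<lambda>h :: real \<times> real. (fst h * (d * curv \<gamma>1 \<gamma>2 a) + (fst h + snd h)) / d) =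
      (\<lambda>h. (curv \<gamma>1 \<gamma>2 a + 1 / d) * fst h + snd h / d)"
    using d by (auto simp: field_simps)
  moreover have "(w p \<bullet> \<gamma>1 (fst p)) / norm (w p) = sgn (\<gamma> (fst p) - \<beta> (snd p)) \<bullet> \<gamma>1 (fst p)" for p
    by (simp add: w_def sgn_div_norm divide_inverse mult.commute)
  ultimately show ?thesis by simp
qed

end

subsection \<open>The differential of the billiard map\<close>

text \<open>The matrix \<open>- [[1 + d k, d], [k + k' + d k k', 1 + d k']]\<close> of one perpendicular flight.\<close>

definition flight_derivative :: "real \<Rightarrow> real \<Rightarrow> real \<Rightarrow> real \<times> real \<Rightarrow> real \<times> real" where
  "flight_derivative d k k' h =
     (let t = - (1 + d * k) * fst h - d * snd h in (t, (k' + 1 / d) * t + fst h / d))"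

text \<open>The pair of boundary parameters of two consecutive collisions determines the angles at both, and
  both angles are arcsines of smooth functions; inverting the first relation gives the flight in the
  coordinates \<open>(s, \<phi>)\<close>.\<close>

lemma flight_local_coordinates:
  fixes \<O> :: "3 \<Rightarrow> complex set"
  assumes tab: "billiard_table \<O>" and ij: "i \<noteq> j"
    and arc: "arc_param (\<O> i) T \<gamma> \<gamma>1 \<gamma>2" and arc': "arc_param (\<O> j) T' \<beta> \<beta>1 \<beta>2"
    and d: "d > 0" and base: "\<beta> b = \<gamma> a + d *\<^sub>R (- \<i> * \<gamma>1 a)" and opp: "\<beta>1 b = - \<gamma>1 a"
  shows "\<exists>g. g (a, 0) = (b, 0) \<and>
    (g has_derivative flight_derivative d (curv \<gamma>1 \<gamma>2 a) (curv \<beta>1 \<beta>2 b)) (at (a, 0)) \<and>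
    (\<forall>\<^sub>F w in nhds (a, 0). billiard_map \<O> (collision_coords (\<O> i) \<gamma> w) (collision_coords (\<O> j) \<beta> (g w)))"
proof -
  define n n' where "n s = - \<i> * \<gamma>1 s" and "n' t = - \<i> * \<beta>1 t" for s t
  define \<nu> where "\<nu> p = sgn (\<beta> (snd p) - \<gamma> (fst p))" for p
  \<comment> \<open>\<open>G\<close> and \<open>E\<close> read off the coordinates of the start and
    of the end of a flight from the two boundary parameters. On \<open>U\<close> the ray leaves the
    first obstacle and enters the second, and the window of half a period to each side of
    \<open>b\<close> makes the second parameter unique.\<close>
  define U where "U = {p. \<bar>snd p - b\<bar> < T' / 2 \<and> \<nu> p \<bullet> n (fst p) > 0 \<and> \<nu> p \<bullet> n' (snd p) < 0}"
  define G where "G p = (fst p, arcsin (\<nu> p \<bullet> \<gamma>1 (fst p)))" for p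
  define E where "E p = (snd p, arcsin (\<nu> p \<bullet> \<beta>1 (snd p)))" for p
  define k k' where "k = curv \<gamma>1 \<gamma>2 a" and "k' = curv \<beta>1 \<beta>2 b"
  have ob: "obstacle (\<O> l)" for l by (rule billiard_obstacle[OF tab])
  have un: "unit_normal (\<O> i) (\<gamma> s) = n s" "unit_normal (\<O> j) (\<beta> t) = n' t" for s t
    unfolding n_def n'_def by (rule unit_normal_arc_param(1)[OF ob arc] unit_normal_arc_param(1)[OF ob arc'])+
  have sup': "(x - \<beta> t) \<bullet> n' t \<le> 0" if "x \<in> closure (\<O> j)" for x t
    unfolding n'_def by (rule unit_normal_arc_param(2)[OF ob arc' that])
  have nn: "norm (n s) = 1" "norm (n' t) = 1" for s t
    by (simp_all add: n_def n'_def norm_mult arc_param_norm[OF arc] arc_param_norm[OF arc'])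
  have in_n: "\<i> * n s = \<gamma>1 s" "\<i> * n' t = \<beta>1 t" for s t
    by (simp_all add: n_def n'_def)
  have ne: "\<beta> t \<noteq> \<gamma> s" for s t
    using billiard_closures_disjoint[OF tab ij] arc_param_in_frontier[OF arc, of s]
      arc_param_in_frontier[OF arc', of t] by (auto simp: frontier_def)
  have n\<nu>: "norm (\<nu> p) = 1" for p
    using ne by (simp add: \<nu>_def norm_sgn)
  have cont: "continuous_on UNIV (\<lambda>p. \<gamma> (fst p))" "continuous_on UNIV (\<lambda>p. \<gamma>1 (fst p))"
    "continuous_on UNIV (\<lambda>p. \<beta> (snd p))" "continuous_on UNIV (\<lambda>p. \<beta>1 (snd p))"
    by (rule continuous_on_compose2[OF arc_param_cont(1)[OF arc, of UNIV]]
        continuous_on_compose2[OF arc_param_cont(2)[OF arc, of UNIV]]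
        continuous_on_compose2[OF arc_param_cont(1)[OF arc', of UNIV]]
        continuous_on_compose2[OF arc_param_cont(2)[OF arc', of UNIV]],
        auto intro: continuous_intros)+
  have c\<nu>: "continuous_on UNIV \<nu>"
    unfolding \<nu>_def sgn_div_norm using ne
    by (intro continuous_intros cont) auto
  have \<nu>0: "\<nu> (a, b) = n a"
  proof -
    have "\<nu> (a, b) = sgn (\<beta> b - \<gamma> a)" by (simp add: \<nu>_def)
    also have "\<beta> b - \<gamma> a = d *\<^sub>R n a" by (simp add: base n_def)
    also have "sgn (d *\<^sub>R n a) = n a"
      unfolding sgn_scaleR using d nn by (simp add: sgn_div_norm)
    finally show ?thesis .
  qed
  have n'b: "n' b = - n a" by (simp add: n_def n'_def opp)
  have U: "open U" "(a, b) \<in> U"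
  proof -
    have "U = {p. \<bar>snd p - b\<bar> < T' / 2} \<inter> {p. \<nu> p \<bullet> n (fst p) > 0} \<inter> {p. \<nu> p \<bullet> n' (snd p) < 0}"
      by (auto simp: U_def)
    also have "open \<dots>"
      unfolding n_def n'_def by (intro open_Int open_Collect_less continuous_intros cont c\<nu>)
    finally show "open U" .
    have "n a \<bullet> n a = 1" by (simp add: dot_square_norm nn)
    then show "(a, b) \<in> U"
      using arc_param_period_pos[OF arc'] by (simp add: U_def \<nu>0 n'b)
  qed
  have ab1: "\<bar>\<nu> p \<bullet> \<gamma>1 (fst p)\<bar> \<le> 1" "\<bar>\<nu> p \<bullet> \<beta>1 (snd p)\<bar> \<le> 1" for p
    using Cauchy_Schwarz_ineq2[of "\<nu> p"] n\<nu> arc_param_norm[OF arc] arc_param_norm[OF arc']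
    by (metis mult_1)+
  have \<nu>cis: "\<nu> p = n (fst p) * cis (snd (G p))" if "p \<in> U" for p
    using unit_eq_cis_arcsin[OF n\<nu> nn(1), of p "fst p"] that
    by (simp add: U_def G_def in_n)
  have contG: "continuous_on U G"
    unfolding G_def using ab1
    by (intro continuous_intros continuous_on_arcsin continuous_on_subset[OF c\<nu>]
        continuous_on_subset[OF cont(2)]) (auto simp: abs_le_iff)
  \<comment> \<open>A ray cannot enter a convex obstacle twice: the supporting lines at two entry
    points give opposite inequalities between their distances from the start.\<close>
  have injG: "inj_on G U"
  proof (rule inj_onI)
    fix p p' assume p: "p \<in> U" "p' \<in> U" "G p = G p'"
    then have f: "fst p = fst p'" by (simp add: G_def)
    have v: "\<nu> p = \<nu> p'" using \<nu>cis p f by simp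
    define s t t' r r' where "s = fst p" and "t = snd p" and "t' = snd p'"
      and "r = norm (\<beta> t - \<gamma> s)" and "r' = norm (\<beta> t' - \<gamma> s)"
    have bt: "\<beta> t - \<gamma> s = r *\<^sub>R \<nu> p" "\<beta> t' - \<gamma> s = r' *\<^sub>R \<nu> p"
    proof -
      have "\<nu> p = sgn (\<beta> t - \<gamma> s)" "\<nu> p = sgn (\<beta> t' - \<gamma> s)"
        using v f by (simp_all add: \<nu>_def s_def t_def t'_def)
      then show "\<beta> t - \<gamma> s = r *\<^sub>R \<nu> p" "\<beta> t' - \<gamma> s = r' *\<^sub>R \<nu> p"
        unfolding r_def r'_def by (metis norm_scaleR_sgn)+
    qed
    have "\<beta> t - \<beta> t' = (r - r') *\<^sub>R \<nu> p"
      using bt by (simp add: algebra_simps)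
    then have e1: "(\<beta> t - \<beta> t') \<bullet> n' t' = (r - r') * (\<nu> p \<bullet> n' t')"
      "(\<beta> t' - \<beta> t) \<bullet> n' t = (r' - r) * (\<nu> p \<bullet> n' t)"
    proof -
      assume *: "\<beta> t - \<beta> t' = (r - r') *\<^sub>R \<nu> p"
      show "(\<beta> t - \<beta> t') \<bullet> n' t' = (r - r') * (\<nu> p \<bullet> n' t')"
        unfolding * by simp
      have "\<beta> t' - \<beta> t = (r' - r) *\<^sub>R \<nu> p" using bt by (simp add: algebra_simps)
      then show "(\<beta> t' - \<beta> t) \<bullet> n' t = (r' - r) * (\<nu> p \<bullet> n' t)"
        by simp
    qed
    have cl: "\<beta> t \<in> closure (\<O> j)" "\<beta> t' \<in> closure (\<O> j)"
      using arc_param_in_frontier[OF arc'] by (auto simp: frontier_def)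
    have neg: "\<nu> p \<bullet> n' t' < 0" "\<nu> p \<bullet> n' t < 0"
      using p v by (auto simp: U_def t_def t'_def)
    have "r - r' \<ge> 0" using sup'[OF cl(1), of t'] e1(1) neg(1) by (simp add: mult_le_0_iff)
    moreover have "r' - r \<ge> 0" using sup'[OF cl(2), of t] e1(2) neg(2) by (simp add: mult_le_0_iff)
    ultimately have "r = r'" by simp
    then have "\<beta> t = \<beta> t'" using bt by (metis diff_add_cancel)
    moreover have "\<bar>t - b\<bar> < T' / 2" "\<bar>t' - b\<bar> < T' / 2" using p by (simp_all add: U_def t_def t'_def)
    then have "\<bar>t - t'\<bar> < T'" using abs_triangle_ineq4[of "t - b" "t' - b"] by simp

    ultimately have "t = t'" using arc_param_inj[OF arc'] by blast
    then show "p = p'" using f by (simp add: prod_eq_iff t_def t'_def)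
  qed
  \<comment> \<open>Differentiability of \<open>G\<close> is available at the base point only.
    Invariance of domain gives an open image from continuity and injectivity; the derivative of the
    inverse is then needed at one point.\<close>
  have opG: "open (G ` U)" by (rule invariance_of_domain[OF contG U(1) injG])
  have orth: "\<nu> (a, b) \<bullet> \<gamma>1 a = 0" "\<nu> (a, b) \<bullet> \<beta>1 b = 0"
    by (simp_all add: \<nu>0 n_def opp inner_i_mult_self)
  have dasin: "((\<lambda>p. arcsin (f p)) has_derivative f') (at (a, b))"
    if "(f has_derivative f') (at (a, b))" "f (a, b) = 0" for f :: "real \<times> real \<Rightarrow> real" and f'
  proof -
    have "(arcsin has_derivative (\<lambda>x. x)) (at (f (a, b)))"
      using DERIV_arcsin[of 0] that(2) by (simp add: has_field_derivative_def lambda_one[symmetric])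
    from has_derivative_compose[OF that(1) this] show ?thesis .
  qed
  have dG2: "((\<lambda>p. \<nu> p \<bullet> \<gamma>1 (fst p)) has_derivative (\<lambda>h. - ((k + 1 / d) * fst h + snd h / d))) (at (a, b))"
  proof -
    have "\<nu> p \<bullet> \<gamma>1 (fst p) = - (sgn (\<gamma> (fst p) - \<beta> (snd p)) \<bullet> \<gamma>1 (fst p))" for p
      unfolding \<nu>_def by (metis inner_minus_left minus_diff_eq sgn_minus)
    then show ?thesis
      using has_derivative_minus[OF grazing_has_derivative[OF arc arc' d base opp]] by (simp add: k_def)
  qed
  have dE2: "((\<lambda>p. \<nu> p \<bullet> \<beta>1 (snd p)) has_derivative (\<lambda>h. (k' + 1 / d) * snd h + fst h / d)) (at (a, b))"
  proof -
    have base': "\<gamma> a = \<beta> b + d *\<^sub>R (- \<i> * \<beta>1 b)" and opp': "\<gamma>1 a = - \<beta>1 b"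
      using base opp by simp_all
    have sw: "((\<lambda>p. (snd p, fst p)) has_derivative (\<lambda>h. (snd h, fst h))) (at (a, b))"
      by (auto intro!: derivative_eq_intros)
    have "((\<lambda>p. sgn (\<beta> (fst p) - \<gamma> (snd p)) \<bullet> \<beta>1 (fst p)) has_derivative
        (\<lambda>h. (k' + 1 / d) * fst h + snd h / d)) (at (snd (a, b), fst (a, b)))"
      using grazing_has_derivative[OF arc' arc d base' opp'] by (simp add: k'_def)
    from has_derivative_compose[OF sw this] show ?thesis by (simp add: \<nu>_def)
  qed
  have dG: "(G has_derivative (\<lambda>h. (fst h, - ((k + 1 / d) * fst h + snd h / d)))) (at (a, b))"
    unfolding G_def
    by (intro has_derivative_Pair dasin dG2) (auto intro: derivative_intros simp: orth)
  have dE: "(E has_derivative (\<lambda>h. (snd h, (k' + 1 / d) * snd h + fst h / d))) (at (a, b))"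
    unfolding E_def
    by (intro has_derivative_Pair dasin dE2) (auto intro: derivative_intros simp: orth)
  define F where "F = inv_into U G"
  have FG: "F (G p) = p" if "p \<in> U" for p
    unfolding F_def using inv_into_f_f[OF injG that] .
  have G0: "G (a, b) = (a, 0)" by (simp add: G_def orth)
  have E0: "E (a, b) = (b, 0)" by (simp add: E_def orth)
  have F0: "F (a, 0) = (a, b)" using FG[OF U(2)] G0 by simp
  have dF: "(F has_derivative (\<lambda>h. (fst h, - (1 + d * k) * fst h - d * snd h))) (at (a, 0))"
  proof -
    have "(\<lambda>h :: real \<times> real. (fst h, - ((k + 1 / d) * fst h + snd h / d))) \<circ>
        (\<lambda>h. (fst h, - (1 + d * k) * fst h - d * snd h)) = id"
      using d by (auto simp: fun_eq_iff field_simps)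
    from has_derivative_inverse_strong[OF U(1,2) contG FG dG this] show ?thesis
      by (simp add: G0)
  qed
  define g where "g w = E (F w)" for w
  have "g (a, 0) = (b, 0)" by (simp add: g_def F0 E0)
  moreover have "(g has_derivative flight_derivative d k k') (at (a, 0))"
  proof -
    have "(E has_derivative (\<lambda>h. (snd h, (k' + 1 / d) * snd h + fst h / d))) (at (F (a, 0)))"
      using dE by (simp add: F0)
    from has_derivative_compose[OF dF this] show ?thesis
      by (simp add: g_def[abs_def] flight_derivative_def[abs_def] Let_def)
  qed
  moreover have "billiard_map \<O> (collision_coords (\<O> i) \<gamma> w) (collision_coords (\<O> j) \<beta> (g w))"
    if wU: "w \<in> G ` U" for w
  proof -
    obtain p where p: "p \<in> U" "w = G p" using wU by blast
    have gw: "g w = E p" by (simp add: g_def p FG)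
    define v where "v = \<nu> p"
    define m where "m = n' (snd p)"
    define v' where "v' = v - (2 * (v \<bullet> m)) *\<^sub>R m"
    have mm: "m \<bullet> m = 1" by (simp add: m_def dot_square_norm nn)
    have vm: "v \<bullet> m < 0" using p(1) by (simp add: U_def v_def m_def)
    have "v' \<bullet> m = - (v \<bullet> m)" by (simp add: v'_def inner_diff_left mm)
    moreover have "norm v' = 1"
    proof -
      have "v' \<bullet> v' = v \<bullet> v"
        unfolding v'_def using mm
        by (simp add: inner_diff_left inner_diff_right inner_commute algebra_simps)
      then show ?thesis using n\<nu>[of p] by (simp add: v_def norm_eq_sqrt_inner)
    qed
    \<comment> \<open>Reflection preserves the tangential component, so the arcsine in
      \<open>E\<close>, taken of the incoming velocity, is also the angle of the outgoing
      one.\<close>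
    moreover have "v' \<bullet> (\<i> * m) = v \<bullet> (\<i> * m)"
      by (simp add: v'_def inner_diff_left inner_i_mult_self)
    ultimately have v'cis: "v' = m * cis (arcsin (v \<bullet> (\<i> * m)))"
      using unit_eq_cis_arcsin[of v' m] vm nn(2) by (simp add: m_def)
    have "collision_coords (\<O> i) \<gamma> w = (\<gamma> (fst p), v)"
      using \<nu>cis[OF p(1)] by (simp add: collision_coords_def p(2) un v_def G_def)
    moreover have "collision_coords (\<O> j) \<beta> (g w) = (\<beta> (snd p), v')"
      unfolding v'cis by (simp add: collision_coords_def gw E_def un m_def v_def in_n)
    moreover have "billiard_map \<O> (\<gamma> (fst p), v) (\<beta> (snd p), v')"
      using p(1) arc_param_in_frontier[OF arc] arc_param_in_frontier[OF arc']
      by (intro billiard_mapI[OF tab ij])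
        (auto simp: un v_def v'_def m_def U_def \<nu>_def)
    ultimately show ?thesis by simp
  qed
  moreover have "(a, 0) \<in> G ` U" using G0 U(2) by (metis imageI)
  ultimately show ?thesis
    using opG unfolding k_def k'_def eventually_nhds by blast
qed

section \<open>Independence of the differential from the coordinate expression\<close>

lemma has_billiard_derivativeE:
  assumes "has_billiard_derivative \<O> p x D"
  obtains i j \<gamma> \<gamma>' z f where "arclength_param (\<O> i) \<gamma>" "arclength_param (\<O> j) \<gamma>'"
    "x = collision_coords (\<O> i) \<gamma> z"
    "\<forall>\<^sub>F w in nhds z. snd w \<in> {-pi/2..pi/2} \<and> snd (f w) \<in> {-pi/2..pi/2} \<and>
       (billiard_map \<O> ^^ p) (collision_coords (\<O> i) \<gamma> w) (collision_coords (\<O> j) \<gamma>' (f w))"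
    "(f has_derivative D) (at z)"
  using assms unfolding has_billiard_derivative_def by (elim exE conjE) (rule that)

lemma eventually_nhds_isCont_compose:
  assumes "isCont g x" "\<forall>\<^sub>F w in nhds (g x). P w"
  shows "\<forall>\<^sub>F w in nhds x. P (g w)"
proof -
  have "filterlim g (nhds (g x)) (nhds x)"
    using assms(1) by (simp add: isCont_def tendsto_at_iff_tendsto_nhds)
  then show ?thesis using assms(2) by (rule eventually_compose_filterlim[rotated])
qed


lemma arclength_curves_same_obstacle:
  assumes tab: "billiard_table \<O>" and "arc_param (\<O> i) T \<gamma> \<gamma>1 \<gamma>2" "\<gamma> a \<in> frontier (\<O> j)"
  shows "i = j"
  using billiard_closures_disjoint[OF tab, of i j] arc_param_in_frontier[OF assms(2), of a] assms(3)
  by (auto simp: frontier_def)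

lemma billiard_map_relpow_2_unique:
  assumes "billiard_table \<O>" "(billiard_map \<O> ^^ 2) x y" "(billiard_map \<O> ^^ 2) x z"
  shows "y = z"
proof -
  obtain u v where "billiard_map \<O> x u" "billiard_map \<O> u y" "billiard_map \<O> x v" "billiard_map \<O> v z"
    using assms(2,3) by (auto simp: numeral_2_eq_2)
  then show ?thesis using billiard_map_right_unique[OF assms(1)] by metis
qed

lemma cis_eq_1_small:
  assumes "cis x = 1" "x \<in> {-pi/2..pi/2}"
  shows "x = 0"
proof -
  have "sin x = sin 0" using assms(1) by (simp add: complex_eq_iff)
  then show ?thesis using sin_inj_pi[of x 0] assms(2) by simp
qed

text \<open>A period two orbit in geometric form: two boundary points at distance \<open>d\<close>
  whose outer normals point at each other.\<close>

locale facing_pair =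
  fixes \<O> :: "3 \<Rightarrow> complex set" and i j :: 3 and A B e :: complex and d :: real
  assumes tab: "billiard_table \<O>" and ij: "i \<noteq> j"
    and A: "A \<in> frontier (\<O> i)" and B: "B \<in> frontier (\<O> j)"
    and nA: "unit_normal (\<O> i) A = e" and nB: "unit_normal (\<O> j) B = - e"
    and d: "d > 0" and BA: "B = A + d *\<^sub>R e"
begin

lemma period_two_steps: "billiard_map \<O> (A, e) (B, - e)" "billiard_map \<O> (B, - e) (A, e)"
proof -
  have ob: "obstacle (\<O> l)" for l by (rule billiard_obstacle[OF tab])
  have ne: "norm e = 1" using unit_normal_props(1)[OF ob A] nA by simp
  then have ee: "e \<bullet> e = 1" by (simp add: dot_square_norm)
  have s: "e = sgn (B - A)" "- e = sgn (A - B)"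
    using d ne by (simp_all add: BA sgn_scaleR) (simp_all add: sgn_div_norm)
  show "billiard_map \<O> (A, e) (B, - e)"
    by (rule billiard_mapI[OF tab ij A B s(1)]) (simp_all add: nA nB ee complex_eq_iff)
  show "billiard_map \<O> (B, - e) (A, e)"
    by (rule billiard_mapI[OF tab ij[symmetric] B A s(2)]) (simp_all add: nA nB ee complex_eq_iff)
qed

text \<open>The return is expressed in a possibly different curve of the same obstacle, because
  \<open>has_billiard_derivative\<close> allows different curves at the start and at the
  end.\<close>

lemma period_two_local_map:
  assumes arc: "arc_param (\<O> i) T \<gamma> \<gamma>1 \<gamma>2" "\<gamma> a = A"
    and arcB: "arc_param (\<O> j) T\<^sub>B \<beta> \<beta>1 \<beta>2" "\<beta> b = B"
    and arc': "arc_param (\<O> i) T' \<gamma>' \<gamma>1' \<gamma>2'" "\<gamma>' a' = A"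
  shows "\<exists>g. g (a, 0) = (a', 0) \<and>
    (g has_derivative flight_derivative d (curv \<beta>1 \<beta>2 b) (curv \<gamma>1 \<gamma>2 a) \<circ>
       flight_derivative d (curv \<gamma>1 \<gamma>2 a) (curv \<beta>1 \<beta>2 b)) (at (a, 0)) \<and>
    (\<forall>\<^sub>F w in nhds (a, 0).
       (billiard_map \<O> ^^ 2) (collision_coords (\<O> i) \<gamma> w) (collision_coords (\<O> i) \<gamma>' (g w)))"
proof -
  have ob: "obstacle (\<O> l)" for l by (rule billiard_obstacle[OF tab])
  have n: "- \<i> * \<gamma>1 a = e" "- \<i> * \<beta>1 b = - e" "- \<i> * \<gamma>1' a' = e"
    using unit_normal_arc_param(1)[OF ob arc(1), of a] unit_normal_arc_param(1)[OF ob arcB(1), of b]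
      unit_normal_arc_param(1)[OF ob arc'(1), of a'] nA nB arc(2) arcB(2) arc'(2) by simp_all
  have opp: "\<beta>1 b = - \<gamma>1 a" "\<gamma>1' a' = - \<beta>1 b"
  proof -
    have "\<i> * (- \<i> * \<beta>1 b) = \<i> * (- (- \<i> * \<gamma>1 a))" unfolding n ..
    then show "\<beta>1 b = - \<gamma>1 a" by simp
    have "\<i> * (- \<i> * \<gamma>1' a') = \<i> * (- (- \<i> * \<beta>1 b))" unfolding n by simp
    then show "\<gamma>1' a' = - \<beta>1 b" by simp
  qed
  have base: "\<beta> b = \<gamma> a + d *\<^sub>R (- \<i> * \<gamma>1 a)" "\<gamma>' a' = \<beta> b + d *\<^sub>R (- \<i> * \<beta>1 b)"
    unfolding n arc arcB arc' by (simp_all add: BA)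
  obtain g1 where g1: "g1 (a, 0) = (b, 0)"
    "(g1 has_derivative flight_derivative d (curv \<gamma>1 \<gamma>2 a) (curv \<beta>1 \<beta>2 b)) (at (a, 0))"
    "\<forall>\<^sub>F w in nhds (a, 0). billiard_map \<O> (collision_coords (\<O> i) \<gamma> w) (collision_coords (\<O> j) \<beta> (g1 w))"
    using flight_local_coordinates[OF tab ij arc(1) arcB(1) d base(1) opp(1)] by blast
  obtain g2 where g2: "g2 (b, 0) = (a', 0)"
    "(g2 has_derivative flight_derivative d (curv \<beta>1 \<beta>2 b) (curv \<gamma>1' \<gamma>2' a')) (at (b, 0))"
    "\<forall>\<^sub>F w in nhds (b, 0). billiard_map \<O> (collision_coords (\<O> j) \<beta> w) (collision_coords (\<O> i) \<gamma>' (g2 w))"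
    using flight_local_coordinates[OF tab ij[symmetric] arcB(1) arc'(1) d base(2) opp(2)] by blast
  have cu: "curv \<gamma>1' \<gamma>2' a' = curv \<gamma>1 \<gamma>2 a"
    using curv_unique[OF ob arc(1) arc'(1), of a a'] arc(2) arc'(2) by simp
  have "(g2 \<circ> g1 has_derivative flight_derivative d (curv \<beta>1 \<beta>2 b) (curv \<gamma>1 \<gamma>2 a) \<circ>
       flight_derivative d (curv \<gamma>1 \<gamma>2 a) (curv \<beta>1 \<beta>2 b)) (at (a, 0))"
    using diff_chain_at[OF g1(2)] g2(2) g1(1) cu by simp
  moreover have "\<forall>\<^sub>F w in nhds (a, 0).
      billiard_map \<O> (collision_coords (\<O> j) \<beta> (g1 w)) (collision_coords (\<O> i) \<gamma>' (g2 (g1 w)))"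
    using eventually_nhds_isCont_compose[OF has_derivative_continuous[OF g1(2)]] g2(3) g1(1) by simp
  then have "\<forall>\<^sub>F w in nhds (a, 0).
      (billiard_map \<O> ^^ 2) (collision_coords (\<O> i) \<gamma> w) (collision_coords (\<O> i) \<gamma>' ((g2 \<circ> g1) w))"
    using g1(3) by eventually_elim (auto simp: numeral_2_eq_2)
  ultimately show ?thesis using g1(1) g2(1) by (intro exI[of _ "g2 \<circ> g1"]) auto
qed

text \<open>Existence is the local form of the return map. Conversely, any coordinate expression
  must start and end at \<open>A\<close> with angle 0; near that point the return map is
  single-valued and the coordinates are injective, so the expression agrees with the local form and
  has the same derivative.\<close>

lemma period_two_derivative_iff:
  assumes arc: "arclength_param (\<O> i) \<gamma>" "arc_param (\<O> i) T \<gamma> \<gamma>1 \<gamma>2" "\<gamma> a = A"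
    and arcB: "arc_param (\<O> j) T\<^sub>B \<beta> \<beta>1 \<beta>2" "\<beta> b = B"
  shows "has_billiard_derivative \<O> 2 (A, e) D \<longleftrightarrow>
    D = flight_derivative d (curv \<beta>1 \<beta>2 b) (curv \<gamma>1 \<gamma>2 a) \<circ>
      flight_derivative d (curv \<gamma>1 \<gamma>2 a) (curv \<beta>1 \<beta>2 b)" (is "_ \<longleftrightarrow> D = ?M")
proof
  have ob: "obstacle (\<O> l)" for l by (rule billiard_obstacle[OF tab])
  have ne: "e \<noteq> 0" using unit_normal_props(1)[OF ob A] nA by auto
  {
    assume D: "D = ?M"
    obtain g where g: "g (a, 0) = (a, 0)" "(g has_derivative ?M) (at (a, 0))"
      "\<forall>\<^sub>F w in nhds (a, 0).
       (billiard_map \<O> ^^ 2) (collision_coords (\<O> i) \<gamma> w) (collision_coords (\<O> i) \<gamma> (g w))"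
      using period_two_local_map[OF arc(2,3) arcB arc(2,3)] by blast
    have op: "open {w :: real \<times> real. snd w \<in> {-pi/2<..<pi/2}}"
      by (rule open_Collect_conj[of "\<lambda>w. -pi/2 < snd w" "\<lambda>w. snd w < pi/2", simplified greaterThanLessThan_iff[symmetric]])
        (auto intro!: open_Collect_less continuous_intros)
    have ev: "\<forall>\<^sub>F w :: real \<times> real in nhds (a, 0). snd w \<in> {-pi/2..pi/2}"
      unfolding eventually_nhds using op by (intro exI conjI[OF op]) auto
    then have ev': "\<forall>\<^sub>F w in nhds (a, 0). snd (g w) \<in> {-pi/2..pi/2}"
      using eventually_nhds_isCont_compose[OF has_derivative_continuous[OF g(2)], of "\<lambda>w. snd w \<in> {-pi/2..pi/2}"]
      by (simp only: g(1))
    have "\<forall>\<^sub>F w in nhds (a, 0). snd w \<in> {-pi/2..pi/2} \<and> snd (g w) \<in> {-pi/2..pi/2} \<and>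
           (billiard_map \<O> ^^ 2) (collision_coords (\<O> i) \<gamma> w) (collision_coords (\<O> i) \<gamma> (g w))"
      using ev ev' g(3) by eventually_elim blast
    moreover have "(A, e) = collision_coords (\<O> i) \<gamma> (a, 0)"
      by (simp add: collision_coords_def arc nA)
    ultimately show "has_billiard_derivative \<O> 2 (A, e) D"
      unfolding has_billiard_derivative_def D using arc(1) g(2) by blast
  next
    assume hD: "has_billiard_derivative \<O> 2 (A, e) D"
    obtain i0 j0 \<delta> \<delta>' z f where
      al: "arclength_param (\<O> i0) \<delta>" "arclength_param (\<O> j0) \<delta>'"
      and x: "(A, e) = collision_coords (\<O> i0) \<delta> z"
      and ev: "\<forall>\<^sub>F w in nhds z. snd w \<in> {-pi/2..pi/2} \<and> snd (f w) \<in> {-pi/2..pi/2} \<and>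
           (billiard_map \<O> ^^ 2) (collision_coords (\<O> i0) \<delta> w) (collision_coords (\<O> j0) \<delta>' (f w))"
      and df: "(f has_derivative D) (at z)"
      by (rule has_billiard_derivativeE[OF hD])
    obtain S \<delta>1 \<delta>2 where ar: "arc_param (\<O> i0) S \<delta> \<delta>1 \<delta>2" using arclength_param_imp_arc_param[OF al(1)] .
    obtain S' \<delta>1' \<delta>2' where ar': "arc_param (\<O> j0) S' \<delta>' \<delta>1' \<delta>2'" using arclength_param_imp_arc_param[OF al(2)] .
    have z1: "\<delta> (fst z) = A" using x by (simp add: collision_coords_def split_beta)
    have i0: "i0 = i" using arclength_curves_same_obstacle[OF tab ar, of "fst z" i] z1 A by simp
    have at_z: "snd z \<in> {-pi/2..pi/2}" "snd (f z) \<in> {-pi/2..pi/2}"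
      "(billiard_map \<O> ^^ 2) (collision_coords (\<O> i0) \<delta> z) (collision_coords (\<O> j0) \<delta>' (f z))"
      using eventually_nhds_x_imp_x[OF ev] by auto
    have "e * cis (snd z) = e" using x z1 i0 nA by (simp add: collision_coords_def split_beta)
    then have z2: "snd z = 0" using ne at_z(1) cis_eq_1_small by simp
    have "(billiard_map \<O> ^^ 2) (A, e) (A, e)"
      using period_two_steps by (auto simp: numeral_2_eq_2)
    then have fz: "collision_coords (\<O> j0) \<delta>' (f z) = (A, e)"
      using at_z(3) x billiard_map_relpow_2_unique[OF tab] by metis
    have f1: "\<delta>' (fst (f z)) = A" using fz by (simp add: collision_coords_def split_beta)
    have j0: "j0 = i" using arclength_curves_same_obstacle[OF tab ar', of "fst (f z)" i] f1 A by simp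
    have "e * cis (snd (f z)) = e" using fz f1 j0 nA by (simp add: collision_coords_def split_beta)
    then have f2: "snd (f z) = 0" using ne at_z(2) cis_eq_1_small by simp
    have zz: "z = (fst z, 0)" "f z = (fst (f z), 0)" using z2 f2 by (auto simp: prod_eq_iff)
    obtain g where g: "g z = f z"
      "(g has_derivative flight_derivative d (curv \<beta>1 \<beta>2 b) (curv \<delta>1 \<delta>2 (fst z)) \<circ>
       flight_derivative d (curv \<delta>1 \<delta>2 (fst z)) (curv \<beta>1 \<beta>2 b)) (at z)"
      "\<forall>\<^sub>F w in nhds z.
       (billiard_map \<O> ^^ 2) (collision_coords (\<O> i) \<delta> w) (collision_coords (\<O> i) \<delta>' (g w))"
      using period_two_local_map[OF ar[unfolded i0] z1 arcB ar'[unfolded j0] f1]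
      unfolding zz[symmetric] by blast
    have cu: "curv \<delta>1 \<delta>2 (fst z) = curv \<gamma>1 \<gamma>2 a"
      using curv_unique[OF ob ar[unfolded i0] arc(2)] z1 arc(3) by simp
    \<comment> \<open>A neighbourhood on which \<open>collision_coords\<close> is injective:
      boundary parameters less than a period apart, and angles where the sine is injective. Both
      expressions end up in it near \<open>z\<close> by continuity at \<open>z\<close>.\<close>
    define W where "W = {w :: real \<times> real. \<bar>fst w - fst (f z)\<bar> < S' / 2 \<and> -pi/2 < snd w \<and> snd w < pi/2}"
    have "open W"
      unfolding W_def by (intro open_Collect_conj open_Collect_less continuous_intros)
    moreover have fzW: "f z \<in> W" using f2 arc_param_period_pos[OF ar'] by (simp add: W_def)
    ultimately have evW: "\<forall>\<^sub>F w in nhds (f z). w \<in> W" by (rule eventually_nhds_in_open)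
    have "\<forall>\<^sub>F w in nhds z. f w \<in> W" "\<forall>\<^sub>F w in nhds z. g w \<in> W"
      using eventually_nhds_isCont_compose[OF has_derivative_continuous[OF df] evW]
        eventually_nhds_isCont_compose[OF has_derivative_continuous[OF g(2)], of "\<lambda>w. w \<in> W"] evW g(1)
      by simp_all
    then have "\<forall>\<^sub>F w in nhds z. g w = f w"
      using ev g(3)
    proof eventually_elim
      case (elim w)
      have "collision_coords (\<O> i) \<delta>' (f w) = collision_coords (\<O> i) \<delta>' (g w)"
        using elim(3,4) billiard_map_relpow_2_unique[OF tab] unfolding i0 j0 by blast
      then have eq: "\<delta>' (fst (f w)) = \<delta>' (fst (g w))"
        "unit_normal (\<O> i) (\<delta>' (fst (f w))) * cis (snd (f w)) =
         unit_normal (\<O> i) (\<delta>' (fst (g w))) * cis (snd (g w))"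
        by (auto simp: collision_coords_def split_beta)
      have "\<bar>fst (f w) - fst (g w)\<bar> < S'"
        using elim(1,2) abs_triangle_ineq4[of "fst (f w) - fst (f z)" "fst (g w) - fst (f z)"]
        by (simp add: W_def)
      then have 1: "fst (f w) = fst (g w)" using arc_param_inj[OF ar'] eq(1) by blast
      have "\<delta>' (fst (f w)) \<in> frontier (\<O> i)" using arc_param_in_frontier[OF ar'] j0 by simp
      then have "unit_normal (\<O> i) (\<delta>' (fst (f w))) \<noteq> 0" using unit_normal_props(1)[OF ob] by force
      then have "cis (snd (f w)) = cis (snd (g w))" using eq(2) 1 by simp
      then have s: "sin (snd (f w)) = sin (snd (g w))" by (simp add: complex_eq_iff)
      have b: "-pi/2 < snd (f w)" "snd (f w) < pi/2" "-pi/2 < snd (g w)" "snd (g w) < pi/2"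
        using elim(1,2) by (simp_all add: W_def)
      have "snd (f w) = snd (g w)"
        by (rule sin_inj_pi[OF _ _ _ _ s]) (use b in linarith)+
      with 1 show ?case by (simp add: prod_eq_iff)
    qed
    then have "\<forall>\<^sub>F w in at z. g w = f w" by (simp add: eventually_nhds_conv_at)
    then have "(f has_derivative ?M) (at z)"
      using has_derivative_transform_eventually[OF g(2), of f] g(1) cu by simp
    with df show "D = ?M" using has_derivative_unique by blast
  }
qed

end

text \<open>With \<open>q \<noteq> 0\<close> an eigenvector has nonzero first component, so the
  second can be eliminated; conversely \<open>(q, c - p)\<close> is an eigenvector for every root
  \<open>c\<close> of the characteristic polynomial.\<close>

lemma eigenvalue_two_by_two:
  fixes p q r s c :: real
  assumes "q \<noteq> 0"
  shows "(\<exists>w. w \<noteq> 0 \<and> (p * fst w + q * snd w, r * fst w + s * snd w) = c *\<^sub>R w) \<longleftrightarrow>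
    c\<^sup>2 - (p + s) * c + (p * s - q * r) = 0"
proof
  assume "\<exists>w. w \<noteq> 0 \<and> (p * fst w + q * snd w, r * fst w + s * snd w) = c *\<^sub>R w"
  then obtain x y where w: "(x, y) \<noteq> 0" "p * x + q * y = c * x" "r * x + s * y = c * y"
    by (auto simp: prod_eq_iff)
  have "x \<noteq> 0" using w assms by (auto simp: zero_prod_def)
  have y: "y = (c - p) * x / q" using w(2) assms by (simp add: field_simps)
  have "(r + s * (c - p) / q - c * (c - p) / q) * x = 0"
    using w(3) unfolding y by (simp add: algebra_simps)
  then have "(r + s * (c - p) / q - c * (c - p) / q) * q = 0" using \<open>x \<noteq> 0\<close> by simp
  then have "r * q + s * (c - p) - c * (c - p) = 0"
    using assms by (simp add: left_diff_distrib distrib_right)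
  then show "c\<^sup>2 - (p + s) * c + (p * s - q * r) = 0"
    by (simp add: algebra_simps power2_eq_square)
next
  assume "c\<^sup>2 - (p + s) * c + (p * s - q * r) = 0"
  then have "(p * q + q * (c - p), r * q + s * (c - p)) = c *\<^sub>R (q, c - p)"
    by (simp add: power2_eq_square algebra_simps)
  moreover have "(q, c - p) \<noteq> 0" using assms by (simp add: zero_prod_def)
  ultimately show "\<exists>w. w \<noteq> 0 \<and> (p * fst w + q * snd w, r * fst w + s * snd w) = c *\<^sub>R w"
    by (intro exI[of _ "(q, c - p)"]) simp
qed

text \<open>The signs of the two flight matrices cancel; their product has determinant 1 and trace
  \<open>4 * (1 + d * k) * (1 + d * k') - 2\<close>, so its characteristic polynomial has the roots
  \<open>M\<close> and \<open>1 / M\<close>.\<close>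

lemma flight_return_eigenvalues:
  fixes d k k' M c :: real
  assumes pos: "d > 0" "k > 0" "k' > 0" and M: "M > 0" "M + 1 / M = 4 * (1 + d * k) * (1 + d * k') - 2"
  shows "(\<exists>w. w \<noteq> 0 \<and> (flight_derivative d k' k \<circ> flight_derivative d k k') w = c *\<^sub>R w) \<longleftrightarrow>
    c \<in> {1 / M, M}"
proof -
  define h where "h = k + k' + d * k * k'"
  define p q r s where "p = (1 + d * k') * (1 + d * k) + d * h" and "q = 2 * d * (1 + d * k')"
    and "r = 2 * (1 + d * k) * h" and "s = d * h + (1 + d * k) * (1 + d * k')"
  have "q \<noteq> 0" using pos by (simp add: q_def) (smt (verit) mult_pos_pos)
  have fl: "(flight_derivative d k' k \<circ> flight_derivative d k k') w =
      (p * fst w + q * snd w, r * fst w + s * snd w)" for w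
    using pos(1) by (simp add: flight_derivative_def Let_def p_def q_def r_def s_def h_def field_simps)
  have tr: "p + s = M + 1 / M" unfolding M(2) by (simp add: p_def s_def h_def algebra_simps)
  have det: "p * s - q * r = 1" by (simp add: p_def q_def r_def s_def h_def algebra_simps power2_eq_square)
  have "c\<^sup>2 - (p + s) * c + (p * s - q * r) = (c - M) * (c - 1 / M)"
    unfolding tr det using M(1) by (simp add: field_simps power2_eq_square)
  then have "c\<^sup>2 - (p + s) * c + (p * s - q * r) = 0 \<longleftrightarrow> c \<in> {1 / M, M}" by auto
  then show ?thesis
    unfolding fl using eigenvalue_two_by_two[OF \<open>q \<noteq> 0\<close>, of p r s c] by blast
qed

subsection \<open>Decay rate of three-term recursions\<close>

text \<open>The ratios \<open>x (j - 1) / x j\<close> satisfy the recursion of \<open>R\<close> up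
  to a small error. Since the ratios are at least 1 in absolute value and \<open>R\<close> is at
  least \<rho>, one backward step contracts the distance to \<open>R\<close> by
  \<open>1 / \<rho>\<close>: the local errors add up to a multiple of \<eta>, and the unknown ratio
  at the free end is forgotten geometrically.\<close>

lemma backward_recursion_ratios:
  fixes x c R :: "nat \<Rightarrow> real"
  assumes \<eta>: "0 \<le> \<eta>" "\<eta> \<le> 1/2" and c: "\<And>j. 2 + 4 * \<eta> \<le> c j" "\<And>j. c j \<le> C"
    and R: "\<And>j. R j = c j - 1 / R (Suc j)" "\<And>j. \<rho> \<le> R j" "\<rho> > 1"
    and rec: "\<And>j. j0 < j \<Longrightarrow> j < m \<Longrightarrow>
      \<bar>x (j - 1) + x (j + 1) - c j * x j\<bar> \<le> \<eta> * (\<bar>x (j - 1)\<bar> + \<bar>x j\<bar> + \<bar>x (j + 1)\<bar>)"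
    and last: "\<bar>x (m - 1) - c m / 2 * x m\<bar> \<le> \<eta> * (\<bar>x (m - 1)\<bar> + \<bar>x m\<bar>)"
    and j0: "j0 < m" and x0: "x j0 \<noteq> 0"
  shows "x m \<noteq> 0"
    and "\<bar>ln \<bar>x j0\<bar> - ln \<bar>x m\<bar> - (\<Sum>j\<in>{j0<..m}. ln (R j))\<bar>
      \<le> real m * (\<eta> * (2 * C + 6) / (1 - 1 / \<rho>)) + (3 * C + 4) / (1 - 1 / \<rho>)"
proof -
  have C: "C \<ge> 2" using c[of 0] \<eta> by linarith
  \<comment> \<open>The margin \<open>4 * \<eta>\<close> in the lower bound for \<open>c\<close>
    absorbs the perturbation, so that the absolute values do not decrease backwards.\<close>
  have mono: "\<bar>x j\<bar> \<le> \<bar>x (j - 1)\<bar>" if "j0 < j" "j \<le> m" for j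
    using that(2,1)
  proof (induction rule: inc_induct)
    case base
    have "c m / 2 * \<bar>x m\<bar> - \<bar>x (m - 1)\<bar> \<le> \<bar>x (m - 1) - c m / 2 * x m\<bar>"
      using abs_triangle_ineq2_sym[of "c m / 2 * x m" "x (m - 1)"] c(1)[of m] \<eta> by (simp add: abs_mult)
    then have 1: "c m / 2 * \<bar>x m\<bar> - \<eta> * \<bar>x m\<bar> \<le> (1 + \<eta>) * \<bar>x (m - 1)\<bar>"
      using last by (simp add: algebra_simps)
    have "(1 + \<eta>) * \<bar>x m\<bar> \<le> (c m / 2 - \<eta>) * \<bar>x m\<bar>"
      using c(1)[of m] by (intro mult_right_mono) auto
    then have "(1 + \<eta>) * \<bar>x m\<bar> \<le> (1 + \<eta>) * \<bar>x (m - 1)\<bar>"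
      using 1 by (simp add: algebra_simps)
    then show ?case using \<eta> by simp
  next
    case (step j)
    then have IH: "\<bar>x (j + 1)\<bar> \<le> \<bar>x j\<bar>" by simp
    have "c j * \<bar>x j\<bar> \<le> \<bar>x (j - 1) + x (j + 1) - c j * x j\<bar> + \<bar>x (j - 1)\<bar> + \<bar>x (j + 1)\<bar>"
      using c(1)[of j] \<eta> abs_mult_pos'[of "c j" "x j"]
        abs_triangle_ineq4[of "x (j - 1) + x (j + 1)" "x (j - 1) + x (j + 1) - c j * x j"]
        abs_triangle_ineq[of "x (j - 1)" "x (j + 1)"] by simp
    then have 1: "c j * \<bar>x j\<bar> \<le> (1 + \<eta>) * \<bar>x (j - 1)\<bar> + \<eta> * \<bar>x j\<bar> + (1 + \<eta>) * \<bar>x (j + 1)\<bar>"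
      using rec[of j] step.prems step.hyps by (simp add: algebra_simps)
    have "(1 + \<eta>) * \<bar>x (j + 1)\<bar> \<le> (1 + \<eta>) * \<bar>x j\<bar>" using IH \<eta> by (intro mult_left_mono) auto
    moreover have "(2 + 4 * \<eta>) * \<bar>x j\<bar> \<le> c j * \<bar>x j\<bar>" by (intro mult_right_mono c) auto
    moreover have "0 \<le> \<eta> * \<bar>x j\<bar>" using \<eta> by simp
    ultimately have "(1 + \<eta>) * \<bar>x j\<bar> \<le> (1 + \<eta>) * \<bar>x (j - 1)\<bar>"
      using 1 by (simp add: algebra_simps)
    then show ?case using \<eta> by simp
  qed
  \<comment> \<open>As \<eta> is at most 1/2, half of \<open>\<bar>x (j - 1)\<bar>\<close> can be
    moved to the left, which doubles \<open>C + 2\<close>.\<close>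
  have upper: "\<bar>x (j - 1)\<bar> \<le> (2 * C + 4) * \<bar>x j\<bar>" if j: "j0 < j" "j \<le> m" for j
  proof -
    have cp: "\<bar>c j * x j\<bar> \<le> C * \<bar>x j\<bar>" "0 \<le> C * \<bar>x j\<bar>"
      using c[of j] \<eta> C by (auto simp: abs_mult intro: mult_right_mono)
    have "\<bar>x (j - 1)\<bar> \<le> C * \<bar>x j\<bar> + \<bar>x j\<bar> + \<eta> * (\<bar>x (j - 1)\<bar> + \<bar>x j\<bar> + \<bar>x j\<bar>)"
    proof (cases "j = m")
      case True
      have "\<bar>x (j - 1)\<bar> \<le> \<bar>x (m - 1) - c m / 2 * x m\<bar> + \<bar>c j * x j\<bar> / 2"
        using abs_triangle_ineq[of "x (m - 1) - c m / 2 * x m" "c m / 2 * x m"] True by (simp add: abs_mult)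
      moreover have "0 \<le> \<eta> * \<bar>x j\<bar>" using \<eta> by simp
      ultimately show ?thesis
        using last cp True by (simp add: algebra_simps) (use abs_ge_zero[of "x m"] in linarith)
    next
      case False
      then have IH: "\<bar>x (j + 1)\<bar> \<le> \<bar>x j\<bar>" using mono[of "j + 1"] j by simp
      have "\<eta> * (\<bar>x (j - 1)\<bar> + \<bar>x j\<bar> + \<bar>x (j + 1)\<bar>) \<le> \<eta> * (\<bar>x (j - 1)\<bar> + \<bar>x j\<bar> + \<bar>x j\<bar>)"
        using IH \<eta> by (intro mult_left_mono) auto
      moreover have "\<bar>x (j - 1)\<bar> \<le> \<bar>x (j - 1) + x (j + 1) - c j * x j\<bar> + \<bar>c j * x j\<bar> + \<bar>x (j + 1)\<bar>"
        using abs_triangle_ineq4[of "x (j - 1) + x (j + 1) - c j * x j" "x (j + 1) - c j * x j"]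
          abs_triangle_ineq4[of "x (j + 1)" "c j * x j"] by simp
      moreover have "\<bar>x (j - 1) + x (j + 1) - c j * x j\<bar> \<le> \<eta> * (\<bar>x (j - 1)\<bar> + \<bar>x j\<bar> + \<bar>x (j + 1)\<bar>)"
        using rec[of j] j False by simp
      ultimately show ?thesis using cp IH by linarith
    qed
    also have "\<dots> \<le> C * \<bar>x j\<bar> + \<bar>x j\<bar> + 1/2 * (\<bar>x (j - 1)\<bar> + \<bar>x j\<bar> + \<bar>x j\<bar>)"
      using \<eta> by (intro add_left_mono mult_right_mono) auto
    finally show ?thesis by (simp add: algebra_simps)
  qed
  \<comment> \<open>By \<open>upper\<close>, a zero would propagate backwards to
    \<open>x j0\<close>.\<close>
  have nz: "x j \<noteq> 0" if "j0 \<le> j" "j \<le> m" for j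
    using that
  proof (induction j rule: dec_induct)
    case (step j)
    then show ?case using upper[of "Suc j"] by auto
  qed (rule x0)
  show "x m \<noteq> 0" using nz[of m] j0 by simp
  define r where "r j = x (j - 1) / x j" for j
  \<comment> \<open>\<open>K\<close> bounds the error at the free end, where
    \<open>\<bar>r m\<bar>\<close> is at most \<open>2 * C + 4\<close> and \<open>R m\<close> at
    most \<open>C\<close>. The constant \<open>h\<close> below is the fixed point of the error
    recursion that sends t to \<open>\<eta> * (2 * C + 6) + \<theta> * t\<close>.\<close>
  define K where "K = 3 * C + 4"
  define \<theta> where "\<theta> = 1 / \<rho>"
  define h where "h = \<eta> * (2 * C + 6) / (1 - \<theta>)"
  have \<theta>: "0 < \<theta>" "\<theta> < 1" using R(3) by (auto simp: \<theta>_def)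
  have r: "1 \<le> \<bar>r j\<bar>" "\<bar>r j\<bar> \<le> 2 * C + 4" if "j0 < j" "j \<le> m" for j
    using mono[OF that] upper[OF that] nz[of j] that
    by (auto simp: r_def abs_divide divide_simps)
  have Rb: "1 < R j" "R j \<le> C" for j
  proof -
    have "0 \<le> 1 / R (Suc j)" using R(2)[of "Suc j"] R(3) by simp
    then show "1 < R j" "R j \<le> C" using R(2)[of j] R(3) R(1)[of j] c(2)[of j] by linarith+
  qed
  have est: "\<bar>r j - R j\<bar> \<le> h + \<theta> ^ (m - j) * K" if "j0 < j" "j \<le> m" for j
    using that(2,1)
  proof (induction rule: inc_induct)
    case base
    have "\<bar>r m - R m\<bar> \<le> K" using r[of m] Rb[of m] base abs_triangle_ineq4[of "r m" "R m"] by (simp add: K_def)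
    moreover have "0 \<le> h" using \<eta> C \<theta> by (simp add: h_def)
    ultimately show ?case by simp
  next
    case (step j)
    then have j: "j0 < j" "j < m" "j0 < Suc j" "Suc j \<le> m" by auto
    have x: "x j \<noteq> 0" "x (Suc j) \<noteq> 0" using nz[of j] nz[of "Suc j"] j by auto
    have "\<bar>r j + 1 / r (Suc j) - c j\<bar> = \<bar>x (j - 1) + x (j + 1) - c j * x j\<bar> / \<bar>x j\<bar>"
    proof -
      have "r j + 1 / r (Suc j) - c j = (x (j - 1) + x (j + 1) - c j * x j) / x j"
        using x by (simp add: r_def field_simps)
      then show ?thesis by (simp add: abs_divide)
    qed
    also have "\<dots> \<le> \<eta> * (\<bar>x (j - 1)\<bar> + \<bar>x j\<bar> + \<bar>x (j + 1)\<bar>) / \<bar>x j\<bar>"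
      by (intro divide_right_mono rec j) auto
    also have "\<dots> \<le> \<eta> * ((2 * C + 4) * \<bar>x j\<bar> + \<bar>x j\<bar> + \<bar>x j\<bar>) / \<bar>x j\<bar>"
      using upper[of j] mono[of "Suc j"] j \<eta> by (intro divide_right_mono mult_left_mono add_mono) auto
    also have "\<dots> = \<eta> * (2 * C + 6)" using x by (simp add: field_simps)
    finally have 1: "\<bar>r j + 1 / r (Suc j) - c j\<bar> \<le> \<eta> * (2 * C + 6)" .
    have rr: "1 \<le> \<bar>r (Suc j)\<bar>" "\<rho> \<le> R (Suc j)" using r j R(2) by auto
    have "1 / R (Suc j) - 1 / r (Suc j) = (r (Suc j) - R (Suc j)) / (r (Suc j) * R (Suc j))"
      using rr R(3) by (auto simp: field_simps)
    then have "\<bar>1 / R (Suc j) - 1 / r (Suc j)\<bar> = \<bar>r (Suc j) - R (Suc j)\<bar> / (\<bar>r (Suc j)\<bar> * R (Suc j))"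
      using rr R(3) by (simp add: abs_divide abs_mult)
    also have "\<dots> \<le> \<bar>r (Suc j) - R (Suc j)\<bar> / (1 * \<rho>)"
      using rr R(3) by (intro divide_left_mono mult_mono) auto
    also have "\<dots> \<le> \<theta> * (h + \<theta> ^ (m - Suc j) * K)"
      using mult_left_mono[OF step.IH[OF j(3)], of \<theta>] \<theta> by (simp add: \<theta>_def)
    also have "\<dots> = \<theta> * h + \<theta> ^ (m - j) * K"
      using j by (simp add: algebra_simps Suc_diff_Suc flip: power_Suc)
    finally have 2: "\<bar>1 / R (Suc j) - 1 / r (Suc j)\<bar> \<le> \<theta> * h + \<theta> ^ (m - j) * K" .
    have "r j - R j = (r j + 1 / r (Suc j) - c j) + (1 / R (Suc j) - 1 / r (Suc j))"
      using R(1)[of j] by simp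
    then have "\<bar>r j - R j\<bar> \<le> \<eta> * (2 * C + 6) + (\<theta> * h + \<theta> ^ (m - j) * K)"
      using abs_triangle_ineq[of "r j + 1 / r (Suc j) - c j" "1 / R (Suc j) - 1 / r (Suc j)"] 1 2 by linarith
    also have "\<eta> * (2 * C + 6) = (1 - \<theta>) * h" using \<theta> by (simp add: h_def)
    finally show ?case by (simp add: algebra_simps)
  qed
  have lnest: "\<bar>ln \<bar>r j\<bar> - ln (R j)\<bar> \<le> h + \<theta> ^ (m - j) * K" if "j0 < j" "j \<le> m" for j
  proof -
    have aux: "\<bar>ln a - ln b\<bar> \<le> \<bar>a - b\<bar>" if "1 \<le> a" "1 \<le> b" for a b :: real
    proof -
      have "ln a - ln b \<le> (a - b) / b" "ln b - ln a \<le> (b - a) / a"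
        using that by (intro ln_diff_le; simp)+
      moreover have "(a - b) / b \<le> \<bar>a - b\<bar>" "(b - a) / a \<le> \<bar>a - b\<bar>"
      proof -
        have "\<bar>a - b\<bar> * 1 \<le> \<bar>a - b\<bar> * b" "\<bar>a - b\<bar> * 1 \<le> \<bar>a - b\<bar> * a"
          using that by (intro mult_left_mono; simp)+
        moreover have "a - b \<le> \<bar>a - b\<bar>" "b - a \<le> \<bar>a - b\<bar>" by auto
        ultimately have "a - b \<le> \<bar>a - b\<bar> * b" "b - a \<le> \<bar>a - b\<bar> * a" by simp_all
        then show "(a - b) / b \<le> \<bar>a - b\<bar>" "(b - a) / a \<le> \<bar>a - b\<bar>"
          using that by (simp_all add: pos_divide_le_eq)
      qed
      ultimately show ?thesis by linarith
    qed
    have "\<bar>ln \<bar>r j\<bar> - ln (R j)\<bar> \<le> \<bar>\<bar>r j\<bar> - \<bar>R j\<bar>\<bar>"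
      using aux[of "\<bar>r j\<bar>" "R j"] r[OF that] Rb[of j] by simp
    also have "\<dots> \<le> \<bar>r j - R j\<bar>" by (rule abs_triangle_ineq3)
    also have "\<dots> \<le> h + \<theta> ^ (m - j) * K" by (rule est[OF that])
    finally show ?thesis .
  qed
  have tele: "ln \<bar>x j0\<bar> - ln \<bar>x n\<bar> = (\<Sum>j\<in>{j0<..n}. ln \<bar>r j\<bar>)" if "j0 \<le> n" "n \<le> m" for n
    using that
  proof (induction n rule: dec_induct)
    case (step n)
    have "{j0<..Suc n} = insert (Suc n) {j0<..n}" using step by auto
    moreover have "ln \<bar>r (Suc n)\<bar> = ln \<bar>x n\<bar> - ln \<bar>x (Suc n)\<bar>"
      using nz[of n] nz[of "Suc n"] step by (simp add: r_def abs_divide ln_div)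
    ultimately show ?case using step by simp
  qed simp
  have "\<bar>ln \<bar>x j0\<bar> - ln \<bar>x m\<bar> - (\<Sum>j\<in>{j0<..m}. ln (R j))\<bar> = \<bar>\<Sum>j\<in>{j0<..m}. ln \<bar>r j\<bar> - ln (R j)\<bar>"
    using tele[of m] j0 by (simp add: sum_subtractf)
  also have "\<dots> \<le> (\<Sum>j\<in>{j0<..m}. h + \<theta> ^ (m - j) * K)"
    using lnest by (intro order_trans[OF sum_abs] sum_mono) auto
  \<comment> \<open>The sum is extended down to index 0 to become geometric; subtracting the extra
    \<open>h\<close> keeps the factor \<open>m\<close> instead of \<open>m + 1\<close>.\<close>
  also have "\<dots> \<le> (\<Sum>j\<in>{..m}. h + \<theta> ^ (m - j) * K) - h"
  proof -
    have "0 \<le> h" using \<eta> C \<theta> by (simp add: h_def)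
    moreover have "0 \<le> \<theta> ^ k * K" for k using \<theta> C by (simp add: K_def)
    moreover have "{..m} = insert 0 {0<..m}" by auto
    moreover have "(\<Sum>j\<in>{j0<..m}. h + \<theta> ^ (m - j) * K) \<le> (\<Sum>j\<in>{0<..m}. h + \<theta> ^ (m - j) * K)"
      using calculation(1,2) by (intro sum_mono2) (auto intro: add_nonneg_nonneg)
    moreover have "(\<Sum>j\<in>insert 0 {0<..m}. h + \<theta> ^ (m - j) * K) =
        h + \<theta> ^ m * K + (\<Sum>j\<in>{0<..m}. h + \<theta> ^ (m - j) * K)" by simp
    ultimately have "(\<Sum>j\<in>{..m}. h + \<theta> ^ (m - j) * K) =
        h + \<theta> ^ m * K + (\<Sum>j\<in>{0<..m}. h + \<theta> ^ (m - j) * K)"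
      "(\<Sum>j\<in>{j0<..m}. h + \<theta> ^ (m - j) * K) \<le> (\<Sum>j\<in>{0<..m}. h + \<theta> ^ (m - j) * K)"
      by simp_all
    moreover have "0 \<le> \<theta> ^ m * K" using \<theta> C by (simp add: K_def)
    ultimately show ?thesis by linarith
  qed
  also have "\<dots> = real m * h + (\<Sum>j\<in>{..m}. \<theta> ^ (m - j)) * K"
    unfolding sum.distrib sum_distrib_right by (simp add: algebra_simps)
  also have "(\<Sum>j\<in>{..m}. \<theta> ^ (m - j)) = (\<Sum>j\<in>{..m}. \<theta> ^ j)"
    by (rule sum.nat_diff_reindex[where n = "Suc m", simplified lessThan_Suc_atMost diff_Suc_Suc])
  also have "\<dots> * K \<le> 1 / (1 - \<theta>) * K"
  proof (rule mult_right_mono)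
    have "(\<Sum>j\<in>{..m}. \<theta> ^ j) = (1 - \<theta> ^ Suc m) / (1 - \<theta>)"
      using \<theta> sum_gp0[of \<theta> m] by simp
    also have "\<dots> \<le> 1 / (1 - \<theta>)" using \<theta> by (intro divide_right_mono) auto
    finally show "(\<Sum>j\<in>{..m}. \<theta> ^ j) \<le> 1 / (1 - \<theta>)" .
  qed (use C in \<open>simp add: K_def\<close>)
  finally show "\<bar>ln \<bar>x j0\<bar> - ln \<bar>x m\<bar> - (\<Sum>j\<in>{j0<..m}. ln (R j))\<bar>
      \<le> real m * (\<eta> * (2 * C + 6) / (1 - 1 / \<rho>)) + (3 * C + 4) / (1 - 1 / \<rho>)"
    by (simp add: h_def K_def \<theta>_def)
qed

text \<open>Two consecutive terms contribute \<open>ln (RE * RO)\<close>; parity and the missing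
  first \<open>j0\<close> terms cost an amount independent of \<open>m\<close>.\<close>

lemma sum_alternating_ln:
  fixes RE RO :: real
  assumes "RE > 1" "RO > 1" "j0 \<le> m"
  shows "\<bar>(\<Sum>j\<in>{j0<..m}. ln (if even j then RE else RO)) - real m / 2 * ln (RE * RO)\<bar>
    \<le> real (j0 + 2) * ln (RE * RO)"
proof -
  define l where "l = ln (RE * RO)"
  have l: "l = ln RE + ln RO" "ln RE > 0" "ln RO > 0"
    using assms by (auto simp: l_def ln_mult)
  define L where "L n = (\<Sum>j\<in>{0<..n}. ln (if even j then RE else RO))" for n :: nat
  have L: "L n = real (n div 2) * l + (if odd n then ln RO else 0)" for n
  proof (induction n)
    case (Suc n)
    have "{0<..Suc n} = insert (Suc n) {0<..n}" by auto
    then have "L (Suc n) = L n + ln (if even (Suc n) then RE else RO)" by (simp add: L_def)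
    also have "\<dots> = real (Suc n div 2) * l + (if odd (Suc n) then ln RO else 0)"
      unfolding Suc by (cases "even n") (auto simp: l(1) algebra_simps elim!: oddE evenE)
    finally show ?case .
  qed (simp add: L_def)
  have near: "\<bar>L n - real n / 2 * l\<bar> \<le> l" for n
  proof (cases "even n")
    case True
    then obtain b where "n = 2 * b" by (rule evenE)
    then have "L n - real n / 2 * l = 0" using L[of n] by simp
    then show ?thesis using l by simp
  next
    case False
    then obtain b where "n = 2 * b + 1" by (rule oddE)
    then have "L n = real b * l + ln RO" "real n / 2 * l = real b * l + l / 2"
      using L[of n] by (simp_all add: distrib_right add_divide_distrib)
    then have "L n - real n / 2 * l = ln RO - l / 2" by linarith
    moreover have "\<bar>ln RO - l / 2\<bar> \<le> l" using l by linarith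
    ultimately show ?thesis by presburger
  qed
  have "{0<..m} = {0<..j0} \<union> {j0<..m}" "{0<..j0} \<inter> {j0<..m} = {}" using assms(3) by auto
  then have "(\<Sum>j\<in>{j0<..m}. ln (if even j then RE else RO)) = L m - L j0"
    unfolding L_def by (simp add: sum.union_disjoint)
  moreover have "\<bar>L m - L j0 - real m / 2 * l\<bar> \<le> real (j0 + 2) * l"
  proof -
    have "\<bar>L m - L j0 - real m / 2 * l\<bar> \<le> l + \<bar>L j0\<bar>"
      using near[of m] abs_triangle_ineq4[of "L m - real m / 2 * l" "L j0"] by (simp add: algebra_simps)
    moreover have "\<bar>L j0\<bar> \<le> l + real j0 / 2 * l"
      using near[of j0] abs_triangle_ineq[of "L j0 - real j0 / 2 * l" "real j0 / 2 * l"] l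
      by (simp add: abs_mult)
    moreover have "0 \<le> real j0 * l" using l by simp
    ultimately show ?thesis by (simp add: algebra_simps)
  qed
  ultimately show ?thesis by (simp add: l_def)
qed

text \<open>For fixed \<eta> the backward estimate starts at an index \<open>j0\<close> independent
  of \<open>m\<close>, where the solution is bounded above and away from 0. It gives the rate up to
  a multiple of \<eta> and a bounded term, and \<eta> is arbitrary.\<close>

lemma alternating_recursion_decay_rate:
  fixes s :: "nat \<Rightarrow> nat \<Rightarrow> real" and cE cO RE RO D :: real
  defines "c \<equiv> \<lambda>j. if even j then cE else cO"
  assumes c2: "cE > 2" "cO > 2" and R1: "RE > 1" "RO > 1"
    and R: "RE = cE - 1 / RO" "RO = cO - 1 / RE"
    and rec: "\<And>\<eta>. \<eta> > 0 \<Longrightarrow> \<exists>j0. \<forall>m j. j0 < j \<and> j < m \<longrightarrow>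
      \<bar>s m (j - 1) + s m (j + 1) - c j * s m j\<bar> \<le> \<eta> * (\<bar>s m (j - 1)\<bar> + \<bar>s m j\<bar> + \<bar>s m (j + 1)\<bar>)"
    and last: "\<And>\<eta>. \<eta> > 0 \<Longrightarrow> \<exists>j0. \<forall>m>j0.
      \<bar>s m (m - 1) - c m / 2 * s m m\<bar> \<le> \<eta> * (\<bar>s m (m - 1)\<bar> + \<bar>s m m\<bar>)"
    and lower: "\<And>j0. \<exists>\<delta>>0. \<forall>\<^sub>F m in sequentially. \<delta> \<le> \<bar>s m j0\<bar>"
    and upper: "\<And>m j. \<bar>s m j\<bar> \<le> D"
  shows "\<forall>\<^sub>F m in sequentially. s m m \<noteq> 0"
    and "(\<lambda>m. ln \<bar>s m m\<bar> / real m) \<longlonglongrightarrow> - ln (RE * RO) / 2"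
proof -
  define Rf where "Rf j = (if even j then RE else RO)" for j :: nat
  define \<rho> where "\<rho> = min RE RO"
  define C where "C = max cE cO"
  have \<rho>: "\<rho> > 1" using R1 by (simp add: \<rho>_def)
  \<comment> \<open>\<open>K\<close> depends on \<eta> through \<open>j0\<close> and the lower bound
    at \<open>j0\<close>; it disappears on division by \<open>m\<close>, before \<eta> is made
    small.\<close>
  have key: "\<exists>K. \<forall>\<^sub>F m in sequentially. s m m \<noteq> 0 \<and>
      \<bar>ln \<bar>s m m\<bar> + real m / 2 * ln (RE * RO)\<bar> \<le> real m * (\<eta> * (2 * C + 6) / (1 - 1 / \<rho>)) + K"
    if \<eta>: "0 < \<eta>" "\<eta> \<le> 1/2" "2 + 4 * \<eta> \<le> cE" "2 + 4 * \<eta> \<le> cO" for \<eta>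
  proof -
    obtain j1 where j1: "\<And>m j. j1 < j \<Longrightarrow> j < m \<Longrightarrow>
      \<bar>s m (j - 1) + s m (j + 1) - c j * s m j\<bar> \<le> \<eta> * (\<bar>s m (j - 1)\<bar> + \<bar>s m j\<bar> + \<bar>s m (j + 1)\<bar>)"
      using rec[OF \<eta>(1)] by blast
    obtain j2 where j2: "\<And>m. j2 < m \<Longrightarrow>
      \<bar>s m (m - 1) - c m / 2 * s m m\<bar> \<le> \<eta> * (\<bar>s m (m - 1)\<bar> + \<bar>s m m\<bar>)"
      using last[OF \<eta>(1)] by blast
    define j0 where "j0 = max j1 j2"
    obtain \<delta> where \<delta>: "\<delta> > 0" "\<forall>\<^sub>F m in sequentially. \<delta> \<le> \<bar>s m j0\<bar>" using lower by blast
    define K where "K = (3 * C + 4) / (1 - 1 / \<rho>) + real (j0 + 2) * ln (RE * RO) + (\<bar>ln \<delta>\<bar> + \<bar>ln D\<bar>)"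
    have "\<forall>\<^sub>F m in sequentially. s m m \<noteq> 0 \<and>
      \<bar>ln \<bar>s m m\<bar> + real m / 2 * ln (RE * RO)\<bar> \<le> real m * (\<eta> * (2 * C + 6) / (1 - 1 / \<rho>)) + K"
      using \<delta>(2) eventually_gt_at_top[of j0]
    proof eventually_elim
      case (elim m)
      have c: "2 + 4 * \<eta> \<le> c j" "c j \<le> C" "Rf j = c j - 1 / Rf (Suc j)" "\<rho> \<le> Rf j" for j
        using \<eta> R by (auto simp: c_def C_def Rf_def \<rho>_def)
      have x0: "s m j0 \<noteq> 0" using elim \<delta>(1) by auto
      note B = backward_recursion_ratios[of \<eta> c C Rf \<rho> j0 m "s m", OF _ \<eta>(2) c \<rho> _ _ elim(2) x0]
      have 1: "s m m \<noteq> 0"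
        by (rule B(1)) (use \<eta> elim j1 j2 in \<open>auto simp: j0_def\<close>)
      have 2: "\<bar>ln \<bar>s m j0\<bar> - ln \<bar>s m m\<bar> - (\<Sum>j\<in>{j0<..m}. ln (Rf j))\<bar>
        \<le> real m * (\<eta> * (2 * C + 6) / (1 - 1 / \<rho>)) + (3 * C + 4) / (1 - 1 / \<rho>)"
        by (rule B(2)) (use \<eta> elim j1 j2 in \<open>auto simp: j0_def\<close>)
      have 3: "\<bar>(\<Sum>j\<in>{j0<..m}. ln (Rf j)) - real m / 2 * ln (RE * RO)\<bar> \<le> real (j0 + 2) * ln (RE * RO)"
        unfolding Rf_def using elim by (intro sum_alternating_ln R1) auto
      have "ln \<delta> \<le> ln \<bar>s m j0\<bar>" "ln \<bar>s m j0\<bar> \<le> ln D"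
        using elim \<delta>(1) upper[of m j0] x0 by (subst ln_le_cancel_iff; simp)+
      then have 4: "\<bar>ln \<bar>s m j0\<bar>\<bar> \<le> \<bar>ln \<delta>\<bar> + \<bar>ln D\<bar>" by linarith
      have comb: "\<bar>b + t\<bar> \<le> X + (x + Y + Z)"
        if "\<bar>a - b - S\<bar> \<le> X + x" "\<bar>S - t\<bar> \<le> Y" "\<bar>a\<bar> \<le> Z" for a b S t X x Y Z :: real
        using that by linarith
      show ?case using 1 comb[OF 2 3 4] unfolding K_def by blast
    qed
    then show ?thesis by blast
  qed
  define \<eta>0 where "\<eta>0 = min (1/2) (min ((cE - 2) / 4) ((cO - 2) / 4))"
  have \<eta>0: "0 < \<eta>0" "\<eta>0 \<le> 1/2" "2 + 4 * \<eta>0 \<le> cE" "2 + 4 * \<eta>0 \<le> cO"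
    using c2 by (auto simp: \<eta>0_def min_def field_simps)
  from key[OF \<eta>0] show "\<forall>\<^sub>F m in sequentially. s m m \<noteq> 0"
    by (auto elim: eventually_mono)
  show "(\<lambda>m. ln \<bar>s m m\<bar> / real m) \<longlonglongrightarrow> - ln (RE * RO) / 2"
  proof (rule tendstoI)
    fix e :: real assume "e > 0"
    define W where "W = (2 * C + 6) / (1 - 1 / \<rho>)"
    have "1 - 1 / \<rho> > 0" using \<rho> by simp
    moreover have "2 * C + 6 > 0" using c2 by (simp add: C_def)
    ultimately have W: "W > 0" by (simp add: W_def)
    define \<eta> where "\<eta> = min \<eta>0 (e / (2 * W))"
    have \<eta>: "0 < \<eta>" "\<eta> \<le> 1/2" "2 + 4 * \<eta> \<le> cE" "2 + 4 * \<eta> \<le> cO"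
      using \<eta>0 W \<open>e > 0\<close> by (auto simp: \<eta>_def)
    have \<eta>W: "\<eta> * W \<le> e / 2"
    proof -
      have "\<eta> * W \<le> e / (2 * W) * W" using W by (intro mult_right_mono) (auto simp: \<eta>_def)
      then show ?thesis using W by simp
    qed
    obtain K where K: "\<forall>\<^sub>F m in sequentially. s m m \<noteq> 0 \<and>
      \<bar>ln \<bar>s m m\<bar> + real m / 2 * ln (RE * RO)\<bar> \<le> real m * (\<eta> * (2 * C + 6) / (1 - 1 / \<rho>)) + K"
      using key[OF \<eta>] by blast
    have "(\<lambda>m. K / real m) \<longlonglongrightarrow> 0" by (rule lim_const_over_n)
    then have "\<forall>\<^sub>F m in sequentially. K / real m < e / 2"
      by (rule order_tendstoD(2)) (use \<open>e > 0\<close> in simp)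
    then show "\<forall>\<^sub>F m in sequentially. dist (ln \<bar>s m m\<bar> / real m) (- ln (RE * RO) / 2) < e"
      using K eventually_gt_at_top[of 0]
    proof eventually_elim
      case (elim m)
      have "dist (ln \<bar>s m m\<bar> / real m) (- ln (RE * RO) / 2) =
          \<bar>(ln \<bar>s m m\<bar> + real m / 2 * ln (RE * RO)) / real m\<bar>"
        using elim(3) by (simp add: dist_real_def field_simps)
      also have "\<dots> = \<bar>ln \<bar>s m m\<bar> + real m / 2 * ln (RE * RO)\<bar> / real m"
        using elim(3) by (simp add: abs_divide)
      also have "\<dots> \<le> (real m * (\<eta> * W) + K) / real m"
        using elim(2,3) by (intro divide_right_mono) (auto simp: W_def)
      also have "\<dots> = \<eta> * W + K / real m" using elim(3) by (simp add: field_simps)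
      also have "\<dots> < e" using elim(1) \<eta>W by linarith
      finally show ?case .
    qed
  qed
qed

subsection \<open>Shortest chains near a period two orbit\<close>

lemma arc_distance_critical:
  assumes arc: "arc_param K T \<gamma> \<gamma>1 \<gamma>2" and p: "\<gamma> t \<noteq> p"
  shows "((\<lambda>s. dist p (\<gamma> s)) has_real_derivative sgn (\<gamma> t - p) \<bullet> \<gamma>1 t) (at t)"
proof -
  have "((\<lambda>s. \<gamma> s - p) has_derivative (\<lambda>h. h *\<^sub>R \<gamma>1 t)) (at t)"
    using arc_param_deriv(1)[OF arc, of t] unfolding has_vector_derivative_def
    by (auto intro!: derivative_eq_intros)
  then have "((\<lambda>s. norm (\<gamma> s - p)) has_derivative (\<lambda>h. (h *\<^sub>R \<gamma>1 t) \<bullet> sgn (\<gamma> t - p))) (at t)"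
    by (rule has_derivative_norm_compose) (use p in simp)
  moreover have "(\<lambda>h. (h *\<^sub>R \<gamma>1 t) \<bullet> sgn (\<gamma> t - p)) = (*) (sgn (\<gamma> t - p) \<bullet> \<gamma>1 t)"
    by (auto simp: inner_commute)
  ultimately show ?thesis
    unfolding has_field_derivative_def by (simp add: dist_norm norm_minus_commute)
qed

lemma arc_sum_dist_critical:
  assumes arc: "arc_param K T \<gamma> \<gamma>1 \<gamma>2" and ne: "\<gamma> t \<noteq> p" "\<gamma> t \<noteq> q"
    and min: "\<And>w. w \<in> closure K \<Longrightarrow> dist p (\<gamma> t) + dist (\<gamma> t) q \<le> dist p w + dist w q"
  shows "sgn (\<gamma> t - p) \<bullet> \<gamma>1 t + sgn (\<gamma> t - q) \<bullet> \<gamma>1 t = 0"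
proof (rule DERIV_local_min)
  show "((\<lambda>s. dist p (\<gamma> s) + dist q (\<gamma> s)) has_real_derivative
      sgn (\<gamma> t - p) \<bullet> \<gamma>1 t + sgn (\<gamma> t - q) \<bullet> \<gamma>1 t) (at t)"
    by (intro DERIV_add arc_distance_critical[OF arc] ne)
  show "\<forall>y. \<bar>t - y\<bar> < 1 \<longrightarrow> dist p (\<gamma> t) + dist q (\<gamma> t) \<le> dist p (\<gamma> y) + dist q (\<gamma> y)"
  proof (intro allI impI)
    fix y
    have "\<gamma> y \<in> closure K" using arc_param_in_frontier[OF arc] by (auto simp: frontier_def)
    from min[OF this] show "dist p (\<gamma> t) + dist q (\<gamma> t) \<le> dist p (\<gamma> y) + dist q (\<gamma> y)"
      by (simp add: dist_commute[of q])
  qed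
qed simp

lemma arc_dist_critical:
  assumes arc: "arc_param K T \<gamma> \<gamma>1 \<gamma>2" and ne: "\<gamma> t \<noteq> p"
    and min: "\<And>w. w \<in> closure K \<Longrightarrow> dist p (\<gamma> t) \<le> dist p w"
  shows "sgn (\<gamma> t - p) \<bullet> \<gamma>1 t = 0"
proof -
  have "dist p (\<gamma> t) + dist (\<gamma> t) p \<le> dist p w + dist w p" if "w \<in> closure K" for w
    using min[OF that] by (simp add: dist_commute)
  from arc_sum_dist_critical[OF arc ne ne this] show ?thesis by simp
qed

section \<open>Links between two facing obstacles\<close>

context facing_pair
begin

lemma pair_norm: "norm e = 1" "e \<bullet> e = 1"
  using unit_normal_props(1)[OF billiard_obstacle[OF tab] A] nA by (auto simp: dot_square_norm)

text \<open>The component of a link along \<open>e\<close> is \<open>d\<close> plus the depths of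
  its ends below the supporting lines at \<open>A\<close> and \<open>B\<close>. In the case of
  equality both depths vanish, and strict convexity identifies the ends.\<close>

lemma pair_separation:
  assumes "x \<in> closure (\<O> i)" "y \<in> closure (\<O> j)"
  shows "d \<le> dist x y" "dist x y \<le> d \<Longrightarrow> x = A \<and> y = B"
    "d + (A - x) \<bullet> e \<le> dist x y"
proof -
  have ob: "obstacle (\<O> l)" for l by (rule billiard_obstacle[OF tab])
  have le: "(x - A) \<bullet> e \<le> 0" "(y - B) \<bullet> (- e) \<le> 0"
    using unit_normal_props(2)[OF ob A assms(1)] unit_normal_props(2)[OF ob B assms(2)] nA nB by auto
  have "(y - x) \<bullet> e \<le> dist x y"
    using inner_le_norm_unit[OF pair_norm(1), of "y - x"] by (simp add: dist_norm norm_minus_commute)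
  moreover have "(y - x) \<bullet> e = d + (y - B) \<bullet> e + (A - x) \<bullet> e"
    using pair_norm(2) by (simp add: BA inner_diff_left inner_add_left)
  ultimately have main: "d + (y - B) \<bullet> e + (A - x) \<bullet> e \<le> dist x y" by simp
  then show "d \<le> dist x y" "d + (A - x) \<bullet> e \<le> dist x y" using le by (auto simp: inner_diff_left)
  assume "dist x y \<le> d"
  then have z: "(x - A) \<bullet> e = 0" "(y - B) \<bullet> (- e) = 0" using main le by (auto simp: inner_diff_left)
  show "x = A \<and> y = B"
    using unit_normal_strict[OF ob A assms(1)] unit_normal_strict[OF ob B assms(2)] z nA nB by force
qed

text \<open>Pairs of points not close to \<open>(A, B)\<close> form a compact set; there the
  distance attains its minimum, which exceeds \<open>d\<close>.\<close>

lemma pair_stability: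
  assumes "\<epsilon> > 0"
  obtains \<eta> where "\<eta> > 0"
    "\<And>x y. x \<in> closure (\<O> i) \<Longrightarrow> y \<in> closure (\<O> j) \<Longrightarrow> dist x y < d + \<eta> \<Longrightarrow> dist x A < \<epsilon> \<and> dist y B < \<epsilon>"
proof -
  have ob: "obstacle (\<O> l)" for l by (rule billiard_obstacle[OF tab])
  define S where "S = (closure (\<O> i) \<times> closure (\<O> j)) \<inter> ({p. \<epsilon> \<le> dist (fst p) A} \<union> {p. \<epsilon> \<le> dist (snd p) B})"
  have "compact S"
    unfolding S_def
    by (intro compact_Int_closed compact_Times obstacle_compact ob closed_Un closed_Collect_le continuous_intros)
  show ?thesis
  proof (cases "S = {}")
    case True
    show ?thesis by (rule that[of 1]) (use True in \<open>auto simp: S_def not_le\<close>)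
  next
    case False
    have "continuous_on S (\<lambda>p. dist (fst p) (snd p))" by (intro continuous_intros)
    then obtain q where q: "q \<in> S" "\<And>p. p \<in> S \<Longrightarrow> dist (fst q) (snd q) \<le> dist (fst p) (snd p)"
      using continuous_attains_inf[OF \<open>compact S\<close> False] by blast
    have gt: "dist (fst q) (snd q) > d"
      using pair_separation(2)[of "fst q" "snd q"] q(1) assms by (force simp: S_def)
    show ?thesis
    proof (rule that[of "dist (fst q) (snd q) - d"])
      show "dist (fst q) (snd q) - d > 0" using gt by simp
      fix x y assume *: "x \<in> closure (\<O> i)" "y \<in> closure (\<O> j)" "dist x y < d + (dist (fst q) (snd q) - d)"
      then have "(x, y) \<notin> S" using q(2)[of "(x, y)"] by auto
      then show "dist x A < \<epsilon> \<and> dist y B < \<epsilon>" using * by (auto simp: S_def)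
    qed
  qed
qed

text \<open>The outgoing direction at \<open>A\<close> is the normal itself. Reflection fixes the
  incoming direction to \<open>- e\<close>, so the previous vertex lies on the common
  normal.\<close>

lemma pair_reflect_back:
  assumes k: "k \<noteq> i" and x: "x \<in> closure (\<O> k)"
    and min: "\<And>w. w \<in> closure (\<O> i) \<Longrightarrow> dist x A + dist A B \<le> dist x w + dist w B"
  obtains r where "r > 0" "x = A + r *\<^sub>R e"
proof -
  have ob: "obstacle (\<O> l)" for l by (rule billiard_obstacle[OF tab])
  have cl: "A \<in> closure (\<O> i)" "B \<in> closure (\<O> j)" using A B by (auto simp: frontier_def)
  have seg: "z \<notin> closure (\<O> i)" if "z \<in> closed_segment x B" for z
    using billiard_segment_avoids[OF tab k[symmetric] ij x cl(2) that] .
  define v where "v = sgn (A - x)"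
  have sB: "sgn (B - A) = e" using d pair_norm(1) by (simp add: BA sgn_scaleR) (simp add: sgn_div_norm)
  have "e = v - (2 * (v \<bullet> e)) *\<^sub>R e"
    using reflection_of_minimum(4)[OF ob cl(1) seg min] sB by (simp add: nA v_def)
  then have v: "v = (1 + 2 * (v \<bullet> e)) *\<^sub>R e" by (metis add.commute diff_eq_eq scaleR_add_left scaleR_one)
  have "v \<bullet> e = (1 + 2 * (v \<bullet> e)) * (e \<bullet> e)" by (subst v) simp
  then have "v \<bullet> e = -1" using pair_norm(2) by simp
  with v have ve: "v = - e" by simp
  show ?thesis
  proof (rule that)
    have "A \<noteq> x" using billiard_closures_disjoint[OF tab k] x cl(1) by auto
    then show "norm (A - x) > 0" by simp
    have "A - x = norm (A - x) *\<^sub>R v" unfolding v_def by (rule norm_scaleR_sgn[symmetric])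
    then have "A - x = - (norm (A - x) *\<^sub>R e)" unfolding ve by simp
    then show "x = A + norm (A - x) *\<^sub>R e" by (metis add_diff_cancel_left' diff_add_cancel diff_minus_eq_add)
  qed
qed

text \<open>Up to \<open>B\<close> the ray runs between two obstacles and misses the third; a hit
  behind \<open>B\<close> would put \<open>B\<close> on a segment between the two other obstacles.
  Non-eclipse excludes both.\<close>

lemma pair_ray_avoids_third:
  assumes "k \<noteq> i" "k \<noteq> j" "r > 0"
  shows "A + r *\<^sub>R e \<notin> closure (\<O> k)"
proof
  assume p: "A + r *\<^sub>R e \<in> closure (\<O> k)"
  have cl: "A \<in> closure (\<O> i)" "B \<in> closure (\<O> j)" using A B by (auto simp: frontier_def)
  consider "r < d" | "r = d" | "d < r" by linarith
  then show False
  proof cases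
    case 1
    then have "A + r *\<^sub>R e \<in> closed_segment A B"
      using assms(3) by (intro aligned_in_closed_segment[of r "d - r" _ _ e]) (auto simp: BA algebra_simps)
    then show False using billiard_segment_avoids[OF tab assms(1,2) cl] p by blast
  next
    case 2
    then show False using p cl(2) billiard_closures_disjoint[OF tab assms(2)] by (auto simp: BA)
  next
    case 3
    then have "B \<in> closed_segment A (A + r *\<^sub>R e)"
      using d by (intro aligned_in_closed_segment[of d "r - d" _ _ e]) (auto simp: BA algebra_simps)
    then show False
      using billiard_segment_avoids[OF tab ij[symmetric] assms(2)[symmetric] cl(1) p] cl(2) by blast
  qed
qed

text \<open>The ray may leave the obstacle again behind \<open>B\<close>. Reflection towards
  \<open>A\<close> shows that the normal at the hit faces \<open>A\<close>; then the supporting line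
  there forces \<open>r \<le> d\<close>, while \<open>d\<close> is the least distance.\<close>

lemma pair_ray_first_hit:
  assumes x: "A + r *\<^sub>R e \<in> closure (\<O> j)" and r: "r > 0" and l: "l \<noteq> j" "w \<in> closure (\<O> l)"
    and min: "\<And>y. y \<in> closure (\<O> j) \<Longrightarrow>
      dist w (A + r *\<^sub>R e) + dist (A + r *\<^sub>R e) A \<le> dist w y + dist y A"
  shows "A + r *\<^sub>R e = B"
proof -
  have ob: "obstacle (\<O> l)" for l by (rule billiard_obstacle[OF tab])
  have cl: "A \<in> closure (\<O> i)" "B \<in> closure (\<O> j)" using A B by (auto simp: frontier_def)
  define n where "n = unit_normal (\<O> j) (A + r *\<^sub>R e)"
  have seg: "z \<notin> closure (\<O> j)" if "z \<in> closed_segment w A" for z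
    using billiard_segment_avoids[OF tab l(1)[symmetric] ij[symmetric] l(2) cl(1) that] .
  note R = reflection_of_minimum[OF ob x seg min]
  have "sgn (A - (A + r *\<^sub>R e)) = - e"
    using r pair_norm(1) by (simp add: sgn_minus sgn_scaleR) (simp add: sgn_div_norm)
  then have neg: "e \<bullet> n < 0" using R(3) by (simp add: n_def)
  have "d \<le> dist A (A + r *\<^sub>R e)" by (rule pair_separation(1)[OF cl(1) x])
  then have rd: "d \<le> r" using r pair_norm(1) by (simp add: dist_norm)
  have "(B - (A + r *\<^sub>R e)) \<bullet> n \<le> 0"
    unfolding n_def by (rule unit_normal_props(2)[OF ob R(1) cl(2)])
  moreover have "B - (A + r *\<^sub>R e) = (d - r) *\<^sub>R e" by (simp add: BA algebra_simps)
  ultimately have "(d - r) * (e \<bullet> n) \<le> 0" by simp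
  then have "d - r \<ge> 0" using neg by (simp add: mult_le_0_iff)
  with rd show ?thesis by (simp add: BA)
qed

section \<open>Estimates in arc-length coordinates near the two facing points\<close>

context
  fixes T \<gamma> \<gamma>1 \<gamma>2 a T' \<beta> \<beta>1 \<beta>2 b
  assumes arc: "arc_param (\<O> i) T \<gamma> \<gamma>1 \<gamma>2" and ga: "\<gamma> a = A"
    and arc': "arc_param (\<O> j) T' \<beta> \<beta>1 \<beta>2" and gb: "\<beta> b = B"
begin

lemma pair_tangents: "- \<i> * \<gamma>1 a = e" "- \<i> * \<beta>1 b = - e" "\<beta>1 b = - \<gamma>1 a"
proof -
  have ob: "obstacle (\<O> l)" for l by (rule billiard_obstacle[OF tab])
  show 1: "- \<i> * \<gamma>1 a = e" and 2: "- \<i> * \<beta>1 b = - e"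
    using unit_normal_arc_param(1)[OF ob arc, of a] unit_normal_arc_param(1)[OF ob arc', of b] ga gb nA nB
    by simp_all
  have "\<i> * (- \<i> * \<beta>1 b) = \<i> * (- (- \<i> * \<gamma>1 a))" unfolding 1 2 ..
  then show "\<beta>1 b = - \<gamma>1 a" by simp
qed

lemma pair_grazing_linearization:
  assumes "\<eta> > 0"
  obtains \<delta> where "\<delta> > 0" "\<And>h k. \<bar>h\<bar> < \<delta> \<Longrightarrow> \<bar>k\<bar> < \<delta> \<Longrightarrow>
    \<bar>d * (sgn (\<gamma> (a + h) - \<beta> (b + k)) \<bullet> \<gamma>1 (a + h)) - ((1 + d * curv \<gamma>1 \<gamma>2 a) * h + k)\<bar>
      \<le> \<eta> * (\<bar>h\<bar> + \<bar>k\<bar>)"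
proof -
  define N where "N p = sgn (\<gamma> (fst p) - \<beta> (snd p)) \<bullet> \<gamma>1 (fst p)" for p
  define L where "L h = (curv \<gamma>1 \<gamma>2 a + 1 / d) * fst h + snd h / d" for h :: "real \<times> real"
  have base: "\<beta> b = \<gamma> a + d *\<^sub>R (- \<i> * \<gamma>1 a)"
    unfolding pair_tangents ga gb by (rule BA)
  have "(N has_derivative L) (at (a, b))"
    unfolding N_def L_def by (rule grazing_has_derivative[OF arc arc' d base pair_tangents(3)])
  then obtain \<delta> where \<delta>: "\<delta> > 0" "\<And>y. norm (y - (a, b)) < \<delta> \<Longrightarrow>
      norm (N y - N (a, b) - L (y - (a, b))) \<le> \<eta> / d * norm (y - (a, b))"
    unfolding has_derivative_at_alt using assms d by (meson divide_pos_pos)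
  have N0: "N (a, b) = 0"
  proof -
    have "\<gamma> a - \<beta> b = d *\<^sub>R (\<i> * \<gamma>1 a)" unfolding base by simp
    then show ?thesis by (simp add: N_def sgn_scaleR sgn_div_norm[of "\<i> * \<gamma>1 a"] inner_i_mult_self)
  qed
  show ?thesis
  proof (rule that[of "\<delta> / 2"])
    fix h k :: real assume h: "\<bar>h\<bar> < \<delta> / 2" "\<bar>k\<bar> < \<delta> / 2"
    have nb: "norm (h, k) \<le> \<bar>h\<bar> + \<bar>k\<bar>" using norm_Pair_le[of h k] by simp
    then have "norm ((a + h, b + k) - (a, b)) < \<delta>" using h by simp
    from \<delta>(2)[OF this] have "\<bar>N (a + h, b + k) - L (h, k)\<bar> \<le> \<eta> / d * norm (h, k)"
      by (simp add: N0)
    then have "d * \<bar>N (a + h, b + k) - L (h, k)\<bar> \<le> d * (\<eta> / d * norm (h, k))"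
      using d by (intro mult_left_mono) auto
    also have "\<dots> = \<eta> * norm (h, k)" using d by simp
    also have "\<dots> \<le> \<eta> * (\<bar>h\<bar> + \<bar>k\<bar>)" using nb assms by (intro mult_left_mono) auto
    also have "d * \<bar>N (a + h, b + k) - L (h, k)\<bar> = \<bar>d * N (a + h, b + k) - d * L (h, k)\<bar>"
      using d by (simp add: abs_mult flip: right_diff_distrib)
    also have "d * L (h, k) = (1 + d * curv \<gamma>1 \<gamma>2 a) * h + k"
      using d by (simp add: L_def field_simps)
    finally show "\<bar>d * (sgn (\<gamma> (a + h) - \<beta> (b + k)) \<bullet> \<gamma>1 (a + h)) - ((1 + d * curv \<gamma>1 \<gamma>2 a) * h + k)\<bar>
      \<le> \<eta> * (\<bar>h\<bar> + \<bar>k\<bar>)" by (simp add: N_def)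
  qed (use \<delta> in simp)
qed

text \<open>At a minimal vertex the tangential components towards both neighbours cancel, and each
  is linearized with error \<eta>/2, since \<open>h\<close> enters twice. The signs are all positive
  because both curves keep their counterclockwise parameters.\<close>

lemma pair_critical_recursion:
  assumes "\<eta> > 0"
  obtains \<delta> where "\<delta> > 0"
    "\<And>h k l. \<bar>h\<bar> < \<delta> \<Longrightarrow> \<bar>k\<bar> < \<delta> \<Longrightarrow> \<bar>l\<bar> < \<delta> \<Longrightarrow>
      (\<And>w. w \<in> closure (\<O> i) \<Longrightarrow> dist (\<beta> (b + k)) (\<gamma> (a + h)) + dist (\<gamma> (a + h)) (\<beta> (b + l))
          \<le> dist (\<beta> (b + k)) w + dist w (\<beta> (b + l))) \<Longrightarrow>
      \<bar>k + l + 2 * (1 + d * curv \<gamma>1 \<gamma>2 a) * h\<bar> \<le> \<eta> * (\<bar>k\<bar> + \<bar>h\<bar> + \<bar>l\<bar>)"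
    "\<And>h k. \<bar>h\<bar> < \<delta> \<Longrightarrow> \<bar>k\<bar> < \<delta> \<Longrightarrow>
      (\<And>w. w \<in> closure (\<O> i) \<Longrightarrow> dist (\<beta> (b + k)) (\<gamma> (a + h)) \<le> dist (\<beta> (b + k)) w) \<Longrightarrow>
      \<bar>k + (1 + d * curv \<gamma>1 \<gamma>2 a) * h\<bar> \<le> \<eta> * (\<bar>k\<bar> + \<bar>h\<bar>)"
proof -
  have "\<eta> / 2 > 0" using assms by simp
  then obtain \<delta> where \<delta>: "\<delta> > 0" "\<And>h k. \<bar>h\<bar> < \<delta> \<Longrightarrow> \<bar>k\<bar> < \<delta> \<Longrightarrow>
    \<bar>d * (sgn (\<gamma> (a + h) - \<beta> (b + k)) \<bullet> \<gamma>1 (a + h)) - ((1 + d * curv \<gamma>1 \<gamma>2 a) * h + k)\<bar>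
      \<le> \<eta> / 2 * (\<bar>h\<bar> + \<bar>k\<bar>)" using pair_grazing_linearization by blast
  have ne: "\<gamma> s \<noteq> \<beta> t" for s t
    using billiard_closures_disjoint[OF tab ij] arc_param_in_frontier[OF arc, of s]
      arc_param_in_frontier[OF arc', of t] by (auto simp: frontier_def)
  show ?thesis
  proof (rule that[OF \<delta>(1)])
    fix h k l assume hkl: "\<bar>h\<bar> < \<delta>" "\<bar>k\<bar> < \<delta>" "\<bar>l\<bar> < \<delta>"
      and min: "\<And>w. w \<in> closure (\<O> i) \<Longrightarrow> dist (\<beta> (b + k)) (\<gamma> (a + h)) + dist (\<gamma> (a + h)) (\<beta> (b + l))
          \<le> dist (\<beta> (b + k)) w + dist w (\<beta> (b + l))"
    define X Y where "X = sgn (\<gamma> (a + h) - \<beta> (b + k)) \<bullet> \<gamma>1 (a + h)"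
      and "Y = sgn (\<gamma> (a + h) - \<beta> (b + l)) \<bullet> \<gamma>1 (a + h)"
    define c where "c = (1 + d * curv \<gamma>1 \<gamma>2 a) * h"
    have "X + Y = 0" unfolding X_def Y_def by (rule arc_sum_dist_critical[OF arc ne ne min])
    then have XY: "d * X + d * Y = 0" by (simp flip: distrib_left)
    have 1: "\<bar>d * X - (c + k)\<bar> \<le> \<eta> / 2 * (\<bar>h\<bar> + \<bar>k\<bar>)" "\<bar>d * Y - (c + l)\<bar> \<le> \<eta> / 2 * (\<bar>h\<bar> + \<bar>l\<bar>)"
      unfolding X_def Y_def c_def using \<delta>(2) hkl by auto
    have "\<bar>k + l + 2 * c\<bar> \<le> \<eta> / 2 * (\<bar>h\<bar> + \<bar>k\<bar>) + \<eta> / 2 * (\<bar>h\<bar> + \<bar>l\<bar>)"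
      using 1 XY by linarith
    also have "\<dots> \<le> \<eta> * (\<bar>k\<bar> + \<bar>h\<bar> + \<bar>l\<bar>)"
    proof -
      have "0 \<le> \<eta> * \<bar>k\<bar>" "0 \<le> \<eta> * \<bar>l\<bar>" using assms by auto
      then show ?thesis unfolding distrib_left by linarith
    qed
    finally show "\<bar>k + l + 2 * (1 + d * curv \<gamma>1 \<gamma>2 a) * h\<bar> \<le> \<eta> * (\<bar>k\<bar> + \<bar>h\<bar> + \<bar>l\<bar>)"
      unfolding c_def by (simp only: mult.assoc)
  next
    fix h k assume hk: "\<bar>h\<bar> < \<delta>" "\<bar>k\<bar> < \<delta>"
      and min: "\<And>w. w \<in> closure (\<O> i) \<Longrightarrow> dist (\<beta> (b + k)) (\<gamma> (a + h)) \<le> dist (\<beta> (b + k)) w"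
    have "sgn (\<gamma> (a + h) - \<beta> (b + k)) \<bullet> \<gamma>1 (a + h) = 0" by (rule arc_dist_critical[OF arc ne min])
    then have "\<bar>(1 + d * curv \<gamma>1 \<gamma>2 a) * h + k\<bar> \<le> \<eta> / 2 * (\<bar>h\<bar> + \<bar>k\<bar>)"
      using \<delta>(2)[OF hk] by (simp only: mult_zero_right diff_0 abs_minus_cancel)
    also have "\<dots> \<le> \<eta> * (\<bar>k\<bar> + \<bar>h\<bar>)"
    proof -
      have "0 \<le> \<eta> * \<bar>k\<bar>" "0 \<le> \<eta> * \<bar>h\<bar>" using assms by auto
      then show ?thesis unfolding distrib_left by linarith
    qed
    finally show "\<bar>k + (1 + d * curv \<gamma>1 \<gamma>2 a) * h\<bar> \<le> \<eta> * (\<bar>k\<bar> + \<bar>h\<bar>)"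
      by (simp add: add.commute)
  qed
qed

text \<open>The tangent at \<open>A\<close> is orthogonal to \<open>e\<close>, so the depth below
  the supporting line has no linear term.\<close>

lemma pair_height:
  assumes "h \<noteq> 0"
  obtains \<xi> where "\<bar>\<xi> - a\<bar> < \<bar>h\<bar>" "(A - \<gamma> (a + h)) \<bullet> e = - (\<gamma>2 \<xi> \<bullet> e) / 2 * h\<^sup>2"
proof -
  have "\<gamma>1 a \<bullet> e = 0" unfolding pair_tangents(1)[symmetric] by (simp add: inner_i_mult_self)
  then obtain \<xi> where "\<bar>\<xi> - a\<bar> < \<bar>h\<bar>" "(\<gamma> (a + h) - \<gamma> a) \<bullet> e = (\<gamma>2 \<xi> \<bullet> e) / 2 * h\<^sup>2"
    using arc_param_taylor[OF arc, of "a + h" a e] assms by auto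
  with that show ?thesis by (simp add: ga inner_diff_left)
qed

lemma pair_distance_lower:
  obtains c \<delta> where "c > 0" "\<delta> > 0"
    "\<And>h y. \<bar>h\<bar> < \<delta> \<Longrightarrow> y \<in> closure (\<O> j) \<Longrightarrow> d + c * h\<^sup>2 \<le> dist (\<gamma> (a + h)) y"
proof -
  define \<kappa> where "\<kappa> = curv \<gamma>1 \<gamma>2 a"
  have \<kappa>: "\<kappa> > 0" unfolding \<kappa>_def by (rule curv_pos[OF arc])
  have "\<gamma>2 a \<bullet> e = - \<kappa>"
    unfolding pair_tangents(1)[symmetric] \<kappa>_def arc_param_second[OF arc, of a]
    by (simp add: dot_square_norm norm_mult arc_param_norm[OF arc])
  moreover have "isCont (\<lambda>s. \<gamma>2 s \<bullet> e) a"
    using arc_param_cont(3)[OF arc, of UNIV] by (intro continuous_intros) (simp add: continuous_on_eq_continuous_at)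
  moreover have "\<kappa> / 2 > 0" using \<kappa> by simp
  ultimately obtain \<delta> where \<delta>0: "\<delta> > 0" "\<And>s. \<bar>s - a\<bar> < \<delta> \<Longrightarrow> \<bar>\<gamma>2 s \<bullet> e - (- \<kappa>)\<bar> < \<kappa> / 2"
    unfolding continuous_at_eps_delta dist_real_def by metis
  have \<delta>: "\<gamma>2 s \<bullet> e < - \<kappa> / 2" if "\<bar>s - a\<bar> < \<delta>" for s
    using \<delta>0(2)[OF that] by linarith
  show ?thesis
  \<comment> \<open>Continuity keeps the second derivative along \<open>e\<close> below
    \<open>- \<kappa> / 2\<close> near \<open>a\<close>; the Taylor factor 1/2 gives
    \<kappa>/4.\<close>
  proof (rule that[of "\<kappa> / 4" \<delta>])
    fix h y assume h: "\<bar>h\<bar> < \<delta>" and y: "y \<in> closure (\<O> j)"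
    have cl: "\<gamma> (a + h) \<in> closure (\<O> i)" using arc_param_in_frontier[OF arc] by (auto simp: frontier_def)
    have "\<kappa> / 4 * h\<^sup>2 \<le> (A - \<gamma> (a + h)) \<bullet> e"
    proof (cases "h = 0")
      case False
      then obtain \<xi> where \<xi>: "\<bar>\<xi> - a\<bar> < \<bar>h\<bar>" "(A - \<gamma> (a + h)) \<bullet> e = - (\<gamma>2 \<xi> \<bullet> e) / 2 * h\<^sup>2"
        by (rule pair_height)
      then have "\<gamma>2 \<xi> \<bullet> e < - \<kappa> / 2" using \<delta>[of \<xi>] h by simp
      then show ?thesis unfolding \<xi>(2) by (intro mult_right_mono) auto
    qed (simp add: ga)
    then show "d + \<kappa> / 4 * h\<^sup>2 \<le> dist (\<gamma> (a + h)) y"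
      using pair_separation(3)[OF cl y] by linarith
  qed (use \<kappa> \<delta>0 in auto)
qed

lemma pair_distance_upper:
  obtains C where "C > 0" "\<And>h. \<bar>h\<bar> \<le> T / 2 \<Longrightarrow> dist (\<gamma> (a + h)) B \<le> d + C * h\<^sup>2"
proof -
  have "compact (\<gamma>2 ` cball a (T / 2))"
    by (intro compact_continuous_image arc_param_cont[OF arc]) simp
  then obtain K where K: "\<And>x. \<bar>x - a\<bar> \<le> T / 2 \<Longrightarrow> norm (\<gamma>2 x) \<le> K"
    using compact_imp_bounded[THEN bounded_pos[THEN iffD1]] by (force simp: dist_real_def abs_minus_commute)
  have "K \<ge> 0" using order_trans[OF norm_ge_zero K[of a]] arc_param_period_pos[OF arc] by simp
  \<comment> \<open>Chosen such that
    \<open>h\<^sup>2 + d * K * h\<^sup>2 = 2 * d * (C * h\<^sup>2)\<close>: adding the square of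
    \<open>C * h\<^sup>2\<close> then completes the square and removes the root from the
    distance.\<close>
  define C where "C = (1 + d * K) / (2 * d)"
  show ?thesis
  proof (rule that[of C])
    show "C > 0" using d \<open>K \<ge> 0\<close> by (simp add: C_def add_pos_nonneg)
    fix h assume h: "\<bar>h\<bar> \<le> T / 2"
    have up: "(A - \<gamma> (a + h)) \<bullet> e \<le> K / 2 * h\<^sup>2"
    proof (cases "h = 0")
      case False
      then obtain \<xi> where \<xi>: "\<bar>\<xi> - a\<bar> < \<bar>h\<bar>" "(A - \<gamma> (a + h)) \<bullet> e = - (\<gamma>2 \<xi> \<bullet> e) / 2 * h\<^sup>2"
        by (rule pair_height)
      have "- (\<gamma>2 \<xi> \<bullet> e) \<le> norm (\<gamma>2 \<xi>)"
        using inner_le_norm_unit[of "- e" "\<gamma>2 \<xi>"] pair_norm(1) by simp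
      also have "\<dots> \<le> K" using K[of \<xi>] \<xi>(1) h by simp
      finally show ?thesis unfolding \<xi>(2) by (intro mult_right_mono) auto
    qed (simp add: ga)
    have "norm (\<gamma> (a + h) - A) \<le> \<bar>h\<bar>"
      using arc_param_lipschitz[OF arc, of "a + h" a] by (simp add: ga dist_norm)
    then have sq: "(norm (\<gamma> (a + h) - A))\<^sup>2 \<le> h\<^sup>2" by (metis abs_le_square_iff abs_norm_cancel)
    define u where "u = \<gamma> (a + h) - A"
    have u: "\<gamma> (a + h) - B = u - d *\<^sub>R e" "A - \<gamma> (a + h) = - u" by (simp_all add: u_def BA)
    have "(norm (u - d *\<^sub>R e))\<^sup>2 = (norm u)\<^sup>2 + 2 * d * (- u \<bullet> e) + d\<^sup>2"
      unfolding power2_norm_eq_inner using pair_norm(2)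
      by (simp add: inner_diff_left inner_diff_right inner_commute power2_eq_square algebra_simps)
    then have "(norm (\<gamma> (a + h) - B))\<^sup>2 =
        (norm (\<gamma> (a + h) - A))\<^sup>2 + 2 * d * ((A - \<gamma> (a + h)) \<bullet> e) + d\<^sup>2"
      unfolding u by (simp add: u_def)
    also have "\<dots> \<le> h\<^sup>2 + 2 * d * (K / 2 * h\<^sup>2) + d\<^sup>2"
      using sq up d by (intro add_mono mult_left_mono) auto
    also have "\<dots> = d\<^sup>2 + 2 * d * (C * h\<^sup>2)" using d by (simp add: C_def field_simps)
    also have "\<dots> \<le> (d + C * h\<^sup>2)\<^sup>2" by (simp add: power2_sum)
    finally have "(dist (\<gamma> (a + h)) B)\<^sup>2 \<le> (d + C * h\<^sup>2)\<^sup>2" unfolding dist_norm .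
    then show "dist (\<gamma> (a + h)) B \<le> d + C * h\<^sup>2"
      by (rule power2_le_imp_le) (use d \<open>C > 0\<close> in simp)
  qed
qed

end
end

subsection \<open>Chains approaching the period two orbit\<close>

text \<open>One infinite word serves all lengths: folding its first \<open>n + 2\<close> letters
  gives the periodic word of \<tau> followed by \<open>n\<close> copies of \<sigma>.\<close>

definition approach_word :: "3 \<Rightarrow> 3 \<Rightarrow> 3 \<Rightarrow> nat \<Rightarrow> 3" where
  "approach_word wt w0 w1 j = (if j = 0 then wt else if even j then w1 else w0)"

locale facing_pair_third = facing_pair \<O> w1 w0 A B e d for \<O> w1 w0 A B e d +
  fixes wt :: 3
  assumes wt1: "wt \<noteq> w1" and wt0: "wt \<noteq> w0"
begin

sublocale opposite: facing_pair \<O> w0 w1 B A "- e" d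
  by unfold_locales (use tab ij A B nA nB d BA in simp_all)

abbreviation (input) "approach \<equiv> approach_word wt w0 w1"

text \<open>The value at 0 is a dummy, as vertex 0 lies on the third obstacle.\<close>

definition base_point :: "nat \<Rightarrow> complex" where
  "base_point j = (if even j then A else B)"

lemma approach_word_step: "approach j \<noteq> approach (Suc j)"
  using ij wt0 by (auto simp: approach_word_def)

lemma base_point_mem: "j > 0 \<Longrightarrow> base_point j \<in> closure (\<O> (approach j))"
  using A B by (auto simp: base_point_def approach_word_def frontier_def)

lemma base_point_dist: "dist (base_point j) (base_point (Suc j)) = d"
  unfolding base_point_def using d pair_norm(1)
  by (cases "even j") (simp_all add: dist_norm BA)

lemma approach_separation:
  assumes "j > 0" "x \<in> closure (\<O> (approach j))" "y \<in> closure (\<O> (approach (Suc j)))"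
  shows "d \<le> dist x y" "dist x y \<le> d \<Longrightarrow> x = base_point j \<and> y = base_point (Suc j)"
proof -
  have "d \<le> dist x y \<and> (dist x y \<le> d \<longrightarrow> x = base_point j \<and> y = base_point (Suc j))"
  proof (cases "even j")
    case True
    then have "x \<in> closure (\<O> w1)" "y \<in> closure (\<O> w0)" using assms by (simp_all add: approach_word_def)
    moreover have "base_point j = A" "base_point (Suc j) = B" using True by (simp_all add: base_point_def)
    ultimately show ?thesis using pair_separation(1,2) by metis
  next
    case False
    then have "x \<in> closure (\<O> w0)" "y \<in> closure (\<O> w1)" using assms by (simp_all add: approach_word_def)
    moreover have "base_point j = B" "base_point (Suc j) = A" using False by (simp_all add: base_point_def)
    ultimately show ?thesis using opposite.pair_separation(1,2) by metis
  qed
  then show "d \<le> dist x y" "dist x y \<le> d \<Longrightarrow> x = base_point j \<and> y = base_point (Suc j)" by auto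
qed

lemma approach_stability:
  assumes "\<epsilon> > 0"
  obtains \<eta> where "\<eta> > 0"
    "\<And>j x y. j > 0 \<Longrightarrow> x \<in> closure (\<O> (approach j)) \<Longrightarrow> y \<in> closure (\<O> (approach (Suc j))) \<Longrightarrow> dist x y < d + \<eta> \<Longrightarrow>
       dist x (base_point j) < \<epsilon> \<and> dist y (base_point (Suc j)) < \<epsilon>"
proof -
  obtain \<eta> where \<eta>: "\<eta> > 0" "\<And>x y. x \<in> closure (\<O> w1) \<Longrightarrow> y \<in> closure (\<O> w0) \<Longrightarrow> dist x y < d + \<eta> \<Longrightarrow>
      dist x A < \<epsilon> \<and> dist y B < \<epsilon>"
    using pair_stability[OF assms] by blast
  show ?thesis
  proof (rule that[OF \<eta>(1)])
    fix j x y assume "j > 0" "x \<in> closure (\<O> (approach j))" "y \<in> closure (\<O> (approach (Suc j)))" "dist x y < d + \<eta>"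
    then show "dist x (base_point j) < \<epsilon> \<and> dist y (base_point (Suc j)) < \<epsilon>"
      using \<eta>(2)[of x y] \<eta>(2)[of y x]
      by (cases "even j") (auto simp: approach_word_def base_point_def dist_commute)
  qed
qed

section \<open>Comparison with chains that continue along the period two orbit\<close>

definition splice :: "nat \<Rightarrow> (nat \<Rightarrow> complex) \<Rightarrow> nat \<Rightarrow> complex" where
  "splice j z i = (if i \<le> j then z i else base_point i)"

lemma splice_mem:
  "(\<And>i. z i \<in> closure (\<O> (approach i))) \<Longrightarrow> splice j z i \<in> closure (\<O> (approach i))"
  using base_point_mem by (auto simp: splice_def)

lemma splice_length:
  "chain_length (j + Suc k) (splice j z) = chain_length j z + dist (z j) (base_point (Suc j)) + real k * d"
proof -
  have "chain_length j (splice j z) = chain_length j z"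
    unfolding chain_length_def by (rule sum.cong) (auto simp: splice_def)
  moreover have "(\<Sum>i<Suc k. dist (splice j z (j + i)) (splice j z (Suc (j + i)))) =
      dist (z j) (base_point (Suc j)) + real k * d"
    unfolding sum.lessThan_Suc_shift by (simp add: splice_def base_point_dist)
  ultimately show ?thesis
    using sum_lessThan_add[of "\<lambda>i. dist (splice j z i) (splice j z (Suc i))" j "Suc k"]
    by (simp add: chain_length_def)
qed

lemma sum_lower_one:
  fixes f :: "nat \<Rightarrow> real"
  assumes "i < n" "\<And>k. k < n \<Longrightarrow> c \<le> f k"
  shows "f i + (real n - 1) * c \<le> (\<Sum>k<n. f k)"
proof -
  have "(\<Sum>k\<in>{..<n} - {i}. c) \<le> (\<Sum>k\<in>{..<n} - {i}. f k)"
    by (rule sum_mono) (use assms in auto)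
  moreover have "(\<Sum>k<n. f k) = f i + (\<Sum>k\<in>{..<n} - {i}. f k)"
    using assms(1) by (intro sum.remove) auto
  ultimately show ?thesis using assms(1) by (simp add: of_nat_diff)
qed

lemma minimizer_tail:
  assumes min: "chain_minimizer \<O> approach m z" and jm: "j < m"
  shows "(\<Sum>i<m - j. dist (z (j + i)) (z (Suc (j + i)))) \<le> dist (z j) (base_point (Suc j)) + real (m - j - 1) * d"
proof -
  obtain k where k: "m = j + Suc k" using less_imp_Suc_add[OF jm] by auto
  have mem: "\<And>i. z i \<in> closure (\<O> (approach i))" using min by (simp add: chain_minimizer_def)
  have "chain_length m z \<le> chain_length m (splice j z)"
    using min splice_mem[OF mem] unfolding chain_minimizer_def by blast
  also have "\<dots> = chain_length j z + dist (z j) (base_point (Suc j)) + real k * d"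
    unfolding k by (rule splice_length)
  finally show ?thesis
    using sum_lessThan_add[of "\<lambda>i. dist (z i) (z (Suc i))" j "Suc k"]
    by (simp add: k chain_length_def)
qed

text \<open>All links of the tail have length at least \<open>d\<close>, so the excess of a single
  one is at most that of the whole tail, and this is at most the excess of jumping from
  \<open>z j\<close> to the period two orbit.\<close>

lemma minimizer_energy:
  assumes min: "chain_minimizer \<O> approach m z" and j: "0 < j" "j \<le> i" "i < m"
  shows "dist (z i) (z (Suc i)) \<le> dist (z j) (base_point (Suc j))"
proof -
  have mem: "\<And>i. z i \<in> closure (\<O> (approach i))" using min by (simp add: chain_minimizer_def)
  have "dist (z (j + (i - j))) (z (Suc (j + (i - j)))) + (real (m - j) - 1) * d
      \<le> (\<Sum>k<m - j. dist (z (j + k)) (z (Suc (j + k))))"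
    by (rule sum_lower_one[where f = "\<lambda>k. dist (z (j + k)) (z (Suc (j + k)))"])
      (use j approach_separation(1)[OF _ mem mem] in auto)
  also have "\<dots> \<le> dist (z j) (base_point (Suc j)) + real (m - j - 1) * d"
    by (rule minimizer_tail[OF min]) (use j in simp)
  finally have "dist (z (j + (i - j))) (z (Suc (j + (i - j)))) + (real (m - j) - 1) * d
      \<le> dist (z j) (base_point (Suc j)) + real (m - j - 1) * d" .
  moreover have "real (m - j) - 1 = real (m - j - 1)" using j by (simp add: of_nat_diff)
  moreover have "j + (i - j) = i" using j by simp
  ultimately show ?thesis by (simp only: add_le_cancel_right)
qed

lemma base_point_triangle: "dist x (base_point (Suc j)) \<le> dist x (base_point j) + d"
  using dist_triangle[of x "base_point (Suc j)" "base_point j"] by (simp add: base_point_dist)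

text \<open>The total excess over the lower bound \<open>d\<close> per link is bounded, so some early link is almost
  shortest; from there on the excess of all later links is bounded by that of one vertex.\<close>

lemma minimizers_approach_base:
  assumes min: "\<And>m. chain_minimizer \<O> approach m (Z m)" and \<epsilon>: "\<epsilon> > 0"
  obtains j0 where "j0 > 0" "\<And>m j. j0 \<le> j \<Longrightarrow> j \<le> m \<Longrightarrow> dist (Z m j) (base_point j) < \<epsilon>"
proof -
  have mem: "\<And>m i. Z m i \<in> closure (\<O> (approach i))" using min by (simp add: chain_minimizer_def)
  \<comment> \<open>Stability is used twice: an early link with excess below \<eta>2 puts its first
    vertex within \<eta>1 of the orbit; then every later link has excess below \<eta>1, and its
    vertices are \<epsilon>-close.\<close>
  obtain \<eta>1 where \<eta>1: "\<eta>1 > 0" "\<And>j x y. j > 0 \<Longrightarrow> x \<in> closure (\<O> (approach j)) \<Longrightarrow> y \<in> closure (\<O> (approach (Suc j))) \<Longrightarrow>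
      dist x y < d + \<eta>1 \<Longrightarrow> dist x (base_point j) < \<epsilon> \<and> dist y (base_point (Suc j)) < \<epsilon>"
    using approach_stability[OF \<epsilon>] by blast
  obtain \<eta>2 where \<eta>2: "\<eta>2 > 0" "\<And>j x y. j > 0 \<Longrightarrow> x \<in> closure (\<O> (approach j)) \<Longrightarrow> y \<in> closure (\<O> (approach (Suc j))) \<Longrightarrow>
      dist x y < d + \<eta>2 \<Longrightarrow> dist x (base_point j) < \<eta>1 \<and> dist y (base_point (Suc j)) < \<eta>1"
    using approach_stability[OF \<eta>1(1)] by blast
  have "bounded (closure (\<O> w0))"
    using obstacle_compact[OF billiard_obstacle[OF tab]] compact_imp_bounded by blast
  then obtain D where D: "\<And>x. x \<in> closure (\<O> w0) \<Longrightarrow> dist A x \<le> D"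
    unfolding bounded_any_center[where a = A] by blast
  \<comment> \<open>\<open>D\<close> bounds the jump from vertex 1 to the orbit and hence the total
    excess; \<open>N\<close> links of excess \<eta>2 would exceed it, whatever \<open>m\<close>
    is.\<close>
  obtain N :: nat where N: "D / \<eta>2 < real N" using reals_Archimedean2 by blast
  show ?thesis
  proof (rule that[of "N + 2"])
    fix m j assume j: "N + 2 \<le> j" "j \<le> m"
    define f where "f i = dist (Z m (1 + i)) (Z m (Suc (1 + i)))" for i
    have fd: "d \<le> f i" for i unfolding f_def by (rule approach_separation(1)[OF _ mem mem]) simp
    have "\<exists>i<N. f i < d + \<eta>2"
    proof (rule ccontr)
      assume "\<not> ?thesis"
      then have big: "d + \<eta>2 \<le> f i" if "i < N" for i using that by force
      have "real (m - 1) * d + real N * \<eta>2 = (\<Sum>i<m - 1. d + (if i < N then \<eta>2 else 0))"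
      proof -
        have "{i. i < m - Suc 0 \<and> i < N} = {..<N}" using j by auto
        moreover have "(\<Sum>i<m - 1. if i < N then \<eta>2 else 0) = (\<Sum>i\<in>{i. i < m - Suc 0 \<and> i < N}. \<eta>2)"
          by (rule sum.mono_neutral_cong_right) auto
        ultimately show ?thesis by (simp add: sum.distrib)
      qed
      also have "\<dots> \<le> (\<Sum>i<m - 1. f i)" by (rule sum_mono) (use fd big in auto)
      also have "\<dots> \<le> dist (Z m 1) (base_point 2) + real (m - 1 - 1) * d"
        using minimizer_tail[OF min, of 1 m] j by (simp add: f_def numeral_2_eq_2)
      also have "\<dots> \<le> D + real (m - 1) * d"
        using D[of "Z m 1"] mem[of m 1] d
        by (intro add_mono mult_right_mono) (auto simp: base_point_def approach_word_def dist_commute)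
      finally have "real N * \<eta>2 \<le> D" by simp
      then show False using N \<eta>2(1) by (simp add: divide_less_eq)
    qed
    then obtain i where i: "i < N" "f i < d + \<eta>2" by blast
    have im: "Suc i < m" using i(1) j by linarith
    have near: "dist (Z m (Suc i)) (base_point (Suc i)) < \<eta>1"
      using \<eta>2(2)[of "Suc i", OF _ mem mem] i(2) by (simp add: f_def)
    \<comment> \<open>The link ending in vertex \<open>j\<close> is used, because for
      \<open>j = m\<close> there is no link starting there.\<close>
    define k where "k = j - 1"
    have k: "Suc i \<le> k" "k < m" "j = Suc k" using i j by (auto simp: k_def)
    have "dist (Z m k) (Z m (Suc k)) \<le> dist (Z m (Suc i)) (base_point (Suc (Suc i)))"
      using minimizer_energy[OF min _ k(1,2)] by simp
    also have "\<dots> < d + \<eta>1" using base_point_triangle[of "Z m (Suc i)" "Suc i"] near by simp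
    finally show "dist (Z m j) (base_point j) < \<epsilon>"
      using \<eta>1(2)[of k, OF _ mem mem] k by simp
  qed simp
qed

text \<open>A chain that reaches the period two orbit can be followed backwards along the common normal
  by the law of reflection; it would have to start on that line, which misses the third obstacle.\<close>

lemma limit_chain_not_base:
  assumes mem: "\<And>i. z i \<in> closure (\<O> (approach i))" and j: "j > 0" "z j = base_point j"
    and tail: "\<And>i. j \<le> i \<Longrightarrow> dist (z i) (z (Suc i)) \<le> d"
    and min: "\<And>i w. i > 0 \<Longrightarrow> w \<in> closure (\<O> (approach i)) \<Longrightarrow>
      dist (z (i - 1)) (z i) + dist (z i) (z (Suc i)) \<le> dist (z (i - 1)) w + dist w (z (Suc i))"
  shows False
proof -
  have start: "z j = base_point j \<and> z (Suc j) = base_point (Suc j)"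
    by (rule approach_separation(2)[OF j(1) mem mem tail[OF order_refl]])
  \<comment> \<open>Reflection at vertex \<open>Suc k\<close> puts vertex \<open>k\<close> on the
    common normal. That it is the facing point, not one on the far side of the obstacle, follows
    from reflection at vertex \<open>k\<close> itself and uses its predecessor, hence
    \<open>k > 0\<close>.\<close>
  have backwards: "z k = base_point k \<and> z (Suc k) = base_point (Suc k)"
    if "z (Suc k) = base_point (Suc k) \<and> z (Suc (Suc k)) = base_point (Suc (Suc k))" "k > 0" for k
  proof (cases "even k")
    case True
    have w: "approach k = w1" "approach (Suc k) = w0" using True that(2) by (auto simp: approach_word_def)
    have b: "z (Suc k) = B" "z (Suc (Suc k)) = A" using that(1) True by (auto simp: base_point_def)
    obtain r where r: "r > 0" "z k = B + r *\<^sub>R (- e)"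
      using opposite.pair_reflect_back[OF ij mem[of k, unfolded w]] min[of "Suc k"] b w by auto
    have l: "approach (k - 1) \<noteq> w1" using approach_word_step[of "k - 1"] that(2) w by simp
    have "B + r *\<^sub>R (- e) = A"
      by (rule opposite.pair_ray_first_hit[OF _ r(1) l mem[of "k - 1"]])
        (use mem[of k] min[of k] that(2) r(2) b w in \<open>auto simp del: scaleR_minus_right\<close>)
    then show ?thesis using that r(2) True by (simp add: base_point_def)
  next
    case False
    have w: "approach k = w0" "approach (Suc k) = w1" using False that(2) by (auto simp: approach_word_def)
    have b: "z (Suc k) = A" "z (Suc (Suc k)) = B" using that(1) False by (auto simp: base_point_def)
    obtain r where r: "r > 0" "z k = A + r *\<^sub>R e"
      using pair_reflect_back[OF ij[symmetric] mem[of k, unfolded w]] min[of "Suc k"] b w by auto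
    have l: "approach (k - 1) \<noteq> w0" using approach_word_step[of "k - 1"] that(2) w by simp
    have "A + r *\<^sub>R e = B"
      by (rule pair_ray_first_hit[OF _ r(1) l mem[of "k - 1"]])
        (use mem[of k] min[of k] that(2) r(2) b w in auto)
    then show ?thesis using that r(2) False by (simp add: base_point_def)
  qed
  have "z (Suc 0) = base_point (Suc 0) \<and> z (Suc (Suc 0)) = base_point (Suc (Suc 0))"
  proof -
    have "1 \<le> j" using j(1) by simp
    then have "z 1 = base_point 1 \<and> z (Suc 1) = base_point (Suc 1)"
    proof (induction rule: inc_induct)
      case base
      then show ?case by (rule start)
    next
      case (step n)
      then show ?case using backwards[of n] by simp
    qed
    then show ?thesis by simp
  qed
  then have b: "z (Suc 0) = B" "z (Suc (Suc 0)) = A" by (auto simp: base_point_def)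
  have w: "approach 0 = wt" "approach (Suc 0) = w0" by (auto simp: approach_word_def)
  obtain r where "r > 0" "z 0 = B + r *\<^sub>R (- e)"
    using opposite.pair_reflect_back[OF wt0 mem[of 0, unfolded w]] min[of "Suc 0"] b w by auto
  then show False
    using opposite.pair_ray_avoids_third[OF wt0 wt1] mem[of 0] w by metis
qed

text \<open>Otherwise minimizers along a subsequence converge in the product topology to a chain
  passing through the base point. Local minimality and the energy bound survive in the limit, so all
  later links have length at most \<open>d\<close>; such a chain is impossible.\<close>

lemma minimizers_stay_away:
  assumes min: "\<And>m. chain_minimizer \<O> approach m (Z m)" and j: "j > 0"
  obtains \<delta> where "\<delta> > 0" "\<forall>\<^sub>F m in sequentially. \<delta> \<le> dist (Z m j) (base_point j)"
proof -
  have mem: "\<And>m i. Z m i \<in> closure (\<O> (approach i))" using min by (simp add: chain_minimizer_def)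
  have "\<exists>\<delta>>0. \<forall>\<^sub>F m in sequentially. \<delta> \<le> dist (Z m j) (base_point j)"
  proof (rule ccontr)
    assume "\<not> ?thesis"
    then have fr: "\<exists>m\<ge>n. dist (Z m j) (base_point j) < \<delta>" if "\<delta> > 0" for \<delta> n
      using that unfolding eventually_sequentially by (meson not_le)
    have "\<forall>n. \<exists>m\<ge>n. dist (Z m j) (base_point j) < 1 / (real n + 1)"
      using fr by simp
    then obtain q where q: "\<And>n. q n \<ge> n" "\<And>n. dist (Z (q n) j) (base_point j) < 1 / (real n + 1)"
      by metis
    define S where "S = {z. \<forall>i. z i \<in> closure (\<O> (approach i))}"
    have "compact S" unfolding S_def
      by (intro compact_functions_into obstacle_compact billiard_obstacle tab)
    then have "seq_compact S" by (rule compact_imp_seq_compact)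
    moreover have "\<forall>n. Z (q n) \<in> S" using mem by (simp add: S_def)
    ultimately obtain z r where z: "z \<in> S" "strict_mono (r :: nat \<Rightarrow> nat)" "((\<lambda>n. Z (q n)) \<circ> r) \<longlonglongrightarrow> z"
      by (rule seq_compactE)
    have lim: "(\<lambda>n. Z (q (r n)) i) \<longlonglongrightarrow> z i" for i
    proof -
      have "isCont (\<lambda>x :: nat \<Rightarrow> complex. x i) z"
        by (rule continuous_on_interior[OF continuous_on_product_coordinates]) simp
      from isCont_tendsto_compose[OF this z(3)] show ?thesis by (simp add: o_def)
    qed
    have big: "\<forall>\<^sub>F n in sequentially. i < q (r n)" for i
      using eventually_gt_at_top[of i]
    proof eventually_elim
      case (elim n)
      then show ?case using q(1)[of "r n"] seq_suble[OF z(2), of n] by linarith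
    qed
    have zj: "z j = base_point j"
    proof -
      have "(\<lambda>n. dist (Z (q (r n)) j) (base_point j)) \<longlonglongrightarrow> 0"
      proof (rule tendsto_sandwich[of "\<lambda>_. 0"])
        show "\<forall>\<^sub>F n in sequentially. dist (Z (q (r n)) j) (base_point j) \<le> 1 / (real n + 1)"
        proof (intro always_eventually allI)
          fix n
          have "dist (Z (q (r n)) j) (base_point j) \<le> 1 / (real (r n) + 1)" by (rule less_imp_le[OF q(2)])
          also have "\<dots> \<le> 1 / (real n + 1)" using seq_suble[OF z(2), of n] by (intro divide_left_mono) auto
          finally show "dist (Z (q (r n)) j) (base_point j) \<le> 1 / (real n + 1)" .
        qed
        show "(\<lambda>n. 1 / (real n + 1)) \<longlonglongrightarrow> 0"
          using LIMSEQ_inverse_real_of_nat by (simp add: inverse_eq_divide add.commute)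
      qed auto
      then have "(\<lambda>n. Z (q (r n)) j) \<longlonglongrightarrow> base_point j" by (rule iffD2[OF tendsto_dist_iff])
      with lim[of j] show ?thesis using LIMSEQ_unique by blast
    qed
    show False
    proof (rule limit_chain_not_base[where z = z and j = j, OF _ j zj])
      show "z i \<in> closure (\<O> (approach i))" for i using z(1) by (simp add: S_def)
      show "dist (z i) (z (Suc i)) \<le> d" if "j \<le> i" for i
      proof -
        have "dist (z i) (z (Suc i)) \<le> dist (z j) (base_point (Suc j))"
        proof (rule tendsto_le[OF trivial_limit_sequentially])
          show "(\<lambda>n. dist (Z (q (r n)) i) (Z (q (r n)) (Suc i))) \<longlonglongrightarrow> dist (z i) (z (Suc i))"
            by (intro tendsto_dist lim)
          show "(\<lambda>n. dist (Z (q (r n)) j) (base_point (Suc j))) \<longlonglongrightarrow> dist (z j) (base_point (Suc j))"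
            by (intro tendsto_dist lim tendsto_const)
          show "\<forall>\<^sub>F n in sequentially. dist (Z (q (r n)) i) (Z (q (r n)) (Suc i))
              \<le> dist (Z (q (r n)) j) (base_point (Suc j))"
            using big[of i] by eventually_elim (rule minimizer_energy[OF min j that])
        qed
        then show ?thesis by (simp add: zj base_point_dist)
      qed
      show "dist (z (i - 1)) (z i) + dist (z i) (z (Suc i)) \<le> dist (z (i - 1)) w + dist w (z (Suc i))"
        if "i > 0" "w \<in> closure (\<O> (approach i))" for i w
      proof (rule tendsto_le[OF trivial_limit_sequentially])
        show "(\<lambda>n. dist (Z (q (r n)) (i - 1)) (Z (q (r n)) i) + dist (Z (q (r n)) i) (Z (q (r n)) (Suc i)))
            \<longlonglongrightarrow> dist (z (i - 1)) (z i) + dist (z i) (z (Suc i))"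
          by (intro tendsto_add tendsto_dist lim)
        show "(\<lambda>n. dist (Z (q (r n)) (i - 1)) w + dist w (Z (q (r n)) (Suc i)))
            \<longlonglongrightarrow> dist (z (i - 1)) w + dist w (z (Suc i))"
          by (intro tendsto_add tendsto_dist lim tendsto_const)
        show "\<forall>\<^sub>F n in sequentially.
            dist (Z (q (r n)) (i - 1)) (Z (q (r n)) i) + dist (Z (q (r n)) i) (Z (q (r n)) (Suc i))
            \<le> dist (Z (q (r n)) (i - 1)) w + dist w (Z (q (r n)) (Suc i))"
          using big[of i]
          by eventually_elim (use chain_minimizer_local(1)[OF min that(2) that(1)] in simp)
      qed
    qed
  qed
  with that show ?thesis by blast
qed

end

subsection \<open>Asymptotics of the chain lengths\<close>

lemma ln_mult_square:
  fixes c x :: real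
  assumes "c > 0" "x \<noteq> 0"
  shows "ln (c * x\<^sup>2) = ln c + 2 * ln \<bar>x\<bar>"
proof -
  have "ln (\<bar>x\<bar>\<^sup>2) = real 2 * ln \<bar>x\<bar>" by (rule ln_realpow)
  then have "ln (x\<^sup>2) = 2 * ln \<bar>x\<bar>" unfolding power2_abs by simp
  moreover have "ln (c * x\<^sup>2) = ln c + ln (x\<^sup>2)" using assms by (intro ln_mult_pos) auto
  ultimately show ?thesis by simp
qed

context facing_pair_third
begin

context
  fixes T a T' b :: real and \<gamma> \<gamma>1 \<gamma>2 \<beta> \<beta>1 \<beta>2 :: "real \<Rightarrow> complex"
  assumes arc: "arc_param (\<O> w1) T \<gamma> \<gamma>1 \<gamma>2" and ga: "\<gamma> a = A"
    and arc': "arc_param (\<O> w0) T' \<beta> \<beta>1 \<beta>2" and gb: "\<beta> b = B"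
begin

text \<open>The two boundary curves are traversed in opposite directions along the gap, hence the sign; it
  gives the linearized recursion \<open>s (j - 1) + s (j + 1) = c j * s j\<close> positive coefficients.\<close>

definition chart :: "nat \<Rightarrow> real \<Rightarrow> complex" where
  "chart j t = (if even j then \<gamma> (a + t) else \<beta> (b - t))"

definition half_period :: "nat \<Rightarrow> real" where
  "half_period j = (if even j then T / 2 else T' / 2)"

lemma chart_surj:
  assumes "j > 0" "x \<in> frontier (\<O> (approach j))"
  obtains t where "\<bar>t\<bar> \<le> half_period j" "chart j t = x"
proof (cases "even j")
  case True
  then have "x \<in> frontier (\<O> w1)" using assms by (simp add: approach_word_def)
  then obtain s where "\<gamma> s = x" "\<bar>s - a\<bar> \<le> T / 2" using arc_param_surj[OF arc] by blast
  then show ?thesis using that[of "s - a"] True by (simp add: chart_def half_period_def)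
next
  case False
  then have "x \<in> frontier (\<O> w0)" using assms by (simp add: approach_word_def)
  then obtain s where "\<beta> s = x" "\<bar>s - b\<bar> \<le> T' / 2" using arc_param_surj[OF arc'] by blast
  then show ?thesis using that[of "b - s"] False by (simp add: chart_def half_period_def abs_minus_commute)
qed

lemma chart_near:
  assumes "\<epsilon> > 0"
  obtains \<delta> where "\<delta> > 0"
    "\<And>j t. \<bar>t\<bar> \<le> half_period j \<Longrightarrow> dist (chart j t) (base_point j) < \<delta> \<Longrightarrow> \<bar>t\<bar> < \<epsilon>"
proof -
  obtain \<delta>1 where 1: "\<delta>1 > 0" "\<And>s. \<bar>s - a\<bar> \<le> T / 2 \<Longrightarrow> dist (\<gamma> s) (\<gamma> a) < \<delta>1 \<Longrightarrow> \<bar>s - a\<bar> < \<epsilon>"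
    using arc_param_local_surj[OF arc assms] by blast
  obtain \<delta>2 where 2: "\<delta>2 > 0" "\<And>s. \<bar>s - b\<bar> \<le> T' / 2 \<Longrightarrow> dist (\<beta> s) (\<beta> b) < \<delta>2 \<Longrightarrow> \<bar>s - b\<bar> < \<epsilon>"
    using arc_param_local_surj[OF arc' assms] by blast
  show ?thesis
  proof (rule that[of "min \<delta>1 \<delta>2"])
    fix j t assume t: "\<bar>t\<bar> \<le> half_period j" "dist (chart j t) (base_point j) < min \<delta>1 \<delta>2"
    show "\<bar>t\<bar> < \<epsilon>"
    proof (cases "even j")
      case True
      then have "dist (\<gamma> (a + t)) (\<gamma> a) < \<delta>1" "\<bar>a + t - a\<bar> \<le> T / 2"
        using t ga by (simp_all add: chart_def base_point_def half_period_def)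
      then show ?thesis using 1(2)[of "a + t"] by simp
    next
      case False
      then have "dist (\<beta> (b - t)) (\<beta> b) < \<delta>2" "\<bar>b - t - b\<bar> \<le> T' / 2"
        using t gb by (simp_all add: chart_def base_point_def half_period_def)
      then show ?thesis using 2(2)[of "b - t"] by simp
    qed
  qed (use 1 2 in auto)
qed

definition recursion_coeff :: "nat \<Rightarrow> real" where
  "recursion_coeff j = (if even j then 2 * (1 + d * curv \<gamma>1 \<gamma>2 a) else 2 * (1 + d * curv \<beta>1 \<beta>2 b))"

text \<open>For even \<open>j\<close> the neighbours carry the reversed coordinate, for odd
  \<open>j\<close> the vertex itself; either way the coefficient of \<open>h\<close> changes its
  sign relative to those of \<open>k\<close> and \<open>l\<close>.\<close>

lemma chart_recursion:
  assumes "\<eta> > 0"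
  obtains \<delta> where "\<delta> > 0"
    "\<And>j h k l. j > 0 \<Longrightarrow> \<bar>h\<bar> < \<delta> \<Longrightarrow> \<bar>k\<bar> < \<delta> \<Longrightarrow> \<bar>l\<bar> < \<delta> \<Longrightarrow>
      (\<And>w. w \<in> closure (\<O> (approach j)) \<Longrightarrow> dist (chart (j - 1) k) (chart j h) + dist (chart j h) (chart (j + 1) l)
          \<le> dist (chart (j - 1) k) w + dist w (chart (j + 1) l)) \<Longrightarrow>
      \<bar>k + l - recursion_coeff j * h\<bar> \<le> \<eta> * (\<bar>k\<bar> + \<bar>h\<bar> + \<bar>l\<bar>)"
    "\<And>j h k. j > 0 \<Longrightarrow> \<bar>h\<bar> < \<delta> \<Longrightarrow> \<bar>k\<bar> < \<delta> \<Longrightarrow>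
      (\<And>w. w \<in> closure (\<O> (approach j)) \<Longrightarrow> dist (chart (j - 1) k) (chart j h) \<le> dist (chart (j - 1) k) w) \<Longrightarrow>
      \<bar>k - recursion_coeff j / 2 * h\<bar> \<le> \<eta> * (\<bar>k\<bar> + \<bar>h\<bar>)"
proof -
  let ?ca = "1 + d * curv \<gamma>1 \<gamma>2 a" and ?cb = "1 + d * curv \<beta>1 \<beta>2 b"
  obtain \<delta>1 where 1: "\<delta>1 > 0"
    "\<And>h k l. \<bar>h\<bar> < \<delta>1 \<Longrightarrow> \<bar>k\<bar> < \<delta>1 \<Longrightarrow> \<bar>l\<bar> < \<delta>1 \<Longrightarrow>
      (\<And>w. w \<in> closure (\<O> w1) \<Longrightarrow> dist (\<beta> (b + k)) (\<gamma> (a + h)) + dist (\<gamma> (a + h)) (\<beta> (b + l))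
          \<le> dist (\<beta> (b + k)) w + dist w (\<beta> (b + l))) \<Longrightarrow>
      \<bar>k + l + 2 * ?ca * h\<bar> \<le> \<eta> * (\<bar>k\<bar> + \<bar>h\<bar> + \<bar>l\<bar>)"
    "\<And>h k. \<bar>h\<bar> < \<delta>1 \<Longrightarrow> \<bar>k\<bar> < \<delta>1 \<Longrightarrow>
      (\<And>w. w \<in> closure (\<O> w1) \<Longrightarrow> dist (\<beta> (b + k)) (\<gamma> (a + h)) \<le> dist (\<beta> (b + k)) w) \<Longrightarrow>
      \<bar>k + ?ca * h\<bar> \<le> \<eta> * (\<bar>k\<bar> + \<bar>h\<bar>)"
    using pair_critical_recursion[OF arc ga arc' gb assms] by blast
  obtain \<delta>2 where 2: "\<delta>2 > 0"
    "\<And>h k l. \<bar>h\<bar> < \<delta>2 \<Longrightarrow> \<bar>k\<bar> < \<delta>2 \<Longrightarrow> \<bar>l\<bar> < \<delta>2 \<Longrightarrow>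
      (\<And>w. w \<in> closure (\<O> w0) \<Longrightarrow> dist (\<gamma> (a + k)) (\<beta> (b + h)) + dist (\<beta> (b + h)) (\<gamma> (a + l))
          \<le> dist (\<gamma> (a + k)) w + dist w (\<gamma> (a + l))) \<Longrightarrow>
      \<bar>k + l + 2 * ?cb * h\<bar> \<le> \<eta> * (\<bar>k\<bar> + \<bar>h\<bar> + \<bar>l\<bar>)"
    "\<And>h k. \<bar>h\<bar> < \<delta>2 \<Longrightarrow> \<bar>k\<bar> < \<delta>2 \<Longrightarrow>
      (\<And>w. w \<in> closure (\<O> w0) \<Longrightarrow> dist (\<gamma> (a + k)) (\<beta> (b + h)) \<le> dist (\<gamma> (a + k)) w) \<Longrightarrow>
      \<bar>k + ?cb * h\<bar> \<le> \<eta> * (\<bar>k\<bar> + \<bar>h\<bar>)"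
    using opposite.pair_critical_recursion[OF arc' gb arc ga assms] by blast
  show ?thesis
  proof (rule that[of "min \<delta>1 \<delta>2"])
    fix j h k l
    assume j: "j > (0::nat)" and small: "\<bar>h\<bar> < min \<delta>1 \<delta>2" "\<bar>k\<bar> < min \<delta>1 \<delta>2" "\<bar>l\<bar> < min \<delta>1 \<delta>2"
      and min: "\<And>w. w \<in> closure (\<O> (approach j)) \<Longrightarrow> dist (chart (j - 1) k) (chart j h) + dist (chart j h) (chart (j + 1) l)
          \<le> dist (chart (j - 1) k) w + dist w (chart (j + 1) l)"
    show "\<bar>k + l - recursion_coeff j * h\<bar> \<le> \<eta> * (\<bar>k\<bar> + \<bar>h\<bar> + \<bar>l\<bar>)"
    proof (cases "even j")
      case True
      then have c: "approach j = w1" "chart (j - 1) k = \<beta> (b + - k)" "chart j h = \<gamma> (a + h)" "chart (j + 1) l = \<beta> (b + - l)"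
        using j by (auto simp: chart_def approach_word_def)
      have "\<bar>- k + - l + 2 * ?ca * h\<bar> \<le> \<eta> * (\<bar>- k\<bar> + \<bar>h\<bar> + \<bar>- l\<bar>)"
        by (rule 1(2)) (use small min c in auto)
      moreover have "\<bar>k + l - recursion_coeff j * h\<bar> = \<bar>- k + - l + 2 * ?ca * h\<bar>"
        using True abs_minus_cancel[of "k + l - recursion_coeff j * h"] by (simp add: recursion_coeff_def algebra_simps)
      ultimately show ?thesis by simp
    next
      case False
      then have c: "approach j = w0" "chart (j - 1) k = \<gamma> (a + k)" "chart j h = \<beta> (b + - h)" "chart (j + 1) l = \<gamma> (a + l)"
        using j by (auto simp: chart_def approach_word_def)
      have "\<bar>k + l + 2 * ?cb * (- h)\<bar> \<le> \<eta> * (\<bar>k\<bar> + \<bar>- h\<bar> + \<bar>l\<bar>)"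
        by (rule 2(2)) (use small min c in auto)
      then show ?thesis using False by (simp add: recursion_coeff_def)
    qed
  next
    fix j h k
    assume j: "j > (0::nat)" and small: "\<bar>h\<bar> < min \<delta>1 \<delta>2" "\<bar>k\<bar> < min \<delta>1 \<delta>2"
      and min: "\<And>w. w \<in> closure (\<O> (approach j)) \<Longrightarrow> dist (chart (j - 1) k) (chart j h) \<le> dist (chart (j - 1) k) w"
    show "\<bar>k - recursion_coeff j / 2 * h\<bar> \<le> \<eta> * (\<bar>k\<bar> + \<bar>h\<bar>)"
    proof (cases "even j")
      case True
      then have c: "approach j = w1" "chart (j - 1) k = \<beta> (b + - k)" "chart j h = \<gamma> (a + h)"
        using j by (auto simp: chart_def approach_word_def)
      have "\<bar>- k + ?ca * h\<bar> \<le> \<eta> * (\<bar>- k\<bar> + \<bar>h\<bar>)"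
        by (rule 1(3)) (use small min c in auto)
      moreover have "\<bar>k - recursion_coeff j / 2 * h\<bar> = \<bar>- k + ?ca * h\<bar>"
      proof -
        have "recursion_coeff j / 2 = ?ca" using True by (simp add: recursion_coeff_def)
        show ?thesis
          unfolding \<open>recursion_coeff j / 2 = ?ca\<close> using abs_minus_cancel[of "k - ?ca * h"] by simp
      qed
      ultimately show ?thesis by simp
    next
      case False
      then have c: "approach j = w0" "chart (j - 1) k = \<gamma> (a + k)" "chart j h = \<beta> (b + - h)"
        using j by (auto simp: chart_def approach_word_def)
      have "\<bar>k + ?cb * (- h)\<bar> \<le> \<eta> * (\<bar>k\<bar> + \<bar>- h\<bar>)"
        by (rule 2(3)) (use small min c in auto)
      moreover have half: "recursion_coeff j / 2 = ?cb" using False by (simp add: recursion_coeff_def)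
      ultimately show ?thesis unfolding half by simp
    qed
  qed (use 1 2 in auto)
qed

text \<open>\<open>j > 1\<close> ensures that the previous vertex lies on one of the two facing
  obstacles.\<close>

lemma chart_distance_lower:
  obtains c \<delta> where "c > 0" "\<delta> > 0"
    "\<And>j h y. j > 1 \<Longrightarrow> \<bar>h\<bar> < \<delta> \<Longrightarrow> y \<in> closure (\<O> (approach (j - 1))) \<Longrightarrow> d + c * h\<^sup>2 \<le> dist y (chart j h)"
proof -
  obtain c1 \<delta>1 where 1: "c1 > 0" "\<delta>1 > 0" "\<And>h y. \<bar>h\<bar> < \<delta>1 \<Longrightarrow> y \<in> closure (\<O> w0) \<Longrightarrow> d + c1 * h\<^sup>2 \<le> dist (\<gamma> (a + h)) y"
    using pair_distance_lower[OF arc ga arc' gb] by blast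
  obtain c2 \<delta>2 where 2: "c2 > 0" "\<delta>2 > 0" "\<And>h y. \<bar>h\<bar> < \<delta>2 \<Longrightarrow> y \<in> closure (\<O> w1) \<Longrightarrow> d + c2 * h\<^sup>2 \<le> dist (\<beta> (b + h)) y"
    using opposite.pair_distance_lower[OF arc' gb arc ga] by blast
  show ?thesis
  proof (rule that[of "min c1 c2" "min \<delta>1 \<delta>2"])
    fix j h y assume j: "j > (1::nat)" and h: "\<bar>h\<bar> < min \<delta>1 \<delta>2" and y: "y \<in> closure (\<O> (approach (j - 1)))"
    have le: "min c1 c2 * h\<^sup>2 \<le> c1 * h\<^sup>2" "min c1 c2 * h\<^sup>2 \<le> c2 * h\<^sup>2" by (auto intro: mult_right_mono)
    show "d + min c1 c2 * h\<^sup>2 \<le> dist y (chart j h)"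
    proof (cases "even j")
      case True
      then have "y \<in> closure (\<O> w0)" using y j by (auto simp: approach_word_def)
      then have "d + c1 * h\<^sup>2 \<le> dist (\<gamma> (a + h)) y" using 1(3) h by simp
      then show ?thesis using True le(1) by (simp add: chart_def dist_commute)
    next
      case False
      then have "y \<in> closure (\<O> w1)" using y j by (auto simp: approach_word_def)
      then have "d + c2 * (- h)\<^sup>2 \<le> dist (\<beta> (b + - h)) y" using 2(3)[of "- h"] h by simp
      then show ?thesis using False le(2) by (simp add: chart_def dist_commute)
    qed
  qed (use 1 2 in auto)
qed

lemma chart_distance_upper:
  obtains C where "C > 0"
    "\<And>j t. \<bar>t\<bar> \<le> half_period j \<Longrightarrow> dist (chart j t) (base_point (Suc j)) \<le> d + C * t\<^sup>2"
proof -
  obtain C1 where 1: "C1 > 0" "\<And>h. \<bar>h\<bar> \<le> T / 2 \<Longrightarrow> dist (\<gamma> (a + h)) B \<le> d + C1 * h\<^sup>2"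
    using pair_distance_upper[OF arc ga arc' gb] by blast
  obtain C2 where 2: "C2 > 0" "\<And>h. \<bar>h\<bar> \<le> T' / 2 \<Longrightarrow> dist (\<beta> (b + h)) A \<le> d + C2 * h\<^sup>2"
    using opposite.pair_distance_upper[OF arc' gb arc ga] by blast
  show ?thesis
  proof (rule that[of "max C1 C2"])
    fix j t assume t: "\<bar>t\<bar> \<le> half_period j"
    have le: "C1 * t\<^sup>2 \<le> max C1 C2 * t\<^sup>2" "C2 * t\<^sup>2 \<le> max C1 C2 * t\<^sup>2" by (auto intro: mult_right_mono)
    show "dist (chart j t) (base_point (Suc j)) \<le> d + max C1 C2 * t\<^sup>2"
    proof (cases "even j")
      case True
      then show ?thesis using 1(2)[of t] t le(1) by (simp add: chart_def base_point_def half_period_def)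
    next
      case False
      then show ?thesis using 2(2)[of "- t"] t le(2) by (simp add: chart_def base_point_def half_period_def)
    qed
  qed (use 1 in auto)
qed

text \<open>The value \<open>s m 0 = 1\<close> is arbitrary but nonzero, as the vertex on the third obstacle has no chart.\<close>

lemma minimizer_coordinates:
  assumes min: "\<And>m. chain_minimizer \<O> approach m (Z m)"
  obtains s where "\<And>m. s m 0 = 1"
    "\<And>m j. 0 < j \<Longrightarrow> j \<le> m \<Longrightarrow> chart j (s m j) = Z m j \<and> \<bar>s m j\<bar> \<le> half_period j"
    "\<And>m j. \<bar>s m j\<bar> \<le> max 1 (max T T')"
proof -
  \<comment> \<open>The common bound covers the default value 1 too; beyond \<open>m\<close> any
    value within the bound is allowed.\<close>
  define P where "P m j t \<longleftrightarrow> (j = 0 \<longrightarrow> t = 1) \<and>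
      (0 < j \<and> j \<le> m \<longrightarrow> chart j t = Z m j \<and> \<bar>t\<bar> \<le> half_period j) \<and> \<bar>t\<bar> \<le> max 1 (max T T')" for m j t
  define s where "s m j = (SOME t. P m j t)" for m j
  have ex: "\<exists>t. P m j t" for m j
  proof (cases "0 < j \<and> j \<le> m")
    case True
    then have "m > 0" by linarith
    have "Z m j \<in> frontier (\<O> (approach j))"
      by (rule chain_minimizer_frontier[OF tab \<open>m > 0\<close> min])
        (use True approach_word_step in auto)
    then obtain t where t: "\<bar>t\<bar> \<le> half_period j" "chart j t = Z m j" using chart_surj True by blast
    moreover have "half_period j \<le> max 1 (max T T')"
      using arc_param_period_pos[OF arc] arc_param_period_pos[OF arc'] by (auto simp: half_period_def)
    ultimately show ?thesis using True by (intro exI[of _ t]) (auto simp: P_def)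
  next
    case False
    then show ?thesis by (intro exI[of _ 1]) (auto simp: P_def)
  qed
  have "P m j (s m j)" for m j
    unfolding s_def by (rule someI_ex[OF ex])
  then show ?thesis by (intro that[of s]) (auto simp: P_def)
qed

lemma chart_lipschitz: "dist (chart j t) (base_point j) \<le> \<bar>t\<bar>"
  using arc_param_lipschitz[OF arc, of "a + t" a] arc_param_lipschitz[OF arc', of "b - t" b] ga gb
  by (simp add: chart_def base_point_def)

text \<open>Supplies the hypotheses of \<open>alternating_recursion_decay_rate\<close>: minimality
  at an inner vertex and at the free end gives the approximate equations, since coordinates are
  small from an index independent of \<open>m\<close> on; staying away from the orbit bounds each
  fixed coordinate from below, with the default value serving index 0.\<close>

lemma minimizer_coordinate_rate:
  fixes RE RO :: real
  assumes min: "\<And>m. chain_minimizer \<O> approach m (Z m)"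
    and s1: "\<And>m. s m 0 = 1"
    and s2: "\<forall>j m. 0 < j \<longrightarrow> j \<le> m \<longrightarrow> chart j (s m j) = Z m j \<and> \<bar>s m j\<bar> \<le> half_period j"
    and s3: "\<And>m j. \<bar>s m j\<bar> \<le> max 1 (max T T')"
    and R: "RE > 1" "RO > 1" "RE = 2 * (1 + d * curv \<gamma>1 \<gamma>2 a) - 1 / RO" "RO = 2 * (1 + d * curv \<beta>1 \<beta>2 b) - 1 / RE"
  shows "\<forall>\<^sub>F m in sequentially. s m m \<noteq> 0" "(\<lambda>m. ln \<bar>s m m\<bar> / real m) \<longlonglongrightarrow> - ln (RE * RO) / 2"
    "\<epsilon> > 0 \<Longrightarrow> \<forall>\<^sub>F m in sequentially. \<bar>s m m\<bar> < \<epsilon>"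
proof -
  note s = s1 s2[rule_format] s3
  have near: "\<exists>j0>0. \<forall>m j. j0 \<le> j \<and> j \<le> m \<longrightarrow> \<bar>s m j\<bar> < \<epsilon>" if \<epsilon>: "\<epsilon> > 0" for \<epsilon>
  proof -
    obtain \<delta> where \<delta>: "\<delta> > 0" "\<And>j t. \<bar>t\<bar> \<le> half_period j \<Longrightarrow> dist (chart j t) (base_point j) < \<delta> \<Longrightarrow> \<bar>t\<bar> < \<epsilon>"
      using chart_near[OF \<epsilon>] by blast
    obtain j0 where j0: "j0 > 0" "\<And>m j. j0 \<le> j \<Longrightarrow> j \<le> m \<Longrightarrow> dist (Z m j) (base_point j) < \<delta>"
      using minimizers_approach_base[OF min \<delta>(1)] by blast
    have "\<bar>s m j\<bar> < \<epsilon>" if "j0 \<le> j" "j \<le> m" for m j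
      using \<delta>(2)[of "s m j" j] s(2)[of j m] j0(1) j0(2)[OF that] that by auto
    then show ?thesis using j0(1) by blast
  qed
  show "\<forall>\<^sub>F m in sequentially. \<bar>s m m\<bar> < \<epsilon>" if "\<epsilon> > 0"
    using near[OF that] unfolding eventually_sequentially by blast
  have pos: "d * curv \<gamma>1 \<gamma>2 a > 0" "d * curv \<beta>1 \<beta>2 b > 0"
    using d curv_pos[OF arc] curv_pos[OF arc'] by auto
  have c: "(if even j then 2 * (1 + d * curv \<gamma>1 \<gamma>2 a) else 2 * (1 + d * curv \<beta>1 \<beta>2 b)) = recursion_coeff j" for j
    by (simp add: recursion_coeff_def)
  have rec: "\<exists>j0. \<forall>m j. j0 < j \<and> j < m \<longrightarrow>
      \<bar>s m (j - 1) + s m (j + 1) - recursion_coeff j * s m j\<bar> \<le> \<eta> * (\<bar>s m (j - 1)\<bar> + \<bar>s m j\<bar> + \<bar>s m (j + 1)\<bar>)"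
    and last: "\<exists>j0. \<forall>m>j0. \<bar>s m (m - 1) - recursion_coeff m / 2 * s m m\<bar> \<le> \<eta> * (\<bar>s m (m - 1)\<bar> + \<bar>s m m\<bar>)"
    if \<eta>: "\<eta> > 0" for \<eta>
  proof -
    obtain \<delta> where \<delta>: "\<delta> > 0"
      "\<And>j h k l. j > 0 \<Longrightarrow> \<bar>h\<bar> < \<delta> \<Longrightarrow> \<bar>k\<bar> < \<delta> \<Longrightarrow> \<bar>l\<bar> < \<delta> \<Longrightarrow>
        (\<And>w. w \<in> closure (\<O> (approach j)) \<Longrightarrow> dist (chart (j - 1) k) (chart j h) + dist (chart j h) (chart (j + 1) l)
            \<le> dist (chart (j - 1) k) w + dist w (chart (j + 1) l)) \<Longrightarrow>
        \<bar>k + l - recursion_coeff j * h\<bar> \<le> \<eta> * (\<bar>k\<bar> + \<bar>h\<bar> + \<bar>l\<bar>)"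
      "\<And>j h k. j > 0 \<Longrightarrow> \<bar>h\<bar> < \<delta> \<Longrightarrow> \<bar>k\<bar> < \<delta> \<Longrightarrow>
        (\<And>w. w \<in> closure (\<O> (approach j)) \<Longrightarrow> dist (chart (j - 1) k) (chart j h) \<le> dist (chart (j - 1) k) w) \<Longrightarrow>
        \<bar>k - recursion_coeff j / 2 * h\<bar> \<le> \<eta> * (\<bar>k\<bar> + \<bar>h\<bar>)"
      using chart_recursion[OF \<eta>] by blast
    obtain j0 where j0: "j0 > 0" "\<And>m j. j0 \<le> j \<Longrightarrow> j \<le> m \<Longrightarrow> \<bar>s m j\<bar> < \<delta>"
      using near[OF \<delta>(1)] by blast
    have 1: "\<bar>s m (j - 1) + s m (j + 1) - recursion_coeff j * s m j\<bar> \<le> \<eta> * (\<bar>s m (j - 1)\<bar> + \<bar>s m j\<bar> + \<bar>s m (j + 1)\<bar>)"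
      if j: "j0 < j" "j < m" for m j
    proof (rule \<delta>(2))
      show "j > 0" using j by simp
      show "\<bar>s m j\<bar> < \<delta>" "\<bar>s m (j - 1)\<bar> < \<delta>" "\<bar>s m (j + 1)\<bar> < \<delta>"
        using j0(2)[of j m] j0(2)[of "j - 1" m] j0(2)[of "j + 1" m] j by auto
      have e: "chart j (s m j) = Z m j" "chart (j - 1) (s m (j - 1)) = Z m (j - 1)"
        "chart (j + 1) (s m (j + 1)) = Z m (j + 1)"
        using s(2)[of j m] s(2)[of "j - 1" m] s(2)[of "j + 1" m] j j0(1) by auto
      show "dist (chart (j - 1) (s m (j - 1))) (chart j (s m j)) + dist (chart j (s m j)) (chart (j + 1) (s m (j + 1)))
            \<le> dist (chart (j - 1) (s m (j - 1))) w + dist w (chart (j + 1) (s m (j + 1)))"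
        if "w \<in> closure (\<O> (approach j))" for w
        unfolding e by (rule chain_minimizer_local(1)[OF min that]) (use j in auto)
    qed
    have 2: "\<bar>s m (m - 1) - recursion_coeff m / 2 * s m m\<bar> \<le> \<eta> * (\<bar>s m (m - 1)\<bar> + \<bar>s m m\<bar>)"
      if m: "j0 < m" for m
    proof (rule \<delta>(3))
      show "m > 0" using m by simp
      show "\<bar>s m m\<bar> < \<delta>" "\<bar>s m (m - 1)\<bar> < \<delta>" using j0(2)[of m m] j0(2)[of "m - 1" m] m by auto
      have e: "chart m (s m m) = Z m m" "chart (m - 1) (s m (m - 1)) = Z m (m - 1)"
        using s(2)[of m m] s(2)[of "m - 1" m] m j0(1) by auto
      show "dist (chart (m - 1) (s m (m - 1))) (chart m (s m m)) \<le> dist (chart (m - 1) (s m (m - 1))) w"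
        if "w \<in> closure (\<O> (approach m))" for w
        unfolding e by (rule chain_minimizer_local(3)[OF min that]) (use m in auto)
    qed
    show "\<exists>j0. \<forall>m j. j0 < j \<and> j < m \<longrightarrow>
      \<bar>s m (j - 1) + s m (j + 1) - recursion_coeff j * s m j\<bar> \<le> \<eta> * (\<bar>s m (j - 1)\<bar> + \<bar>s m j\<bar> + \<bar>s m (j + 1)\<bar>)"
      using 1 by blast
    show "\<exists>j0. \<forall>m>j0. \<bar>s m (m - 1) - recursion_coeff m / 2 * s m m\<bar> \<le> \<eta> * (\<bar>s m (m - 1)\<bar> + \<bar>s m m\<bar>)"
      using 2 by blast
  qed
  have lower: "\<exists>\<delta>>0. \<forall>\<^sub>F m in sequentially. \<delta> \<le> \<bar>s m j\<bar>" for j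
  proof (cases "j = 0")
    case True
    then show ?thesis using s(1) by (intro exI[of _ 1]) auto
  next
    case False
    then obtain \<delta> where \<delta>: "\<delta> > 0" "\<forall>\<^sub>F m in sequentially. \<delta> \<le> dist (Z m j) (base_point j)"
      using minimizers_stay_away[OF min] by blast
    have "\<forall>\<^sub>F m in sequentially. \<delta> \<le> \<bar>s m j\<bar>"
      using \<delta>(2) eventually_ge_at_top[of j]
    proof eventually_elim
      case (elim m)
      then have "chart j (s m j) = Z m j" using s(2)[of j m] False by simp
      then show ?case using chart_lipschitz[of j "s m j"] elim(1) by simp
    qed
    then show ?thesis using \<delta>(1) by blast
  qed
  note D = alternating_recursion_decay_rate[of "2 * (1 + d * curv \<gamma>1 \<gamma>2 a)" "2 * (1 + d * curv \<beta>1 \<beta>2 b)" RE RO s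
      "max 1 (max T T')", unfolded c, OF _ _ R rec last lower s(3)]
  show "\<forall>\<^sub>F m in sequentially. s m m \<noteq> 0" "(\<lambda>m. ln \<bar>s m m\<bar> / real m) \<longlonglongrightarrow> - ln (RE * RO) / 2"
    using D pos by auto
qed

text \<open>The upper bound for \<open>E - g m\<close> involves the last coordinate of the chain
  with \<open>m\<close> links, the lower bound that of the chain with \<open>m + 1\<close> links.
  Both coordinates have the same exponential rate, and squaring doubles it.\<close>

lemma approach_length_asymptotics:
  fixes RE RO :: real
  assumes min: "\<And>m. chain_minimizer \<O> approach m (Z m)"
    and R: "RE > 1" "RO > 1" "RE = 2 * (1 + d * curv \<gamma>1 \<gamma>2 a) - 1 / RO" "RO = 2 * (1 + d * curv \<beta>1 \<beta>2 b) - 1 / RE"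
  defines "g \<equiv> \<lambda>m. chain_length m (Z m) - real m * d"
  shows "\<exists>E. g \<longlonglongrightarrow> E \<and> (\<forall>\<^sub>F m in sequentially. g m < E) \<and>
    (\<lambda>m. ln (E - g m) / real m) \<longlonglongrightarrow> - ln (RE * RO)"
proof -
  obtain s where s: "\<And>m. s m 0 = 1"
    "\<And>m j. 0 < j \<Longrightarrow> j \<le> m \<Longrightarrow> chart j (s m j) = Z m j \<and> \<bar>s m j\<bar> \<le> half_period j"
    "\<And>m j. \<bar>s m j\<bar> \<le> max 1 (max T T')"
    using minimizer_coordinates[of Z, OF min] by blast
  have "\<forall>j m. 0 < j \<longrightarrow> j \<le> m \<longrightarrow> chart j (s m j) = Z m j \<and> \<bar>s m j\<bar> \<le> half_period j"
    using s(2) by blast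
  note rate = minimizer_coordinate_rate[of Z s, OF min s(1) this s(3) R]
  have mem: "\<And>m i. Z m i \<in> closure (\<O> (approach i))" using min by (simp add: chain_minimizer_def)
  obtain C where C: "C > 0" "\<And>j t. \<bar>t\<bar> \<le> half_period j \<Longrightarrow> dist (chart j t) (base_point (Suc j)) \<le> d + C * t\<^sup>2"
    using chart_distance_upper by blast
  obtain c \<delta> where c: "c > 0" "\<delta> > 0"
    "\<And>j h y. j > 1 \<Longrightarrow> \<bar>h\<bar> < \<delta> \<Longrightarrow> y \<in> closure (\<O> (approach (j - 1))) \<Longrightarrow> d + c * h\<^sup>2 \<le> dist y (chart j h)"
    using chart_distance_lower by blast
  \<comment> \<open>Cutting the last link of the longer minimizer gives a competitor for the shorter
    chain.\<close>
  have step: "g m + (dist (Z (Suc m) m) (Z (Suc m) (Suc m)) - d) \<le> g (Suc m)" for m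
  proof -
    have "chain_length m (Z m) \<le> chain_length m (Z (Suc m))"
      using min[of m] mem by (simp add: chain_minimizer_def)
    then show ?thesis by (simp add: g_def chain_length_def algebra_simps)
  qed
  have mono1: "g m \<le> g (Suc m)" if "m > 0" for m
    using step[of m] approach_separation(1)[OF that mem mem, of "Suc m" "Suc m"] by linarith
  have mono: "g m \<le> g n" if "0 < m" "m \<le> n" for m n
    using that(2)
  proof (induction rule: dec_induct)
    case (step n)
    then have "g n \<le> g (Suc n)" using mono1 that(1) by simp
    with step.IH show ?case by (rule order_trans)
  qed simp
  \<comment> \<open>Prolonging the shorter minimizer along the period two orbit gives a competitor
    for the longer chain.\<close>
  have up: "g n \<le> g m + C * (s m m)\<^sup>2" if m: "0 < m" "m < n" for m n
  proof -
    obtain k where k: "n = m + Suc k" using less_imp_Suc_add[OF m(2)] by auto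
    have "chain_length n (Z n) \<le> chain_length n (splice m (Z m))"
      by (rule chain_minimizer_le[OF min]) (rule splice_mem[OF mem])
    also have "\<dots> = chain_length m (Z m) + dist (Z m m) (base_point (Suc m)) + real k * d"
      unfolding k by (rule splice_length)
    also have "dist (Z m m) (base_point (Suc m)) \<le> d + C * (s m m)\<^sup>2"
      using C(2)[of "s m m" m] s(2)[OF m(1) order_refl] by simp
    finally show ?thesis by (simp add: g_def k algebra_simps)
  qed
  \<comment> \<open>The supremum starts at index 1: the first link comes from the third obstacle and
    may be shorter than \<open>d\<close>, so monotonicity is available only for positive
    indices.\<close>
  define E where "E = (SUP m. g (Suc m))"
  have bdd: "bdd_above (range (\<lambda>m. g (Suc m)))"
  proof (rule bdd_aboveI2)
    fix m
    show "g (Suc m) \<le> g 1 + C * (s 1 1)\<^sup>2"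
      using up[of 1 "Suc m"] C(1) by (cases "m = 0") auto
  qed
  have "incseq (\<lambda>m. g (Suc m))" by (intro incseq_SucI mono1) simp
  then have "(\<lambda>m. g (Suc m)) \<longlonglongrightarrow> E" unfolding E_def by (rule LIMSEQ_incseq_SUP[OF bdd])
  then have lim: "g \<longlonglongrightarrow> E" by (rule LIMSEQ_imp_Suc)
  have le: "g m \<le> E" if "m > 0" for m
    using cSUP_upper[OF _ bdd, of "m - 1"] that by (simp add: E_def)
  have upE: "E - g m \<le> C * (s m m)\<^sup>2" if "m > 0" for m
  proof -
    have "E \<le> g m + C * (s m m)\<^sup>2"
      by (rule LIMSEQ_le_const2[OF lim]) (use up[OF that] in \<open>auto intro!: exI[of _ "Suc m"]\<close>)
    then show ?thesis by simp
  qed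
  have small: "\<forall>\<^sub>F m in sequentially. \<bar>s (Suc m) (Suc m)\<bar> < \<delta>"
    using rate(3)[OF c(2)] eventually_sequentially_Suc[of "\<lambda>m. \<bar>s m m\<bar> < \<delta>"] by blast
  have nz: "\<forall>\<^sub>F m in sequentially. s (Suc m) (Suc m) \<noteq> 0"
    using rate(1) eventually_sequentially_Suc[of "\<lambda>m. s m m \<noteq> 0"] by blast
  have lowE: "\<forall>\<^sub>F m in sequentially. c * (s (Suc m) (Suc m))\<^sup>2 \<le> E - g m"
    using small eventually_gt_at_top[of 0]
  proof eventually_elim
    case (elim m)
    have "d + c * (s (Suc m) (Suc m))\<^sup>2 \<le> dist (Z (Suc m) m) (chart (Suc m) (s (Suc m) (Suc m)))"
      by (rule c(3)) (use elim mem in auto)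
    also have "chart (Suc m) (s (Suc m) (Suc m)) = Z (Suc m) (Suc m)" using s(2) by simp
    finally show ?case using step[of m] le[of "Suc m"] by simp
  qed
  have pos: "\<forall>\<^sub>F m in sequentially. g m < E"
    using lowE nz
  proof eventually_elim
    case (elim m)
    then have "0 < c * (s (Suc m) (Suc m))\<^sup>2" using c(1) by simp
    with elim show ?case by simp
  qed
  have "(\<lambda>m. ln (E - g m) / real m) \<longlonglongrightarrow> - ln (RE * RO)"
  proof (rule tendsto_sandwich)
    show "\<forall>\<^sub>F m in sequentially. ln c / real m + 2 * (ln \<bar>s (Suc m) (Suc m)\<bar> / real (Suc m)) * (1 + 1 / real m)
        \<le> ln (E - g m) / real m"
      using lowE nz eventually_gt_at_top[of 0]
    proof eventually_elim
      case (elim m)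
      define x where "x = s (Suc m) (Suc m)"
      have "ln (c * x\<^sup>2) \<le> ln (E - g m)"
        using elim c(1) by (intro ln_mono) (auto simp: x_def)
      moreover have "ln (c * x\<^sup>2) = ln c + 2 * ln \<bar>x\<bar>"
        using elim c(1) by (intro ln_mult_square) (auto simp: x_def)
      ultimately have "(ln c + 2 * ln \<bar>x\<bar>) / real m \<le> ln (E - g m) / real m"
        by (intro divide_right_mono) auto
      moreover have "ln c / real m + 2 * (ln \<bar>x\<bar> / real (Suc m)) * (1 + 1 / real m) = (ln c + 2 * ln \<bar>x\<bar>) / real m"
      proof -
        have "1 + 1 / real m = real (Suc m) / real m" using elim(3) by (simp add: field_simps)
        then show ?thesis by (simp add: add_divide_distrib del: of_nat_Suc)
      qed
      ultimately show ?case by (simp add: x_def)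
    qed
    show "\<forall>\<^sub>F m in sequentially. ln (E - g m) / real m \<le> ln C / real m + 2 * (ln \<bar>s m m\<bar> / real m)"
      using pos rate(1) eventually_gt_at_top[of 0]
    proof eventually_elim
      case (elim m)
      define x where "x = s m m"
      have "ln (E - g m) \<le> ln (C * x\<^sup>2)"
        using elim upE by (intro ln_mono) (auto simp: x_def)
      moreover have "ln (C * x\<^sup>2) = ln C + 2 * ln \<bar>x\<bar>"
        using elim C(1) by (intro ln_mult_square) (auto simp: x_def)
      ultimately have "ln (E - g m) / real m \<le> (ln C + 2 * ln \<bar>x\<bar>) / real m"
        by (intro divide_right_mono) auto
      then show ?case by (simp add: x_def add_divide_distrib)
    qed
    have r2: "(\<lambda>m. ln \<bar>s (Suc m) (Suc m)\<bar> / real (Suc m)) \<longlonglongrightarrow> - ln (RE * RO) / 2"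
      using LIMSEQ_Suc[OF rate(2)] .
    have "(\<lambda>m. ln c / real m + 2 * (ln \<bar>s (Suc m) (Suc m)\<bar> / real (Suc m)) * (1 + 1 / real m))
        \<longlonglongrightarrow> 0 + 2 * (- ln (RE * RO) / 2) * (1 + 0)"
      by (intro tendsto_intros r2 lim_const_over_n)
    then show "(\<lambda>m. ln c / real m + 2 * (ln \<bar>s (Suc m) (Suc m)\<bar> / real (Suc m)) * (1 + 1 / real m))
        \<longlonglongrightarrow> - ln (RE * RO)" by simp
    have "(\<lambda>m. ln C / real m + 2 * (ln \<bar>s m m\<bar> / real m)) \<longlonglongrightarrow> 0 + 2 * (- ln (RE * RO) / 2)"
      by (intro tendsto_intros rate(2) lim_const_over_n)
    then show "(\<lambda>m. ln C / real m + 2 * (ln \<bar>s m m\<bar> / real m)) \<longlonglongrightarrow> - ln (RE * RO)" by simp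
  qed
  with lim pos show ?thesis by blast
qed

end

end

subsection \<open>The period two orbit and the marked length spectrum\<close>

text \<open>If the incoming velocity is \<open>- v\<close> and the outgoing one \<open>v\<close>,
  the law of reflection makes \<open>v\<close> a multiple of \<open>n\<close>; unit norms and the
  sign leave \<open>v = n\<close>.\<close>

lemma eq_unit_normal_of_self_reflection:
  fixes v n :: "'a::real_inner"
  assumes "norm v = 1" "norm n = 1" "v \<bullet> n > 0" "v = - v - (2 * (- v \<bullet> n)) *\<^sub>R n"
  shows "n = v"
proof -
  have "2 *\<^sub>R v = (2 * (v \<bullet> n)) *\<^sub>R n"
    using assms(4) by (simp add: scaleR_2) (metis add.commute diff_add_cancel diff_minus_eq_add minus_diff_eq uminus_add_conv_diff)
  then have "2 *\<^sub>R v = 2 *\<^sub>R ((v \<bullet> n) *\<^sub>R n)" by simp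
  then have v: "v = (v \<bullet> n) *\<^sub>R n" unfolding scaleR_cancel_left by simp
  then have "norm v = \<bar>v \<bullet> n\<bar> * norm n" by (metis norm_scaleR)
  then have "v \<bullet> n = 1" using assms by simp
  with v show ?thesis by simp
qed

text \<open>The orbit is the folding of a shortest chain with a single link, that is, of the
  shortest segment between the two obstacles; it retraces itself, so both ends are
  perpendicular.\<close>

lemma period_two_orbit:
  assumes tab: "billiard_table \<O>" and w: "w1 \<noteq> w0"
  obtains A B e d where "facing_pair \<O> w1 w0 A B e d"
    "periodic_orbit \<O> [w1, w0] = (\<lambda>j. if even j then (A, e) else (B, - e))"
    "orbit_length \<O> [w1, w0] = 2 * d" "admissible [w1, w0]"
proof -
  define v :: "nat \<Rightarrow> 3" where "v j = (if even j then w1 else w0)" for j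
  obtain z where min: "chain_minimizer \<O> v (Suc 0) z" using chain_minimizer_exists[OF tab] by blast
  have v: "v j \<noteq> v (Suc j)" for j using w by (simp add: v_def)
  have fold: "fold_index (Suc 0) j = (if even j then 0 else 1)" for j
    by (auto simp: fold_index_def Let_def even_iff_mod_2_eq_zero odd_iff_mod_2_eq_one)
  have word: "periodic_word [w1, w0] j = v (fold_index (Suc 0) j)" for j
    unfolding fold by (auto simp: periodic_word_def v_def even_iff_mod_2_eq_zero odd_iff_mod_2_eq_one)
  have len: "length [w1, w0] = 2 * Suc 0" by simp
  note setting = tab zero_less_Suc min v
  note refl = folded_reflection[OF setting]
  define A B where "A = z 0" and "B = z (Suc 0)"
  define e d where "e = sgn (B - A)" and "d = norm (B - A)"
  have fr: "A \<in> frontier (\<O> w1)" "B \<in> frontier (\<O> w0)"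
    using refl(1)[of 0] refl(1)[of 1] by (simp_all add: fold v_def A_def B_def)
  have ne: "B \<noteq> A" using billiard_closures_disjoint[OF tab w] fr by (auto simp: frontier_def)
  have ne1: "norm e = 1" using ne by (simp add: e_def norm_sgn)
  have me: "sgn (A - B) = - e" unfolding e_def by (metis minus_diff_eq sgn_minus)
  have ob: "obstacle (\<O> l)" for l by (rule billiard_obstacle[OF tab])
  have nA: "unit_normal (\<O> w1) A = e"
    by (rule eq_unit_normal_of_self_reflection)
      (use ne1 unit_normal_props(1)[OF ob fr(1)] refl(3,4)[of 0] me in
        \<open>simp_all add: fold v_def flip: A_def B_def e_def\<close>)
  have nB: "unit_normal (\<O> w0) B = - e"
    by (rule eq_unit_normal_of_self_reflection)
      (use ne1 unit_normal_props(1)[OF ob fr(2)] refl(3,4)[of 1] me in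
        \<open>simp_all add: fold v_def flip: A_def B_def e_def\<close>)
  have BA: "B = A + d *\<^sub>R e" by (simp add: d_def e_def norm_scaleR_sgn)
  have orb: "periodic_orbit \<O> [w1, w0] = (\<lambda>j. if even j then (A, e) else (B, - e))"
    unfolding folded_periodic_orbit[OF setting len word]
    using me by (auto simp: folded_orbit_def fold fun_eq_iff e_def simp flip: A_def B_def)
  have "orbit_length \<O> [w1, w0] = 2 * d"
    unfolding folded_orbit_length[OF setting len word]
    by (simp add: chain_length_def d_def dist_norm norm_minus_commute flip: A_def B_def)
  moreover have "d > 0" using ne by (simp add: d_def)
  then have "facing_pair \<O> w1 w0 A B e d"
    by (rule facing_pair.intro[OF tab w fr nA nB _ BA])
  ultimately show ?thesis
    using that[OF _ orb _ folded_admissible[OF setting len word]] by simp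
qed

lemma sum_inverse_root:
  fixes t :: real
  assumes "t > 2"
  obtains M where "M > 1" "M + 1 / M = t"
proof -
  define q where "q = sqrt (t\<^sup>2 - 4)"
  have "t\<^sup>2 > 2\<^sup>2" using assms by (intro power_strict_mono) auto
  then have q: "q > 0" "q\<^sup>2 = t\<^sup>2 - 4" by (simp_all add: q_def)
  define M where "M = (t + q) / 2"
  have M: "M > 1" using q assms by (simp add: M_def)
  have "M\<^sup>2 + 1 = t * M" using q(2) by (simp add: M_def power2_eq_square field_simps)
  then have "M + 1 / M = t" using M by (simp add: field_simps power2_eq_square)
  with M that show ?thesis by blast
qed

lemma (in facing_pair) period_two_eigenvalues:
  assumes arc: "arclength_param (\<O> i) \<gamma>" "arc_param (\<O> i) T \<gamma> \<gamma>1 \<gamma>2" "\<gamma> a = A"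
    and arcB: "arc_param (\<O> j) T' \<beta> \<beta>1 \<beta>2" "\<beta> b = B"
    and M: "M > 0" "M + 1 / M = 4 * (1 + d * curv \<gamma>1 \<gamma>2 a) * (1 + d * curv \<beta>1 \<beta>2 b) - 2"
  shows "billiard_eigenvalues \<O> 2 (A, e) = {1 / M, M}"
proof -
  have one_point: "(\<exists>D w. D = m \<and> w \<noteq> 0 \<and> D w = c *\<^sub>R w) \<longleftrightarrow> (\<exists>w. w \<noteq> 0 \<and> m w = c *\<^sub>R w)"
    for m :: "real \<times> real \<Rightarrow> real \<times> real" and c by blast
  show ?thesis
    unfolding billiard_eigenvalues_def period_two_derivative_iff[OF arc arcB]
      one_point flight_return_eigenvalues[OF d curv_pos[OF arc(2)] curv_pos[OF arcB(1)] M]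
    by (rule Collect_mem_eq)
qed

section \<open>The periodic words as foldings of one infinite word\<close>

lemma nth_concat_replicate_pair:
  "k < 2 * n \<Longrightarrow> concat (replicate n [x, y]) ! k = (if even k then x else y)"
proof (induction n arbitrary: k)
  case (Suc n)
  show ?case
  proof (cases "k < 2")
    case True
    then show ?thesis by (auto simp: less_2_cases_iff)
  next
    case False
    then obtain l where "k = Suc (Suc l)" by (metis add_2_eq_Suc le_Suc_ex not_less)
    then show ?thesis using Suc by simp
  qed
qed simp

lemma length_approach_word: "length ([wt, w0] @ concat (replicate n [w1, w0])) = 2 * Suc n"
  by (induction n) auto

lemma periodic_approach_word:
  "periodic_word ([wt, w0] @ concat (replicate n [w1, w0])) j = approach_word wt w0 w1 (fold_index (Suc n) j)"
proof -
  define r where "r = nat (j mod int (2 * Suc n))"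
  have r: "r < 2 * Suc n" by (simp add: r_def nat_less_iff)
  have "([wt, w0] @ concat (replicate n [w1, w0])) ! r = approach_word wt w0 w1 r"
  proof (cases "r < 2")
    case True
    then show ?thesis by (auto simp: less_2_cases_iff approach_word_def)
  next
    case False
    then obtain l where l: "r = Suc (Suc l)" by (metis add_2_eq_Suc le_Suc_ex not_less)
    then show ?thesis using r nth_concat_replicate_pair[of l n w1 w0] by (simp add: approach_word_def)
  qed
  \<comment> \<open>The reflection from \<open>r\<close> to \<open>2 * Suc n - r\<close> preserves
    parity and does not reach the exceptional index 0.\<close>
  also have "\<dots> = approach_word wt w0 w1 (if r \<le> Suc n then r else 2 * Suc n - r)"
    using r by (auto simp: approach_word_def)
  finally show ?thesis
    unfolding periodic_word_def length_approach_word fold_index_def Let_def r_def by simp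
qed

text \<open>Gathers what is needed of a single table, both for the formula and for the comparison of
  two tables.\<close>

lemma table_asymptotics:
  assumes tab: "billiard_table \<O>" and w: "w1 \<noteq> w0" "wt \<noteq> w1" "wt \<noteq> w0"
  defines "L \<equiv> \<lambda>n. orbit_length \<O> ([wt, w0] @ concat (replicate n [w1, w0]))"
    and "L2 \<equiv> orbit_length \<O> [w1, w0]"
  obtains M Linf where "M > 1"
    "\<And>j. billiard_eigenvalues \<O> 2 (periodic_orbit \<O> [w1, w0] j) = {1 / M, M}"
    "lyapunov_exponent \<O> [w1, w0] = 1 / 2 * ln M"
    "(\<lambda>n. L n - (real n + 1) * L2) \<longlonglongrightarrow> Linf"
    "\<forall>\<^sub>F n in sequentially. - L n + (real n + 1) * L2 + Linf > 0"
    "(\<lambda>n. 1 / (2 * real n) * ln (- L n + (real n + 1) * L2 + Linf)) \<longlonglongrightarrow> - lyapunov_exponent \<O> [w1, w0]"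
    "admissible [w1, w0]" "\<And>n. admissible ([wt, w0] @ concat (replicate n [w1, w0]))"
proof -
  obtain A B e d where facing: "facing_pair \<O> w1 w0 A B e d"
    and orb: "periodic_orbit \<O> [w1, w0] = (\<lambda>j. if even j then (A, e) else (B, - e))"
    and L2: "L2 = 2 * d" and adm: "admissible [w1, w0]"
    unfolding L2_def by (rule period_two_orbit[OF tab w(1)])
  interpret facing_pair_third \<O> w1 w0 A B e d wt
    by (rule facing_pair_third.intro[OF facing facing_pair_third_axioms.intro[OF w(2,3)]])
  obtain \<gamma> where al: "arclength_param (\<O> w1) \<gamma>"
    using billiard_obstacle[OF tab, of w1] by (auto simp: obstacle_def)
  obtain \<beta> where al': "arclength_param (\<O> w0) \<beta>"
    using billiard_obstacle[OF tab, of w0] by (auto simp: obstacle_def)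
  obtain T \<gamma>1 \<gamma>2 where arc: "arc_param (\<O> w1) T \<gamma> \<gamma>1 \<gamma>2" using arclength_param_imp_arc_param[OF al] .
  obtain T' \<beta>1 \<beta>2 where arc': "arc_param (\<O> w0) T' \<beta> \<beta>1 \<beta>2" using arclength_param_imp_arc_param[OF al'] .
  obtain a where a: "\<gamma> a = A" using arc_param_surj[OF arc A] by blast
  obtain b where b: "\<beta> b = B" using arc_param_surj[OF arc' B] by blast
  define cE cO where "cE = 2 * (1 + d * curv \<gamma>1 \<gamma>2 a)" and "cO = 2 * (1 + d * curv \<beta>1 \<beta>2 b)"
  have c: "cE > 2" "cO > 2"
    using d curv_pos[OF arc] curv_pos[OF arc'] by (auto simp: cE_def cO_def)
  \<comment> \<open>Positive curvature makes the trace \<open>cE * cO - 2\<close> larger than 2,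
    hence the orbit hyperbolic.\<close>
  have "2 * 2 < cE * cO" using c by (intro mult_strict_mono) auto
  then obtain M where M: "M > 1" "M + 1 / M = cE * cO - 2"
    using sum_inverse_root[of "cE * cO - 2"] by auto
  have M1: "M + 1 / M = 4 * (1 + d * curv \<gamma>1 \<gamma>2 a) * (1 + d * curv \<beta>1 \<beta>2 b) - 2"
    "M + 1 / M = 4 * (1 + d * curv \<beta>1 \<beta>2 b) * (1 + d * curv \<gamma>1 \<gamma>2 a) - 2"
    using M(2) by (simp_all add: cE_def cO_def algebra_simps)
  have M0: "M > 0" using M by simp
  have eig: "billiard_eigenvalues \<O> 2 (periodic_orbit \<O> [w1, w0] j) = {1 / M, M}" for j
    using period_two_eigenvalues[OF al arc a arc' b M0 M1(1)]
      opposite.period_two_eigenvalues[OF al' arc' b arc a M0 M1(2)]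
    by (simp add: orb)
  have "unstable_eigenvalue \<O> [w1, w0] = M"
    unfolding unstable_eigenvalue_def
  proof (rule the_equality)
    show "1 < \<bar>M\<bar> \<and> (\<forall>j. M \<in> billiard_eigenvalues \<O> (length [w1, w0]) (periodic_orbit \<O> [w1, w0] j))"
      using M(1) eig by (simp add: numeral_2_eq_2)
    fix x
    assume "1 < \<bar>x\<bar> \<and> (\<forall>j. x \<in> billiard_eigenvalues \<O> (length [w1, w0]) (periodic_orbit \<O> [w1, w0] j))"
    then have "1 < \<bar>x\<bar>" "x \<in> {1 / M, M}" using eig by (auto simp: numeral_2_eq_2)
    then show "x = M" using M(1) by auto
  qed
  then have LE: "lyapunov_exponent \<O> [w1, w0] = 1 / 2 * ln M"
    using M(1) by (simp add: lyapunov_exponent_def)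
  \<comment> \<open>Imposing \<open>RE * RO = M\<close> turns \<open>RE = cE - 1 / RO\<close> into
    \<open>RE * (1 + 1 / M) = cE\<close>. The second equation then amounts to
    \<open>(M + 1) * (M + 1) = M * cE * cO\<close>, the equation for \<open>M\<close>.\<close>
  define RE RO where "RE = M * cE / (M + 1)" and "RO = (M + 1) / cE"
  have Msq: "(M + 1) * (M + 1) = M * cE * cO"
    using M by (simp add: field_simps)
  have RO': "RO = M * cO / (M + 1)"
    using Msq c M(1) by (simp add: RO_def field_simps)
  have RR: "RE * RO = M" using c M(1) by (simp add: RE_def RO_def)
  have gt1: "M * x / (M + 1) > 1" if "x > 2" for x
  proof -
    have "M * 2 < M * x" using that M(1) by simp
    then have "M + 1 < M * x" using M(1) by linarith
    then show ?thesis using M(1) by (simp add: less_divide_eq)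
  qed
  have R1: "RE > 1" "RO > 1" using gt1 c by (auto simp: RE_def RO')
  have R2: "RE = cE - 1 / RO" using c M(1) by (simp add: RE_def RO_def field_simps)
  have R3: "RO = cO - 1 / RE"
  proof -
    have "1 / RE = RO / M" using RR R1 M(1) by (simp add: field_simps)
    also have "\<dots> = cO / (M + 1)" using M(1) by (simp add: RO')
    finally show ?thesis using M(1) by (simp add: RO' field_simps)
  qed
  have "\<forall>m. \<exists>z. chain_minimizer \<O> (approach_word wt w0 w1) m z"
    using chain_minimizer_exists[OF tab] by blast
  from choice[OF this] obtain Z where Z: "\<And>m. chain_minimizer \<O> (approach_word wt w0 w1) m (Z m)"
    by blast
  define g where "g m = chain_length m (Z m) - real m * d" for m
  obtain E where E: "g \<longlonglongrightarrow> E" "\<forall>\<^sub>F m in sequentially. g m < E"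
    "(\<lambda>m. ln (E - g m) / real m) \<longlonglongrightarrow> - ln M"
    using approach_length_asymptotics[OF arc a arc' b Z R1 R2[unfolded cE_def] R3[unfolded cO_def]]
    unfolding g_def[abs_def] RR by blast
  \<comment> \<open>The word with \<open>n\<close> copies of \<sigma> folds a chain of
    \<open>n + 1\<close> links and has twice its length, while \<open>(n + 1) * L2\<close> is
    \<open>2 * (n + 1) * d\<close>. So the limit is \<open>2 * E\<close>.\<close>
  have Lg: "L n - (real n + 1) * L2 = 2 * g (Suc n)" and admn: "admissible ([wt, w0] @ concat (replicate n [w1, w0]))"
    for n
  proof -
    note S = tab zero_less_Suc Z[of "Suc n"] approach_word_step
    show "L n - (real n + 1) * L2 = 2 * g (Suc n)"
      unfolding L_def folded_orbit_length[OF S length_approach_word periodic_approach_word] L2 g_def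
      by (simp add: algebra_simps)
    show "admissible ([wt, w0] @ concat (replicate n [w1, w0]))"
      by (rule folded_admissible[OF S length_approach_word periodic_approach_word])
  qed
  have diff: "- L n + (real n + 1) * L2 + 2 * E = 2 * (E - g (Suc n))" for n
    using Lg[of n] by simp
  show ?thesis
  proof (rule that[OF M(1) eig LE _ _ _ adm admn])
    show "(\<lambda>n. L n - (real n + 1) * L2) \<longlonglongrightarrow> 2 * E"
      unfolding Lg by (intro tendsto_intros LIMSEQ_Suc E(1))
    have ev: "\<forall>\<^sub>F n in sequentially. g (Suc n) < E"
      using E(2) eventually_sequentially_Suc[of "\<lambda>m. g m < E"] by blast
    then show "\<forall>\<^sub>F n in sequentially. - L n + (real n + 1) * L2 + 2 * E > 0"
      unfolding diff by eventually_elim simp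
    \<comment> \<open>The summand \<open>ln 2\<close> comes from running along the chain twice, the
      factor \<open>1 + 1 / real n\<close> from dividing by \<open>n\<close> although the chain has
      \<open>n + 1\<close> links; neither affects the limit.\<close>
    have "(\<lambda>n. ln 2 / real n / 2 + ln (E - g (Suc n)) / real (Suc n) * (1 + 1 / real n) / 2)
        \<longlonglongrightarrow> 0 / 2 + (- ln M) * (1 + 0) / 2"
      by (intro tendsto_intros lim_const_over_n LIMSEQ_Suc[OF E(3)]) auto
    moreover have "\<forall>\<^sub>F n in sequentially.
        ln 2 / real n / 2 + ln (E - g (Suc n)) / real (Suc n) * (1 + 1 / real n) / 2 =
        1 / (2 * real n) * ln (- L n + (real n + 1) * L2 + 2 * E)"
      using ev eventually_gt_at_top[of 0]
    proof eventually_elim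
      case (elim n)
      have "ln (2 * (E - g (Suc n))) = ln 2 + ln (E - g (Suc n))"
        using elim by (intro ln_mult_pos) auto
      moreover have "1 + 1 / real n = real (Suc n) / real n" using elim by (simp add: field_simps)
      ultimately show ?case unfolding diff by (simp add: add_divide_distrib del: of_nat_Suc)
    qed
    ultimately show "(\<lambda>n. 1 / (2 * real n) * ln (- L n + (real n + 1) * L2 + 2 * E))
        \<longlonglongrightarrow> - lyapunov_exponent \<O> [w1, w0]"
      unfolding LE by (auto intro: Lim_transform_eventually)
  qed
qed

text \<open>All words in the formula are admissible, so both tables produce the same sequences; the
  limits of the differences agree first, then those of the logarithms.\<close>

lemma lyapunov_exponent_determined:
  assumes w: "w1 \<noteq> w0" "wt \<noteq> w1" "wt \<noteq> w0"
  shows "determined_by_MLS (\<lambda>\<O>. lyapunov_exponent \<O> [w1, w0])"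
  unfolding determined_by_MLS_def
proof (intro allI impI, elim conjE)
  fix \<O> \<O>' :: "3 \<Rightarrow> complex set"
  assume tab: "billiard_table \<O>" "billiard_table \<O>'"
    and mls: "marked_length_spectrum \<O> = marked_length_spectrum \<O>'"
  have eq: "orbit_length \<O> \<rho> = orbit_length \<O>' \<rho>" if "admissible \<rho>" for \<rho>
    using fun_cong[OF mls, of \<rho>] that by (simp add: marked_length_spectrum_def)
  define W where "W n = [wt, w0] @ concat (replicate n [w1, w0])" for n
  obtain L where L: "(\<lambda>n. orbit_length \<O> (W n) - (real n + 1) * orbit_length \<O> [w1, w0]) \<longlonglongrightarrow> L"
    "(\<lambda>n. 1 / (2 * real n) * ln (- orbit_length \<O> (W n) + (real n + 1) * orbit_length \<O> [w1, w0] + L))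
       \<longlonglongrightarrow> - lyapunov_exponent \<O> [w1, w0]"
    "admissible [w1, w0]" "\<And>n. admissible (W n)"
    by (rule table_asymptotics[OF tab(1) w, folded W_def]) (rule that; assumption)
  obtain L' where L': "(\<lambda>n. orbit_length \<O>' (W n) - (real n + 1) * orbit_length \<O>' [w1, w0]) \<longlonglongrightarrow> L'"
    "(\<lambda>n. 1 / (2 * real n) * ln (- orbit_length \<O>' (W n) + (real n + 1) * orbit_length \<O>' [w1, w0] + L'))
       \<longlonglongrightarrow> - lyapunov_exponent \<O>' [w1, w0]"
    by (rule table_asymptotics[OF tab(2) w, folded W_def]) (rule that; assumption)
  have "L = L'"
    using L(1) L'(1) unfolding eq[OF L(3)] eq[OF L(4)] by (rule LIMSEQ_unique)
  have "- lyapunov_exponent \<O> [w1, w0] = - lyapunov_exponent \<O>' [w1, w0]"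
    by (rule LIMSEQ_unique[OF L(2)[unfolded eq[OF L(3)] eq[OF L(4)] \<open>L = L'\<close>] L'(2)])
  then show "lyapunov_exponent \<O> [w1, w0] = lyapunov_exponent \<O>' [w1, w0]" by simp
qed

theorem corollaryB:
  fixes \<O> :: "3 \<Rightarrow> complex set"
    and \<sigma>\<^sub>0 \<sigma>\<^sub>1 \<tau>\<^sub>1 :: 3
    and \<sigma> \<tau> :: "3 list"
    and lam \<mu> :: real
  assumes "billiard_table \<O>"
    and "\<sigma> = [\<sigma>\<^sub>1, \<sigma>\<^sub>0]" and "\<sigma>\<^sub>0 \<noteq> \<sigma>\<^sub>1"
    and "{\<tau>\<^sub>1, \<sigma>\<^sub>0, \<sigma>\<^sub>1} = {1, 2, 3}" and "\<tau> = [\<tau>\<^sub>1, \<sigma>\<^sub>0]"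
    and "lam < 1" and "1 < \<mu>" and "\<mu> = inverse lam"
    and "\<forall>j. billiard_eigenvalues \<O> 2 (periodic_orbit \<O> \<sigma> j) = {lam, \<mu>}"
  shows "(\<exists>Linf.
      (\<lambda>n. orbit_length \<O> (\<tau> @ concat (replicate n \<sigma>)) - (real n + 1) * orbit_length \<O> \<sigma>)
         \<longlonglongrightarrow> Linf \<and>
      lyapunov_exponent \<O> \<sigma> = 1 / 2 * ln \<mu> \<and>
      1 / 2 * ln \<mu> = - (1 / 2) * ln lam \<and>
      (\<forall>\<^sub>F n in sequentially.
         - orbit_length \<O> (\<tau> @ concat (replicate n \<sigma>)) + (real n + 1) * orbit_length \<O> \<sigma> + Linf > 0) \<and>
      (\<lambda>n. 1 / (2 * real n) *
         ln (- orbit_length \<O> (\<tau> @ concat (replicate n \<sigma>)) + (real n + 1) * orbit_length \<O> \<sigma> + Linf))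
         \<longlonglongrightarrow> - lyapunov_exponent \<O> \<sigma>) \<and>
    determined_by_MLS (\<lambda>\<O>'. lyapunov_exponent \<O>' \<sigma>)"
proof -
  have "card {1, 2, 3 :: 3} = 3" by simp
  then have "card {\<tau>\<^sub>1, \<sigma>\<^sub>0, \<sigma>\<^sub>1} = 3" using assms(4) by simp
  then have w: "\<sigma>\<^sub>1 \<noteq> \<sigma>\<^sub>0" "\<tau>\<^sub>1 \<noteq> \<sigma>\<^sub>1" "\<tau>\<^sub>1 \<noteq> \<sigma>\<^sub>0"
    by (auto simp: card_insert_if split: if_splits)
  obtain M Linf where M: "M > 1"
    "\<And>j. billiard_eigenvalues \<O> 2 (periodic_orbit \<O> \<sigma> j) = {1 / M, M}"
    and concl: "lyapunov_exponent \<O> \<sigma> = 1 / 2 * ln M"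
    "(\<lambda>n. orbit_length \<O> (\<tau> @ concat (replicate n \<sigma>)) - (real n + 1) * orbit_length \<O> \<sigma>) \<longlonglongrightarrow> Linf"
    "\<forall>\<^sub>F n in sequentially.
       - orbit_length \<O> (\<tau> @ concat (replicate n \<sigma>)) + (real n + 1) * orbit_length \<O> \<sigma> + Linf > 0"
    "(\<lambda>n. 1 / (2 * real n) *
       ln (- orbit_length \<O> (\<tau> @ concat (replicate n \<sigma>)) + (real n + 1) * orbit_length \<O> \<sigma> + Linf))
       \<longlonglongrightarrow> - lyapunov_exponent \<O> \<sigma>"
    by (rule table_asymptotics[OF assms(1) w, folded assms(2) assms(5)]) (rule that; assumption)
  \<comment> \<open>The two descriptions of the spectrum are compared as sets; the positions
    relative to 1 tell which element is which.\<close>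
  have "{lam, \<mu>} = {1 / M, M}" using assms(9) M(2) by blast
  moreover have "1 / M < 1" using M(1) by simp
  ultimately have "\<mu> = M" "lam = 1 / M" using M(1) assms(6,7) by (auto simp: doubleton_eq_iff)
  moreover from this have "1 / 2 * ln \<mu> = - (1 / 2) * ln lam"
    using M(1) by (simp add: ln_div)
  ultimately show ?thesis
    using concl lyapunov_exponent_determined[OF w] unfolding assms(2) by blast
qed

end
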